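(* Let $P$ be a GT poset whose every closed interval is shellable. Then the category $\mathcal{F}(P)$ is a PL flow category. Furthermore, whenever $y\prec x$ in $P$, the space $\operatorname{Mor}_{\mathcal{F}(P)}(x,y)$ is PL-homeomorphic to a ball.
   Context: **Posets.** In a poset $(P,\preceq)$, $b$ covers $a$, written $a\leftarrow b$, if $a\prec b$ and there is no $z$ with $a\prec z\prec b$. A maximal element is an element $b$ with no $z$ satisfying $b\prec z$; a submaximal element is an element covered by a maximal element. A chain is a totally ordered subset; its length is its cardinality. The barycentric subdivision $B(P)$ is the poset of (nonempty) chains of $P$ ordered by inclusion. Maximal chains of $P$ are the maximal elements of $B(P)$. The order complex $X(P)$ is the simplicial complex whose $k$-simplices are the chains of $P$ of length $k+1$. Closed intervals are $[a,b]=\{z\in P\mid a\preceq z\preceq b\}$, and $[a,\infty)=\{z\in P\mid a\preceq z\}$. A poset is graded if in every interval all the maximal chains have the same length; lengths of closed intervals are understood to be finite. The Cartesian product $P\times Q$ has $(p',q')\preceq(p,q)$ iff $p'\preceq p$ and $q'\preceq q$; for finite posets, $X(P)\times X(Q)$ is naturally homeomorphic to $X(P\times Q)$ (via the two projections). **Shellable.** A graded poset is shellable if its maximal chains admit a total ordering $\le$ such that whenever $\mathfrak{m}_i<\mathfrak{m}_j$ there exist $\mathfrak{m}_k<\mathfrak{m}_j$ and $x\in\mathfrak{m}_j$ with $\mathfrak{m}_i\cap\mathfrak{m}_j\subseteq\mathfrak{m}_k\cap\mathfrak{m}_j=\mathfrak{m}_j\setminus\{x\}$. **GT posets.** A grading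 assignment on a poset $P$ is a map $g:P\to\mathbb{Z}$ with $g(b)=g(a)+1$ whenever $a\leftarrow b$. A poset in which every closed interval is graded is locally thin if every closed interval of length $3$ has exactly two maximal chains. A GT poset is a locally thin poset equipped with a grading assignment such that there are only finitely many elements in each grading. **PL flow categories.** A PL flow category $\mathcal{C}$ is a small category with the following additional structures and properties: - there is a grading assignment $g:\operatorname{Ob}_{\mathcal{C}}\to\mathbb{Z}$; - for any object $x$, $\operatorname{Mor}_{\mathcal{C}}(x,x)$ consists of only the identity; - for any two distinct objects $x,y$, $\operatorname{Mor}_{\mathcal{C}}(x,y)$ is a (possibly empty) $(g(x)-g(y)-1)$-dimensional PL-manifold (possibly with boundary); - for any objects $x,y,z$, the composition map $\operatorname{Mor}_{\mathcal{C}}(x,y)\times\operatorname{Mor}_{\mathcal{C}}(y,z)\to\operatorname{Mor}_{\mathcal{C}}(x,z)$ is a PL-embedding such that if $x,y,z$ are distinct, the image is a subspace of the boundary of $\operatorname{Mor}_{\mathcal{C}}(x,z)$; - if $p\in\operatorname{Mor}_{\mathcal{C}}(x,z)$ is a point on the boundary, then there exists $y\in\operatorname{Ob}_{\mathcal{C}}\setminus\{x,z\}$ such that $p$ is in the image of $\operatorname{Mor}_{\mathcal{C}}(x,y)\times\operatorname{Mor}_{\mathcal{C}}(y,z)\hookrightarrow\operatorname{Mor}_{\mathcal{C}}(x,z)$. **The category $\mathcal{F}(P)$.** For a GT poset $P$ whose every closed interval is shellable, the objects of $\mathcal{F}(P)$ are the elements of $P$, with grading assignment that of $P$. The space $\operatorname{Mor}_{\mathcal{F}(P)}(x,y)$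 is non-empty if and only if $y\preceq x$; $\operatorname{Mor}_{\mathcal{F}(P)}(x,x)$ consists of only the identity. If $y\prec x$, consider the barycentric subdivision $B([y,x])$ and in it the interval $[\{y,x\},\infty)$ (i.e. the poset of chains of $[y,x]$ containing both $y$ and $x$); then $\operatorname{Mor}_{\mathcal{F}(P)}(x,y)$ is defined to be its order complex $X([\{y,x\},\infty))$. For $z\prec y\prec x$, the Cartesian product of the poset $[\{y,x\},\infty)\subset B([y,x])$ and the poset $[\{z,y\},\infty)\subset B([z,y])$ is naturally isomorphic (by taking unions of chains) to the poset $[\{z,y,x\},\infty)\subset B([z,x])$, and the composition map $\operatorname{Mor}_{\mathcal{F}(P)}(x,y)\times\operatorname{Mor}_{\mathcal{F}(P)}(y,z)\to\operatorname{Mor}_{\mathcal{F}(P)}(x,z)$ is $$X([\{y,x\},\infty))\times X([\{z,y\},\infty))=X([\{y,x\},\infty)\times[\{z,y\},\infty))=X([\{z,y,x\},\infty))\hookrightarrow X([\{z,x\},\infty)).$$ *)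

theory Defs
  imports "HOL-Analysis.Analysis" "HOL-Library.Function_Algebras"
begin

section \<open>Posets\<close>

text \<open>A poset is a subset \<open>P\<close> of a type of class \<^class>\<open>order\<close>, with the induced order; its closed
  intervals are the sets \<open>P \<inter> {a..b}\<close> with \<open>a, b \<in> P\<close>, \<open>a \<le> b\<close>, and \<open>[a, \<infinity>)\<close> is \<open>P \<inter> {a..}\<close>.\<close>

definition covers :: "'a::order set \<Rightarrow> 'a \<Rightarrow> 'a \<Rightarrow> bool" where
  "covers P a b \<longleftrightarrow> a \<in> P \<and> b \<in> P \<and> a < b \<and> \<not> (\<exists>z\<in>P. a < z \<and> z < b)"

definition maximal_elements :: "'a::order set \<Rightarrow> 'a set" where
  "maximal_elements P = {b \<in> P. \<not> (\<exists>z\<in>P. b < z)}"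

definition barycentric_subdivision :: "'a::order set \<Rightarrow> 'a set set" where
  "barycentric_subdivision P = {C. C \<subseteq> P \<and> C \<noteq> {} \<and> Complete_Partial_Order.chain (\<le>) C}"

definition maximal_chains :: "'a::order set \<Rightarrow> 'a set set" where
  "maximal_chains P = maximal_elements (barycentric_subdivision P)"

text \<open>Lengths of closed intervals are finite, whence the condition \<open>finite m\<close>; without it, an
  infinite chain would have \<^const>\<open>card\<close> zero.\<close>

definition graded :: "'a::order set \<Rightarrow> bool" where
  "graded P \<longleftrightarrow> (\<forall>a\<in>P. \<forall>b\<in>P. a \<le> b \<longrightarrow>
     (\<exists>n. \<forall>m\<in>maximal_chains (P \<inter> {a..b}). finite m \<and> card m = n))"

definition shellable :: "'a::order set \<Rightarrow> bool" where
  "shellable P \<longleftrightarrow> graded P \<and>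
     (\<exists>r. linear_order_on (maximal_chains P) r \<and>
        (\<forall>mi\<in>maximal_chains P. \<forall>mj\<in>maximal_chains P. (mi, mj) \<in> r \<and> mi \<noteq> mj \<longrightarrow>
           (\<exists>mk\<in>maximal_chains P. (mk, mj) \<in> r \<and> mk \<noteq> mj \<and>
              (\<exists>x\<in>mj. mi \<inter> mj \<subseteq> mk \<inter> mj \<and> mk \<inter> mj = mj - {x}))))"

definition grading_assignment :: "'a::order set \<Rightarrow> ('a \<Rightarrow> int) \<Rightarrow> bool" where
  "grading_assignment P g \<longleftrightarrow> (\<forall>a b. covers P a b \<longrightarrow> g b = g a + 1)"

definition locally_thin :: "'a::order set \<Rightarrow> bool" where
  "locally_thin P \<longleftrightarrow>
     (\<forall>a\<in>P. \<forall>b\<in>P. a \<le> b \<longrightarrow> graded (P \<inter> {a..b})) \<and>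
     (\<forall>a\<in>P. \<forall>b\<in>P. a \<le> b \<and> (\<forall>m\<in>maximal_chains (P \<inter> {a..b}). card m = 3) \<longrightarrow>
        card (maximal_chains (P \<inter> {a..b})) = 2)"

definition GT_poset :: "'a::order set \<Rightarrow> ('a \<Rightarrow> int) \<Rightarrow> bool" where
  "GT_poset P g \<longleftrightarrow> locally_thin P \<and> grading_assignment P g \<and> (\<forall>k. finite {p \<in> P. g p = k})"


section \<open>Piecewise linear topology\<close>

text \<open>Function spaces \<open>'i \<Rightarrow> real\<close> are real vector spaces, pointwise. They already carry the product
  topology.\<close>

instantiation "fun" :: (type, real_vector) real_vector
begin

definition scaleR_fun :: "real \<Rightarrow> ('a \<Rightarrow> 'b) \<Rightarrow> 'a \<Rightarrow> 'b" where
  "scaleR_fun r f = (\<lambda>x. r *\<^sub>R f x)"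

instance
  by standard (auto simp: scaleR_fun_def plus_fun_def scaleR_add_right scaleR_add_left)

end

text \<open>Polyhedra in the sense of PL topology (neither convex nor compact in general): locally a finite
  union of polytopes. Likewise, a map is PL if it is locally affine on the pieces of such a
  decomposition; such maps are continuous. The ambient spaces below are \<open>'i \<Rightarrow> real\<close> and products of
  those, where \<open>'i\<close> may be infinite, but by definition a polyhedron is locally contained in a
  finite-dimensional subspace.\<close>

definition pl_polyhedron :: "'a::{real_vector,topological_space} set \<Rightarrow> bool" where
  "pl_polyhedron X \<longleftrightarrow>
     (\<forall>a\<in>X. \<exists>\<K> U. finite \<K> \<and> (\<forall>K\<in>\<K>. polytope K \<and> K \<subseteq> X) \<and>
        openin (top_of_set X) U \<and> a \<in> U \<and> U \<subseteq> \<Union>\<K>)"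

definition affine_map_on :: "'a::real_vector set \<Rightarrow> ('a \<Rightarrow> 'b::real_vector) \<Rightarrow> bool" where
  "affine_map_on K f \<longleftrightarrow>
     (\<forall>x\<in>K. \<forall>y\<in>K. \<forall>u\<in>{0..1}. f ((1 - u) *\<^sub>R x + u *\<^sub>R y) = (1 - u) *\<^sub>R f x + u *\<^sub>R f y)"

definition pl_map ::
  "('a::{real_vector,topological_space} \<Rightarrow> 'b::{real_vector,topological_space})
     \<Rightarrow> 'a set \<Rightarrow> 'b set \<Rightarrow> bool" where
  "pl_map f X Y \<longleftrightarrow> pl_polyhedron X \<and> pl_polyhedron Y \<and> f ` X \<subseteq> Y \<and>
     (\<forall>a\<in>X. \<exists>\<K> U. finite \<K> \<and> (\<forall>K\<in>\<K>. polytope K \<and> K \<subseteq> X \<and> affine_map_on K f) \<and>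
        openin (top_of_set X) U \<and> a \<in> U \<and> U \<subseteq> \<Union>\<K>)"

definition pl_homeomorphism ::
  "('a::{real_vector,topological_space} \<Rightarrow> 'b::{real_vector,topological_space})
     \<Rightarrow> 'a set \<Rightarrow> 'b set \<Rightarrow> bool" where
  "pl_homeomorphism f X Y \<longleftrightarrow> bij_betw f X Y \<and> pl_map f X Y \<and> pl_map (inv_into X f) Y X"

definition pl_homeomorphic ::
  "'a::{real_vector,topological_space} set \<Rightarrow> 'b::{real_vector,topological_space} set \<Rightarrow> bool" where
  "pl_homeomorphic X Y \<longleftrightarrow> (\<exists>f. pl_homeomorphism f X Y)"

definition pl_embedding ::
  "('a::{real_vector,topological_space} \<Rightarrow> 'b::{real_vector,topological_space})
     \<Rightarrow> 'a set \<Rightarrow> 'b set \<Rightarrow> bool" where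
  "pl_embedding f X Y \<longleftrightarrow> pl_map f X Y \<and> pl_homeomorphism f X (f ` X)"

definition pl_cube :: "nat \<Rightarrow> (nat \<Rightarrow> real) set" where
  "pl_cube n = {x \<in> topspace (Euclidean_space n). \<forall>i<n. - 1 \<le> x i \<and> x i \<le> 1}"

text \<open>The closed half-space of dimension \<open>n\<close>; for \<open>n = 0\<close> it is the one-point space \<open>\<real>\<^sup>0\<close>.\<close>

definition half_space :: "nat \<Rightarrow> (nat \<Rightarrow> real) topology" where
  "half_space n = subtopology (Euclidean_space n) {x. 0 \<le> x 0}"

text \<open>Manifolds may have boundary. The dimension is an integer; in negative dimensions, only the empty
  set is a manifold, and the empty set is a manifold of every dimension.\<close>

definition pl_manifold :: "int \<Rightarrow> 'a::{real_vector,topological_space} set \<Rightarrow> bool" where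
  "pl_manifold n X \<longleftrightarrow> pl_polyhedron X \<and> second_countable (top_of_set X) \<and>
     (\<forall>a\<in>X. 0 \<le> n \<and> (\<exists>U V. openin (top_of_set X) U \<and> a \<in> U \<and>
        openin (half_space (nat n)) V \<and> pl_homeomorphic U V))"

definition pl_interior :: "int \<Rightarrow> 'a::{real_vector,topological_space} set \<Rightarrow> 'a set" where
  "pl_interior n X = {a \<in> X. 0 \<le> n \<and> (\<exists>U V. openin (top_of_set X) U \<and> a \<in> U \<and>
     openin (Euclidean_space (nat n)) V \<and> pl_homeomorphic U V)}"

definition pl_boundary :: "int \<Rightarrow> 'a::{real_vector,topological_space} set \<Rightarrow> 'a set" where
  "pl_boundary n X = X - pl_interior n X"


section \<open>PL flow categories\<close>

text \<open>Composition is written in diagrammatic order, \<open>cmp x y z : Mor x y \<times> Mor y z \<rightarrow> Mor x z\<close>. Hom-sets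
  are families indexed by their endpoints, and so need not be disjoint.\<close>

locale hom_category =
  fixes Ob :: "'o set"
    and Mor :: "'o \<Rightarrow> 'o \<Rightarrow> 'm set"
    and ident :: "'o \<Rightarrow> 'm"
    and cmp :: "'o \<Rightarrow> 'o \<Rightarrow> 'o \<Rightarrow> 'm \<times> 'm \<Rightarrow> 'm"
  assumes ident_mor: "x \<in> Ob \<Longrightarrow> ident x \<in> Mor x x"
    and cmp_mor: "\<lbrakk>x \<in> Ob; y \<in> Ob; z \<in> Ob; p \<in> Mor x y; q \<in> Mor y z\<rbrakk> \<Longrightarrow> cmp x y z (p, q) \<in> Mor x z"
    and ident_left: "\<lbrakk>x \<in> Ob; y \<in> Ob; p \<in> Mor x y\<rbrakk> \<Longrightarrow> cmp x x y (ident x, p) = p"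
    and ident_right: "\<lbrakk>x \<in> Ob; y \<in> Ob; p \<in> Mor x y\<rbrakk> \<Longrightarrow> cmp x y y (p, ident y) = p"
    and assoc: "\<lbrakk>w \<in> Ob; x \<in> Ob; y \<in> Ob; z \<in> Ob; p \<in> Mor w x; q \<in> Mor x y; r \<in> Mor y z\<rbrakk>
      \<Longrightarrow> cmp w y z (cmp w x y (p, q), r) = cmp w x z (p, cmp x y z (q, r))"

text \<open>The case \<open>x = z\<close> is left out of \<open>boundary_cmp\<close>: there \<open>Mor x x\<close> is a point, which has no
  boundary, and which is not of dimension \<open>g x - g x - 1\<close>.\<close>

locale pl_flow_category = hom_category Ob Mor ident cmp
  for Ob :: "'o set"
    and g :: "'o \<Rightarrow> int"
    and Mor :: "'o \<Rightarrow> 'o \<Rightarrow> ('i \<Rightarrow> real) set"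
    and ident :: "'o \<Rightarrow> 'i \<Rightarrow> real"
    and cmp :: "'o \<Rightarrow> 'o \<Rightarrow> 'o \<Rightarrow> ('i \<Rightarrow> real) \<times> ('i \<Rightarrow> real) \<Rightarrow> 'i \<Rightarrow> real" +
  assumes Mor_self: "x \<in> Ob \<Longrightarrow> Mor x x = {ident x}"
    and Mor_manifold: "\<lbrakk>x \<in> Ob; y \<in> Ob; x \<noteq> y\<rbrakk> \<Longrightarrow> pl_manifold (g x - g y - 1) (Mor x y)"
    and cmp_embedding: "\<lbrakk>x \<in> Ob; y \<in> Ob; z \<in> Ob\<rbrakk>
      \<Longrightarrow> pl_embedding (cmp x y z) (Mor x y \<times> Mor y z) (Mor x z)"
    and cmp_boundary: "\<lbrakk>x \<in> Ob; y \<in> Ob; z \<in> Ob; x \<noteq> y; y \<noteq> z; x \<noteq> z\<rbrakk>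
      \<Longrightarrow> cmp x y z ` (Mor x y \<times> Mor y z) \<subseteq> pl_boundary (g x - g z - 1) (Mor x z)"
    and boundary_cmp: "\<lbrakk>x \<in> Ob; z \<in> Ob; x \<noteq> z; p \<in> pl_boundary (g x - g z - 1) (Mor x z)\<rbrakk>
      \<Longrightarrow> \<exists>y\<in>Ob - {x, z}. p \<in> cmp x y z ` (Mor x y \<times> Mor y z)"


section \<open>Order complexes\<close>

definition order_complex :: "'a::order set \<Rightarrow> 'a set set" where
  "order_complex P = {C \<in> barycentric_subdivision P. finite C}"

text \<open>Points of the geometric realization are given by their barycentric coordinates, so that the
  simplex \<open>C\<close> is the convex hull of the unit vectors indexed by \<open>C\<close>. Below, only finite posets are
  realized.\<close>

definition realization :: "'v set set \<Rightarrow> ('v \<Rightarrow> real) set" where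
  "realization K = {f. (\<forall>v. 0 \<le> f v) \<and> {v. f v \<noteq> 0} \<in> K \<and> (\<Sum>v | f v \<noteq> 0. f v) = 1}"

abbreviation order_space :: "'a::order set \<Rightarrow> ('a \<Rightarrow> real) set" where
  "order_space P \<equiv> realization (order_complex P)"

text \<open>The map of realizations which is affine on simplices and is \<open>\<phi>\<close> on vertices.\<close>

definition realize_map :: "('v \<Rightarrow> 'w) \<Rightarrow> ('v \<Rightarrow> real) \<Rightarrow> 'w \<Rightarrow> real" where
  "realize_map \<phi> f = (\<lambda>w. \<Sum>v | f v \<noteq> 0 \<and> \<phi> v = w. f v)"

text \<open>The inverse of the homeomorphism \<open>X(P \<times> Q) \<rightarrow> X(P) \<times> X(Q)\<close> induced by the two projections.
  The order on \<open>P \<times> Q\<close> is componentwise.\<close>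

definition product_iso ::
  "'a::order set \<Rightarrow> 'b::order set \<Rightarrow> ('a \<Rightarrow> real) \<times> ('b \<Rightarrow> real) \<Rightarrow> 'a \<times> 'b \<Rightarrow> real" where
  "product_iso P Q = inv_into (order_space (P \<times> Q)) (\<lambda>f. (realize_map fst f, realize_map snd f))"


section \<open>The category \<open>\<F>(P)\<close>\<close>

text \<open>The poset \<open>[{y, x}, \<infinity>)\<close> of chains of \<open>[y, x]\<close> containing both ends. It is empty unless \<open>y \<le> x\<close>,
  and for \<open>y = x\<close> its only element is \<open>{x}\<close>.\<close>

definition end_chains :: "'a::order set \<Rightarrow> 'a \<Rightarrow> 'a \<Rightarrow> 'a set set" where
  "end_chains P y x = barycentric_subdivision (P \<inter> {y..x}) \<inter> {{y, x}..}"

definition F_Mor :: "'a::order set \<Rightarrow> 'a \<Rightarrow> 'a \<Rightarrow> ('a set \<Rightarrow> real) set" where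
  "F_Mor P x y = order_space (end_chains P y x)"

text \<open>The vertex \<open>{x}\<close>, which is the only point of \<open>F_Mor P x x\<close>.\<close>

definition F_ident :: "'a::order \<Rightarrow> 'a set \<Rightarrow> real" where
  "F_ident x = (\<lambda>C. if C = {x} then 1 else 0)"

definition F_comp ::
  "'a::order set \<Rightarrow> 'a \<Rightarrow> 'a \<Rightarrow> 'a \<Rightarrow> ('a set \<Rightarrow> real) \<times> ('a set \<Rightarrow> real) \<Rightarrow> 'a set \<Rightarrow> real" where
  "F_comp P x y z =
     realize_map (\<lambda>(C, D). C \<union> D) \<circ> product_iso (end_chains P y x) (end_chains P z y)"

end

theory Submission
  imports Defs "HOL-Homology.Invariance_of_Domain"
begin

text \<open>Let \<open>\<Delta>\<close> be the order complex of the open interval between \<open>y\<close> and \<open>x\<close>. Sending a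
  chain to its indicator function identifies \<open>F_Mor P x y\<close> with the functions of maximum at most \<open>1\<close>
  in the cone \<open>C\<close> of nonnegative functions supported on simplices of \<open>\<Delta>\<close>; composition becomes
  gluing of functions. Thinness makes \<open>\<Delta>\<close> a closed pseudomanifold, and a shelling yields
  lattice-linear (hence homogeneous PL) mutually inverse maps between \<open>C\<close> and \<open>\<real>\<^sup>n\<close>: while facets are
  added, the cone over the facets so far is a half-space, and a new facet is the region between a
  part of the boundary hyperplane and the graph of a lattice-linear function over it, so it is
  absorbed by a shear. By invariance of domain, that function extends continuously by zero.

  The maximum becomes a lattice-linear gauge on \<open>\<real>\<^sup>n\<close>. Its unit ball is a PL manifold
  whose boundary is the unit sphere, that is, the functions that take the value \<open>1\<close> on the open
  interval, and these are the glued ones. Radial projection to the cube is not PL; instead, two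
  gauges are linear on the cones of a common central hyperplane arrangement, and choosing a unit
  vector in each cell triangulates both unit balls by the same complex.\<close>

section \<open>Polytopes in real vector spaces\<close>

text \<open>The usual argument for shellable complexes glues balls along discs in their boundaries
  and needs collars or regular neighbourhoods. Working with the whole cone replaces this by one
  global change of coordinates per facet, and lattice-linear formulas survive composition, so that
  no subdivision is carried through the induction. The obstacle is the edge of the glued part. The
  shear extends over the boundary hyperplane only if its depth is 0 off the new facet
  \<open>F\<close>, that is, if a boundary point that is nonzero at all vertices of
  \<open>F - R\<close> already lies in the cone over \<open>F\<close>. This holds because a
  hyperplane has no room for a second sheet. Level functions also undo the barycentric subdivision:
  \<open>F_Mor P x y\<close> becomes a cone over \<Delta> itself, whose tip is the chain consisting
  of the two ends. A point lies in the image of a composition over \<open>z\<close> exactly if all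
  chains in its support pass through \<open>z\<close>, that is, if its level at \<open>z\<close> is
  1.\<close>

lemma affine_map_on_subset: "affine_map_on K f \<Longrightarrow> L \<subseteq> K \<Longrightarrow> affine_map_on L f"
  unfolding affine_map_on_def by blast

lemma affine_map_on_cong: "affine_map_on K f \<Longrightarrow> convex K \<Longrightarrow> (\<And>x. x \<in> K \<Longrightarrow> f x = g x) \<Longrightarrow> affine_map_on K g"
  unfolding affine_map_on_def convex_alt by (metis atLeastAtMost_iff)

lemma affine_map_on_linear: "linear f \<Longrightarrow> affine_map_on K f"
  unfolding affine_map_on_def by (simp add: linear_add linear_scale)

lemma affine_map_on_ident: "affine_map_on K (\<lambda>x. x)"
  unfolding affine_map_on_def by simp

lemma affine_map_on_comp:
  "affine_map_on K f \<Longrightarrow> affine_map_on (f ` K) g \<Longrightarrow> affine_map_on K (\<lambda>x. g (f x))"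
  unfolding affine_map_on_def by simp

lemma affine_map_on_Pair:
  "affine_map_on K f \<Longrightarrow> affine_map_on K g \<Longrightarrow> affine_map_on K (\<lambda>x. (f x, g x))"
  unfolding affine_map_on_def by simp

lemma affine_map_on_const: "affine_map_on K (\<lambda>x. c)"
  unfolding affine_map_on_def by (simp add: algebra_simps)

lemma affine_map_onD:
  assumes "affine_map_on K f" "x \<in> K" "y \<in> K" "0 \<le> u" "0 \<le> v" "u + v = 1"
  shows "f (u *\<^sub>R x + v *\<^sub>R y) = u *\<^sub>R f x + v *\<^sub>R f y"
proof -
  have "v \<in> {0..1}" "u = 1 - v" using assms by auto
  then show ?thesis using assms(1-3) unfolding affine_map_on_def by blast
qed

lemma convex_affine_image:
  assumes "affine_map_on K f" "convex K" shows "convex (f ` K)"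
proof (rule convexI, clarify)
  fix x y :: 'a and u v :: real
  assume h: "0 \<le> u" "0 \<le> v" "u + v = 1" "x \<in> K" "y \<in> K"
  then have "u *\<^sub>R f x + v *\<^sub>R f y = f (u *\<^sub>R x + v *\<^sub>R y)"
    using affine_map_onD[OF assms(1)] by simp
  then show "u *\<^sub>R f x + v *\<^sub>R f y \<in> f ` K"
    using convexD[OF assms(2)] h by blast
qed

text \<open>The points of the hull that \<open>f\<close> maps into the hull of the images form a
  convex set containing \<open>W\<close>.\<close>

lemma affine_image_convex_hull:
  assumes "affine_map_on (convex hull W) f"
  shows "f ` (convex hull W) = convex hull (f ` W)"
proof
  have "convex {x \<in> convex hull W. f x \<in> convex hull (f ` W)}"
  proof (rule convexI)
    fix x y :: 'a and u v :: real
    assume "x \<in> {x \<in> convex hull W. f x \<in> convex hull (f ` W)}"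
      "y \<in> {x \<in> convex hull W. f x \<in> convex hull (f ` W)}" and uv: "0 \<le> u" "0 \<le> v" "u + v = 1"
    then have h: "x \<in> convex hull W" "y \<in> convex hull W"
      "f x \<in> convex hull (f ` W)" "f y \<in> convex hull (f ` W)" by auto
    show "u *\<^sub>R x + v *\<^sub>R y \<in> {x \<in> convex hull W. f x \<in> convex hull (f ` W)}"
      using convexD[OF convex_convex_hull h(1,2) uv] convexD[OF convex_convex_hull h(3,4) uv]
        affine_map_onD[OF assms h(1,2) uv] by simp
  qed
  then have "convex hull W \<subseteq> {x \<in> convex hull W. f x \<in> convex hull (f ` W)}"
    by (intro hull_minimal) (auto intro: hull_inc)
  then show "f ` (convex hull W) \<subseteq> convex hull (f ` W)" by auto
  show "convex hull (f ` W) \<subseteq> f ` (convex hull W)"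
    by (intro hull_minimal image_mono hull_subset convex_affine_image assms convex_convex_hull)
qed

lemma polytope_affine_image:
  assumes "affine_map_on K f" "polytope K" shows "polytope (f ` K)"
proof -
  obtain W where "finite W" "K = convex hull W" using assms(2) by (auto simp: polytope_def)
  then show ?thesis using affine_image_convex_hull[of W f] assms(1) by (metis finite_imageI polytope_def)
qed

text \<open>A polytope meets a half-space in the convex hull of its vertices \<open>u\<close> inside and of the points where
  segments from these to the vertices \<open>w\<close> outside cross the hyperplane. With \<open>\<alpha>\<close> and \<open>\<beta>\<close> the distances
  to the hyperplane, a convex combination \<open>c\<close> of vertices is rewritten by giving the crossing point of
  \<open>u\<close> and \<open>w\<close> a weight proportional to \<open>c u * c w * (\<alpha> u + \<beta> w)\<close>.\<close>

lemma coupling_sum: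
  fixes f :: "'a \<Rightarrow> 'b::real_vector" and c \<alpha> \<beta> :: "'a \<Rightarrow> real"
  assumes "A = (\<Sum>u\<in>P. c u * \<alpha> u)" "B = (\<Sum>w\<in>N. c w * \<beta> w)" "A \<noteq> 0"
  shows "(\<Sum>u\<in>P. \<Sum>w\<in>N. (c u * c w / A) *\<^sub>R (\<beta> w *\<^sub>R f u + \<alpha> u *\<^sub>R f w)) =
    (B / A) *\<^sub>R (\<Sum>u\<in>P. c u *\<^sub>R f u) + (\<Sum>w\<in>N. c w *\<^sub>R f w)"
proof -
  have "(\<Sum>u\<in>P. \<Sum>w\<in>N. (c u * c w / A) *\<^sub>R (\<beta> w *\<^sub>R f u + \<alpha> u *\<^sub>R f w))
     = (\<Sum>u\<in>P. \<Sum>w\<in>N. (c u * c w / A * \<beta> w) *\<^sub>R f u) + (\<Sum>u\<in>P. \<Sum>w\<in>N. (c u * c w / A * \<alpha> u) *\<^sub>R f w)"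
    by (simp add: scaleR_add_right sum.distrib)
  also have "(\<Sum>u\<in>P. \<Sum>w\<in>N. (c u * c w / A * \<beta> w) *\<^sub>R f u) = (B / A) *\<^sub>R (\<Sum>u\<in>P. c u *\<^sub>R f u)"
  proof -
    have "(\<Sum>w\<in>N. (c u * c w / A * \<beta> w) *\<^sub>R f u) = (B / A) *\<^sub>R c u *\<^sub>R f u" for u
    proof -
      have "(\<Sum>w\<in>N. (c u * c w / A * \<beta> w) *\<^sub>R f u) = (\<Sum>w\<in>N. c w * \<beta> w * (c u / A)) *\<^sub>R f u"
        by (simp add: scaleR_sum_left mult_ac)
      also have "(\<Sum>w\<in>N. c w * \<beta> w * (c u / A)) = B * (c u / A)"
        by (simp only: sum_distrib_right[symmetric] assms(2)[symmetric])
      finally show ?thesis by (simp add: mult_ac)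
    qed
    then show ?thesis by (simp only: scaleR_sum_right)
  qed
  also have "(\<Sum>u\<in>P. \<Sum>w\<in>N. (c u * c w / A * \<alpha> u) *\<^sub>R f w) = (\<Sum>w\<in>N. \<Sum>u\<in>P. (c u * c w / A * \<alpha> u) *\<^sub>R f w)"
    by (rule sum.swap)
  also have "\<dots> = (\<Sum>w\<in>N. c w *\<^sub>R f w)"
  proof (rule sum.cong[OF refl])
    fix w
    have "(\<Sum>u\<in>P. (c u * c w / A * \<alpha> u) *\<^sub>R f w) = (\<Sum>u\<in>P. c u * \<alpha> u * (c w / A)) *\<^sub>R f w"
      by (simp add: scaleR_sum_left mult_ac)
    also have "(\<Sum>u\<in>P. c u * \<alpha> u * (c w / A)) = c w"
      using assms(3) by (simp only: sum_distrib_right[symmetric] assms(1)[symmetric]) simp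
    finally show "(\<Sum>u\<in>P. (c u * c w / A * \<alpha> u) *\<^sub>R f w) = c w *\<^sub>R f w" .
  qed
  finally show ?thesis .
qed

text \<open>One sum over the inner vertices, with the weight left over by the coupling, and over the
  crossing points. It serves twice: for the points themselves, where it returns \<open>x\<close>,
  and for the constant 1, where it shows that the new weights add up to 1. The second condition on
  \<open>f\<close> is stated without division so as to fit both.\<close>

lemma coupling_sum_Plus:
  fixes f :: "'a + 'a \<times> 'a \<Rightarrow> 'b::real_vector" and c \<alpha> \<beta> :: "'a \<Rightarrow> real"
  assumes fin: "finite P" "finite N"
    and AB: "A = (\<Sum>u\<in>P. c u * \<alpha> u)" "B = (\<Sum>w\<in>N. c w * \<beta> w)" "A \<noteq> 0"
    and b: "\<And>u. b (Inl u) = c u * (1 - B / A)"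
      "\<And>u w. b (Inr (u, w)) = c u * c w * (\<alpha> u + \<beta> w) / A"
    and f: "\<And>u. f (Inl u) = g u"
      "\<And>u w. u \<in> P \<Longrightarrow> w \<in> N \<Longrightarrow> (\<alpha> u + \<beta> w) *\<^sub>R f (Inr (u,w)) = \<beta> w *\<^sub>R g u + \<alpha> u *\<^sub>R g w"
  shows "(\<Sum>i\<in>P <+> (P \<times> N). b i *\<^sub>R f i) = (\<Sum>u\<in>P. c u *\<^sub>R g u) + (\<Sum>w\<in>N. c w *\<^sub>R g w)"
proof -
  have "(\<Sum>i\<in>P <+> (P \<times> N). b i *\<^sub>R f i) = (\<Sum>u\<in>P. b (Inl u) *\<^sub>R f (Inl u)) + (\<Sum>p\<in>P\<times>N. b (Inr p) *\<^sub>R f (Inr p))"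
    using fin by (simp add: sum.Plus)
  also have "(\<Sum>p\<in>P\<times>N. b (Inr p) *\<^sub>R f (Inr p)) = (\<Sum>u\<in>P. \<Sum>w\<in>N. b (Inr (u,w)) *\<^sub>R f (Inr (u,w)))"
    by (simp add: sum.cartesian_product split_def)
  also have "\<dots> = (\<Sum>u\<in>P. \<Sum>w\<in>N. (c u * c w / A) *\<^sub>R (\<beta> w *\<^sub>R g u + \<alpha> u *\<^sub>R g w))"
    by (intro sum.cong refl) (simp add: b f(2)[symmetric])
  also have "\<dots> = (B / A) *\<^sub>R (\<Sum>u\<in>P. c u *\<^sub>R g u) + (\<Sum>w\<in>N. c w *\<^sub>R g w)"
    by (rule coupling_sum[OF AB])
  also have "(\<Sum>u\<in>P. b (Inl u) *\<^sub>R f (Inl u)) = (1 - B / A) *\<^sub>R (\<Sum>u\<in>P. c u *\<^sub>R g u)"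
    by (simp add: b f(1) scaleR_sum_right mult.commute)
  finally show ?thesis by (simp add: algebra_simps)
qed

lemma polytope_halfspace:
  fixes l :: "'a::real_vector \<Rightarrow> real"
  assumes "linear l" "polytope K"
  shows "polytope {x \<in> K. a \<le> l x}"
proof -
  obtain W where W: "finite W" "K = convex hull W" using assms(2) by (auto simp: polytope_def)
  define P where "P = {w \<in> W. a \<le> l w}"
  define N where "N = {w \<in> W. l w < a}"
  define z where "z u w = ((a - l w) / (l u - l w)) *\<^sub>R u + ((l u - a) / (l u - l w)) *\<^sub>R w" for u w
  define Y where "Y = P \<union> (\<lambda>(u,w). z u w) ` (P \<times> N)"
  have fin: "finite P" "finite N" using W(1) by (auto simp: P_def N_def)
  have PN: "W = P \<union> N" "P \<inter> N = {}" by (auto simp: P_def N_def)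
  have finY: "finite Y" using fin by (auto simp: Y_def)
  have "{x \<in> K. a \<le> l x} = convex hull Y"
  proof
    have "{x \<in> K. a \<le> l x} = K \<inter> l -` {a..}" by auto
    then have cv: "convex {x \<in> K. a \<le> l x}"
      using W(2) convex_linear_vimage[OF assms(1), of "{a..}"] by (simp add: convex_Int)
    have "z u w \<in> K \<and> a \<le> l (z u w)" if "u \<in> P" "w \<in> N" for u w
    proof
      have lt: "l w < a" "a \<le> l u" "l u - l w > 0" using that by (auto simp: P_def N_def)
      have "u \<in> K" "w \<in> K" using that W by (auto simp: P_def N_def hull_inc)
      moreover have "(a - l w) / (l u - l w) + (l u - a) / (l u - l w) = 1"
        using lt by (simp add: add_divide_distrib[symmetric])
      ultimately show "z u w \<in> K" unfolding z_def W(2)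
        using lt convexD[OF convex_convex_hull, of u W w "(a - l w) / (l u - l w)" "(l u - a) / (l u - l w)"] by simp
      have "l (z u w) = (a - l w) / (l u - l w) * l u + (l u - a) / (l u - l w) * l w"
        using assms(1) by (simp add: z_def linear_add linear_scale)
      also have "\<dots> = a"
      proof -
        have "((a - l w) * l u + (l u - a) * l w) = a * (l u - l w)" by (simp add: algebra_simps)
        then show ?thesis using lt by (simp add: add_divide_distrib[symmetric])
      qed
      finally show "a \<le> l (z u w)" by simp
    qed
    then have "Y \<subseteq> {x \<in> K. a \<le> l x}"
      unfolding Y_def using W by (auto simp: P_def hull_inc)
    then show "convex hull Y \<subseteq> {x \<in> K. a \<le> l x}" using cv by (rule hull_minimal)
    show "{x \<in> K. a \<le> l x} \<subseteq> convex hull Y"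
    proof clarify
      fix x assume "x \<in> K" and ax: "a \<le> l x"
      then obtain c where c: "\<And>v. v \<in> W \<Longrightarrow> 0 \<le> c v" "sum c W = 1" "(\<Sum>v\<in>W. c v *\<^sub>R v) = x"
        unfolding W(2) convex_hull_finite[OF W(1)] by auto
      define A where "A = (\<Sum>u\<in>P. c u * (l u - a))"
      define B where "B = (\<Sum>w\<in>N. c w * (a - l w))"
      have cP: "c u \<ge> 0" "l u - a \<ge> 0" if "u \<in> P" for u using that c(1) by (auto simp: P_def)
      have cN: "c w \<ge> 0" "a - l w > 0" if "w \<in> N" for w using that c(1) by (auto simp: N_def)
      have A0: "A \<ge> 0" unfolding A_def using cP by (intro sum_nonneg mult_nonneg_nonneg) auto
      have B0: "B \<ge> 0" unfolding B_def using cN by (intro sum_nonneg mult_nonneg_nonneg) (auto simp: less_imp_le)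
      have sP: "sum f W = sum f P + sum f N" for f :: "'a \<Rightarrow> 'b::comm_monoid_add"
        unfolding PN(1) using fin PN(2) by (rule sum.union_disjoint)
      \<comment> \<open>\<open>A - B\<close> is the signed distance of \<open>x\<close> from the
        hyperplane, so \<open>B \<le> A\<close>: the inner vertices carry enough weight to be
        coupled with all the outer ones, and the remaining factor \<open>1 - B / A\<close> is
        nonnegative. If \<open>A = 0\<close>, the outer weights vanish.\<close>
      have "l x - a = (\<Sum>v\<in>W. c v * (l v - a))"
        using assms(1) c(2) by (simp add: c(3)[symmetric] linear_sum linear_scale algebra_simps sum_subtractf sum_distrib_left[symmetric])
      also have "\<dots> = A - B" unfolding sP A_def B_def by (simp add: sum_subtractf algebra_simps)
      finally have AB: "B \<le> A" using ax by simp
      show "x \<in> convex hull Y"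
      proof (cases "A = 0")
        case True
        with AB B0 have "B = 0" by simp
        then have "c w * (a - l w) = 0" if "w \<in> N" for w
          using that fin(2) cN sum_nonneg_eq_0_iff[OF fin(2), of "\<lambda>w. c w * (a - l w)"]
          unfolding B_def by (simp add: less_imp_le)
        then have "c w = 0" if "w \<in> N" for w using that cN(2)[OF that] by fastforce
        then have "x = (\<Sum>u\<in>P. c u *\<^sub>R u)" "sum c P = 1" using c(2,3) unfolding sP by auto
        then show ?thesis
          using convex_sum[OF fin(1) convex_convex_hull[of Y], of c "\<lambda>u. u"] cP
          by (auto simp: Y_def hull_inc)
      next
        case False
        then have Ap: "A > 0" using A0 by simp
        define b where "b i = (case i of Inl u \<Rightarrow> c u * (1 - B / A) | Inr (u, w) \<Rightarrow> c u * c w * (l u - l w) / A)" for i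
        define y where "y i = (case i of Inl u \<Rightarrow> u | Inr (u, w) \<Rightarrow> z u w)" for i
        have b0: "b i \<ge> 0" if i: "i \<in> P <+> (P \<times> N)" for i
          using i
        proof (rule PlusE)
          fix u assume u: "u \<in> P" "i = Inl u"
          have "0 \<le> 1 - B / A" using AB Ap by simp
          with u show ?thesis using cP(1)[OF u(1)] by (simp add: b_def)
        next
          fix p assume "p \<in> P \<times> N" "i = Inr p"
          then obtain u w where u: "u \<in> P" "w \<in> N" "i = Inr (u, w)" by auto
          have "0 \<le> l u - l w" using cP(2)[OF u(1)] cN(2)[OF u(2)] by simp
          with u Ap show ?thesis using cP(1)[OF u(1)] cN(1)[OF u(2)] by (simp add: b_def)
        qed
        have yY: "y i \<in> convex hull Y" if "i \<in> P <+> (P \<times> N)" for i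
          using that unfolding y_def Y_def by (auto intro!: hull_inc)
        note sm = coupling_sum_Plus[OF fin A_def B_def False, of b]
        have "(\<Sum>i\<in>P <+> (P \<times> N). b i *\<^sub>R y i) = (\<Sum>u\<in>P. c u *\<^sub>R u) + (\<Sum>w\<in>N. c w *\<^sub>R w)"
        proof (rule sm)
          fix u w assume "u \<in> P" "w \<in> N"
          then have "l u - l w \<noteq> 0" by (auto simp: P_def N_def)
          then show "((l u - a) + (a - l w)) *\<^sub>R y (Inr (u, w)) = (a - l w) *\<^sub>R u + (l u - a) *\<^sub>R w"
            by (simp add: y_def z_def scaleR_add_right)
        qed (auto simp: y_def b_def)
        then have x: "(\<Sum>i\<in>P <+> (P \<times> N). b i *\<^sub>R y i) = x" using c(3) sP by metis
        have "(\<Sum>i\<in>P <+> (P \<times> N). b i *\<^sub>R (1::real)) = (\<Sum>u\<in>P. c u *\<^sub>R 1) + (\<Sum>w\<in>N. c w *\<^sub>R 1)"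
          by (rule sm) (auto simp: b_def)
        then have "sum b (P <+> (P \<times> N)) = 1" using c(2) sP[of c] by simp
        then show ?thesis
          using convex_sum[OF _ convex_convex_hull[of Y], of "P <+> (P \<times> N)" b y] fin b0 yY x by auto
      qed
    qed
  qed
  then show ?thesis using finY by (auto simp: polytope_def)
qed

lemma polytope_hyperplane:
  fixes l :: "'a::real_vector \<Rightarrow> real"
  assumes "linear l" "polytope K"
  shows "polytope {x \<in> K. l x = a}"
proof -
  have "polytope {x \<in> {x \<in> K. a \<le> l x}. - a \<le> - l x}"
    by (rule polytope_halfspace[OF linear_compose_neg[OF assms(1)] polytope_halfspace[OF assms]])
  moreover have "{x \<in> {x \<in> K. a \<le> l x}. - a \<le> - l x} = {x \<in> K. l x = a}" by auto
  ultimately show ?thesis by simp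
qed

text \<open>A basis of \<open>span S\<close> has finitely many coordinate functionals, extended to
  the whole space. They turn a vector equation on a polytope into finitely many scalar ones, even if
  the ambient space has infinite dimension.\<close>

lemma separating_functionals:
  fixes S :: "'a::real_vector set"
  assumes "finite S"
  obtains \<Phi> :: "('a \<Rightarrow> real) set" where "finite \<Phi>" "\<And>\<phi>. \<phi> \<in> \<Phi> \<Longrightarrow> linear \<phi>"
    "\<And>y. y \<in> span S \<Longrightarrow> (\<And>\<phi>. \<phi> \<in> \<Phi> \<Longrightarrow> \<phi> y = 0) \<Longrightarrow> y = 0"
proof -
  obtain B where B: "B \<subseteq> S" "independent B" "S \<subseteq> span B"
    using maximal_independent_subset by blast
  have fB: "finite B" using B(1) assms finite_subset by blast
  have "\<exists>g::'a\<Rightarrow>real. linear g \<and> (\<forall>x\<in>B. g x = (if x = b then 1 else 0))" for b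
    by (rule linear_independent_extend[OF B(2)])
  then obtain g where g0: "\<And>b. linear (g b) \<and> (\<forall>x\<in>B. g b x = (if x = b then 1 else (0::real)))"
    by metis
  then have g: "\<And>b. b \<in> B \<Longrightarrow> linear (g b)"
    "\<And>b x. b \<in> B \<Longrightarrow> x \<in> B \<Longrightarrow> g b x = (if x = b then 1 else (0::real))" by auto
  show ?thesis
  proof (rule that[of "g ` B"])
    fix y assume y: "y \<in> span S" "\<And>\<phi>. \<phi> \<in> g ` B \<Longrightarrow> \<phi> y = 0"
    have "y \<in> span B" using y(1) B(3) by (meson span_minimal subspace_span subsetD)
    then obtain u where u: "y = (\<Sum>b\<in>B. u b *\<^sub>R b)" using span_finite[OF fB] by auto
    have "u b = 0" if "b \<in> B" for b
    proof -
      have "g b y = (\<Sum>x\<in>B. u x * g b x)" unfolding u using g(1)[OF that] by (simp add: linear_sum linear_scale)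
      also have "\<dots> = (\<Sum>x\<in>B. if x = b then u x else 0)"
        by (rule sum.cong) (auto simp: g(2) that)
      also have "\<dots> = u b" using fB that by simp
      finally show ?thesis using y(2)[of "g b"] that by simp
    qed
    then show "y = 0" by (simp add: u)
  qed (use fB g(1) in auto)
qed

lemma polytope_kernel:
  fixes L :: "'a::real_vector \<Rightarrow> 'b::real_vector"
  assumes L: "linear L" and "polytope K"
  shows "polytope {x \<in> K. L x = 0}"
proof -
  obtain W where W: "finite W" "K = convex hull W" using assms(2) by (auto simp: polytope_def)
  obtain \<Phi> :: "('b \<Rightarrow> real) set" where \<Phi>: "finite \<Phi>" "\<And>\<phi>. \<phi> \<in> \<Phi> \<Longrightarrow> linear \<phi>"
    "\<And>y. y \<in> span (L ` W) \<Longrightarrow> (\<And>\<phi>. \<phi> \<in> \<Phi> \<Longrightarrow> \<phi> y = 0) \<Longrightarrow> y = 0"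
    using separating_functionals[of "L ` W"] W(1) by auto
  have sub: "L x \<in> span (L ` W)" if "x \<in> K" for x
    using that convex_hull_subset_span[of W] W(2) linear_span_image[OF L, of W] by blast
  have eq: "{x \<in> K. L x = 0} = {x \<in> K. \<forall>\<phi>\<in>\<Phi>. \<phi> (L x) = 0}"
    using \<Phi>(3)[OF sub] \<Phi>(2) linear_0 by force
  have "polytope {x \<in> K. \<forall>\<phi>\<in>\<Psi>. \<phi> (L x) = 0}" if "finite \<Psi>" "\<Psi> \<subseteq> \<Phi>" for \<Psi>
    using that
  proof (induction \<Psi>)
    case (insert \<phi> \<Psi>)
    have "polytope {x \<in> {x \<in> K. \<forall>\<phi>\<in>\<Psi>. \<phi> (L x) = 0}. (\<phi> \<circ> L) x = 0}"
      using insert \<Phi>(2) by (intro polytope_hyperplane linear_compose L) auto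
    moreover have "{x \<in> {x \<in> K. \<forall>\<phi>\<in>\<Psi>. \<phi> (L x) = 0}. (\<phi> \<circ> L) x = 0} = {x \<in> K. \<forall>\<phi>\<in>insert \<phi> \<Psi>. \<phi> (L x) = 0}"
      by auto
    ultimately show ?case by simp
  qed (use assms in simp)
  then show ?thesis unfolding eq using \<Phi>(1) by blast
qed

text \<open>\<open>f\<close> is affine on \<open>K\<close> only and need not be the restriction of a
  linear map. The set is therefore obtained as the projection of a fibre product: the pairs in the
  product of the graph of \<open>f\<close> with \<open>L\<close> whose last entries agree form a
  linear section of a polytope.\<close>

lemma polytope_affine_vimage:
  assumes f: "affine_map_on K f" and K: "polytope K" and L: "polytope L"
  shows "polytope {x \<in> K. f x \<in> L}"
proof -
  let ?G = "(\<lambda>x. (x, f x)) ` K"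
  let ?D = "{p \<in> ?G \<times> L. snd (fst p) - snd p = 0}"
  have "polytope ?G"
    by (rule polytope_affine_image[OF affine_map_on_Pair[OF affine_map_on_ident f] K])
  then have "polytope ?D" by (intro polytope_kernel polytope_Times L) (auto intro!: linearI simp: algebra_simps)
  then have "polytope ((fst \<circ> fst) ` ?D)"
    by (intro polytope_linear_image linear_compose linear_fst)
  moreover have "(fst \<circ> fst) ` ?D = {x \<in> K. f x \<in> L}"
  proof (intro equalityI subsetI)
    fix x assume "x \<in> {x \<in> K. f x \<in> L}"
    then have "((x, f x), f x) \<in> ?D" "x = (fst \<circ> fst) ((x, f x), f x)" by auto
    then show "x \<in> (fst \<circ> fst) ` ?D" by (rule rev_image_eqI)
  qed auto
  ultimately show ?thesis by simp
qed

lemma polytope_Int_polytope: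
  fixes K :: "'a::real_vector set"
  shows "polytope K \<Longrightarrow> polytope L \<Longrightarrow> polytope (K \<inter> L)"
  using polytope_affine_vimage[of K "\<lambda>x. x" L] affine_map_on_ident[of K]
  by (simp add: Int_def)

lemma polytope_affine_le:
  fixes f :: "'a::real_vector \<Rightarrow> real"
  assumes f: "affine_map_on K f" and K: "polytope K"
  shows "polytope {x \<in> K. a \<le> f x}"
proof -
  let ?G = "(\<lambda>x. (x, f x)) ` K"
  have "polytope ?G"
    by (rule polytope_affine_image[OF affine_map_on_Pair[OF affine_map_on_ident f] K])
  then have "polytope (fst ` {p \<in> ?G. a \<le> snd p})"
    by (intro polytope_linear_image[OF linear_fst] polytope_halfspace[OF linear_snd])
  moreover have "fst ` {p \<in> ?G. a \<le> snd p} = {x \<in> K. a \<le> f x}"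
  proof (intro equalityI subsetI)
    fix x assume "x \<in> {x \<in> K. a \<le> f x}"
    then have "(x, f x) \<in> {p \<in> ?G. a \<le> snd p}" "x = fst (x, f x)" by auto
    then show "x \<in> fst ` {p \<in> ?G. a \<le> snd p}" by (rule rev_image_eqI)
  qed auto
  ultimately show ?thesis by simp
qed

section \<open>Piecewise affine maps\<close>

text \<open>The condition is tested on polytopes inside \<open>X\<close> and involves no topology,
  so \<open>X\<close> may be any set, such as an unbounded cone. Restriction is then immediate,
  composition only pulls pieces back, and \<open>pl_mapI\<close> yields PL maps between
  polyhedra.\<close>

definition piecewise_affine_on :: "'a::real_vector set \<Rightarrow> ('a \<Rightarrow> 'b::real_vector) \<Rightarrow> bool" where
  "piecewise_affine_on X f \<longleftrightarrow> (\<forall>K. polytope K \<and> K \<subseteq> X \<longrightarrow>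
     (\<exists>\<K>. finite \<K> \<and> \<Union>\<K> = K \<and> (\<forall>L\<in>\<K>. polytope L \<and> affine_map_on L f)))"

definition compact_polyhedron :: "'a::real_vector set \<Rightarrow> bool" where
  "compact_polyhedron X \<longleftrightarrow> (\<exists>\<K>. finite \<K> \<and> (\<forall>K\<in>\<K>. polytope K) \<and> \<Union>\<K> = X)"

lemma piecewise_affine_onE:
  assumes "piecewise_affine_on X f" "polytope K" "K \<subseteq> X"
  obtains \<K> where "finite \<K>" "\<Union>\<K> = K" "\<And>L. L \<in> \<K> \<Longrightarrow> polytope L" "\<And>L. L \<in> \<K> \<Longrightarrow> affine_map_on L f"
  using assms unfolding piecewise_affine_on_def by meson

lemma piecewise_affine_onI:
  assumes "\<And>K. polytope K \<Longrightarrow> K \<subseteq> X \<Longrightarrow>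
    \<exists>\<K>. finite \<K> \<and> \<Union>\<K> = K \<and> (\<forall>L\<in>\<K>. polytope L \<and> affine_map_on L f)"
  shows "piecewise_affine_on X f"
  using assms unfolding piecewise_affine_on_def by blast

lemma piecewise_affine_on_subset: "piecewise_affine_on X f \<Longrightarrow> Y \<subseteq> X \<Longrightarrow> piecewise_affine_on Y f"
  unfolding piecewise_affine_on_def by (meson subset_trans)

lemma affine_imp_piecewise: "(\<And>K. affine_map_on K f) \<Longrightarrow> piecewise_affine_on X f"
  by (rule piecewise_affine_onI) (metis ccpo_Sup_singleton finite.emptyI finite_insert singletonD)

lemma piecewise_affine_on_linear: "linear f \<Longrightarrow> piecewise_affine_on X f"
  by (intro affine_imp_piecewise affine_map_on_linear)

lemma piecewise_affine_on_const: "piecewise_affine_on X (\<lambda>x. c)"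
  by (intro affine_imp_piecewise affine_map_on_const)

lemma piecewise_affine_on_ident: "piecewise_affine_on X (\<lambda>x. x)"
  by (intro affine_imp_piecewise affine_map_on_ident)

lemma piecewise_affine_on_cong:
  assumes "piecewise_affine_on X f" "\<And>x. x \<in> X \<Longrightarrow> f x = g x"
  shows "piecewise_affine_on X g"
proof (rule piecewise_affine_onI)
  fix K assume K: "polytope K" "K \<subseteq> X"
  obtain \<K> where *: "finite \<K>" "\<Union>\<K> = K" "\<And>L. L \<in> \<K> \<Longrightarrow> polytope L" "\<And>L. L \<in> \<K> \<Longrightarrow> affine_map_on L f"
    using piecewise_affine_onE[OF assms(1) K] by metis
  have "affine_map_on L g" if "L \<in> \<K>" for L
    using *(4)[OF that] polytope_imp_convex[OF *(3)[OF that]]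
    by (rule affine_map_on_cong) (use assms(2) that *(2) K(2) in blast)
  with * show "\<exists>\<K>. finite \<K> \<and> \<Union>\<K> = K \<and> (\<forall>L\<in>\<K>. polytope L \<and> affine_map_on L g)" by blast
qed

lemma polytopes_refine:
  assumes "finite \<K>" "\<And>K. K \<in> \<K> \<Longrightarrow> \<exists>\<L>. finite \<L> \<and> \<Union>\<L> = K \<and> (\<forall>L\<in>\<L>. polytope L \<and> Q L)"
  shows "\<exists>\<L>. finite \<L> \<and> \<Union>\<L> = \<Union>\<K> \<and> (\<forall>L\<in>\<L>. polytope L \<and> Q L)"
proof -
  obtain F where F: "\<And>K. K \<in> \<K> \<Longrightarrow> finite (F K) \<and> \<Union>(F K) = K \<and> (\<forall>L\<in>F K. polytope L \<and> Q L)"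
    using assms(2) by metis
  show ?thesis
  proof (intro exI[of _ "\<Union>(F ` \<K>)"] conjI)
    have "\<Union>(\<Union>(F ` \<K>)) = (\<Union>K\<in>\<K>. \<Union>(F K))" by auto
    also have "\<dots> = \<Union>\<K>" using F by simp
    finally show "\<Union>(\<Union>(F ` \<K>)) = \<Union>\<K>" .
  qed (use F assms(1) in auto)
qed

lemma piecewise_affine_on_comp:
  assumes f: "piecewise_affine_on X f" and fX: "f ` X \<subseteq> Y" and g: "piecewise_affine_on Y g"
  shows "piecewise_affine_on X (\<lambda>x. g (f x))"
proof (rule piecewise_affine_onI)
  fix K assume K: "polytope K" "K \<subseteq> X"
  obtain \<K> where *: "finite \<K>" "\<Union>\<K> = K" "\<And>L. L \<in> \<K> \<Longrightarrow> polytope L" "\<And>L. L \<in> \<K> \<Longrightarrow> affine_map_on L f"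
    using piecewise_affine_onE[OF f K] by metis
  have "\<exists>\<L>. finite \<L> \<and> \<Union>\<L> = L \<and> (\<forall>M\<in>\<L>. polytope M \<and> affine_map_on M (\<lambda>x. g (f x)))" if L: "L \<in> \<K>" for L
  proof -
    have "polytope (f ` L)" "f ` L \<subseteq> Y" using polytope_affine_image *(3,4) L *(2) K fX by blast+
    then obtain \<M> where **: "finite \<M>" "\<Union>\<M> = f ` L" "\<And>L. L \<in> \<M> \<Longrightarrow> polytope L" "\<And>L. L \<in> \<M> \<Longrightarrow> affine_map_on L g"
      using piecewise_affine_onE[OF g] by metis
    show ?thesis
    proof (rule exI[of _ "(\<lambda>M. {x \<in> L. f x \<in> M}) ` \<M>"], intro conjI ballI)
      show "\<Union> ((\<lambda>M. {x \<in> L. f x \<in> M}) ` \<M>) = L" using **(2) by auto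
      fix M' assume "M' \<in> (\<lambda>M. {x \<in> L. f x \<in> M}) ` \<M>"
      then obtain M where M: "M \<in> \<M>" "M' = {x \<in> L. f x \<in> M}" by auto
      show "polytope M'" unfolding M(2) by (intro polytope_affine_vimage * ** L M)
      have "affine_map_on M' f" "affine_map_on (f ` M') g"
        using affine_map_on_subset[OF *(4)[OF L], of M'] affine_map_on_subset[OF **(4)[OF M(1)], of "f ` M'"] M(2)
        by (auto simp: image_subset_iff)
      then show "affine_map_on M' (\<lambda>x. g (f x))" by (rule affine_map_on_comp)
    qed (use **(1) in simp)
  qed
  from polytopes_refine[OF *(1), of "\<lambda>M. affine_map_on M (\<lambda>x. g (f x))", OF this]
  show "\<exists>\<K>. finite \<K> \<and> \<Union>\<K> = K \<and> (\<forall>L\<in>\<K>. polytope L \<and> affine_map_on L (\<lambda>x. g (f x)))"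
    using *(2) by auto
qed

lemma piecewise_affine_on_Pair:
  assumes f: "piecewise_affine_on X f" and g: "piecewise_affine_on X g"
  shows "piecewise_affine_on X (\<lambda>x. (f x, g x))"
proof (rule piecewise_affine_onI)
  fix K assume K: "polytope K" "K \<subseteq> X"
  obtain \<K> where *: "finite \<K>" "\<Union>\<K> = K" "\<And>L. L \<in> \<K> \<Longrightarrow> polytope L" "\<And>L. L \<in> \<K> \<Longrightarrow> affine_map_on L f"
    using piecewise_affine_onE[OF f K] by metis
  obtain \<M> where **: "finite \<M>" "\<Union>\<M> = K" "\<And>L. L \<in> \<M> \<Longrightarrow> polytope L" "\<And>L. L \<in> \<M> \<Longrightarrow> affine_map_on L g"
    using piecewise_affine_onE[OF g K] by metis
  show "\<exists>\<K>. finite \<K> \<and> \<Union>\<K> = K \<and> (\<forall>L\<in>\<K>. polytope L \<and> affine_map_on L (\<lambda>x. (f x, g x)))"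
  proof (rule exI[of _ "(\<lambda>(L,M). L \<inter> M) ` (\<K> \<times> \<M>)"], intro conjI ballI)
    show "\<Union>((\<lambda>(L,M). L \<inter> M) ` (\<K> \<times> \<M>)) = K" using *(2) **(2) by auto
    fix N assume "N \<in> (\<lambda>(L,M). L \<inter> M) ` (\<K> \<times> \<M>)"
    then obtain L M where N: "L \<in> \<K>" "M \<in> \<M>" "N = L \<inter> M" by auto
    show "polytope N" unfolding N by (intro polytope_Int_polytope * ** N)
    show "affine_map_on N (\<lambda>x. (f x, g x))"
      by (intro affine_map_on_Pair) (use N affine_map_on_subset *(4) **(4) in blast)+
  qed (use * ** in auto)
qed

lemma piecewise_affine_on_linear2:
  assumes "piecewise_affine_on X f" "piecewise_affine_on X g" "linear (\<lambda>(x, y). h x y)"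
  shows "piecewise_affine_on X (\<lambda>x. h (f x) (g x))"
  using piecewise_affine_on_comp[OF piecewise_affine_on_Pair[OF assms(1,2)] subset_UNIV piecewise_affine_on_linear[OF assms(3)]]
  by simp

lemma piecewise_affine_on_add:
  "piecewise_affine_on X f \<Longrightarrow> piecewise_affine_on X g \<Longrightarrow> piecewise_affine_on X (\<lambda>x. f x + g x)"
  by (rule piecewise_affine_on_linear2) (auto intro!: linearI simp: algebra_simps)

lemma piecewise_affine_on_diff:
  "piecewise_affine_on X f \<Longrightarrow> piecewise_affine_on X g \<Longrightarrow> piecewise_affine_on X (\<lambda>x. f x - g x)"
  by (rule piecewise_affine_on_linear2) (auto intro!: linearI simp: algebra_simps)

lemma piecewise_affine_on_linear_comp:
  assumes "linear l" "piecewise_affine_on X f" shows "piecewise_affine_on X (\<lambda>x. l (f x))"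
  using piecewise_affine_on_comp[OF assms(2) subset_UNIV piecewise_affine_on_linear[OF assms(1)]] .

lemma piecewise_affine_on_scaleR_left:
  fixes v :: "'b::real_vector"
  assumes "piecewise_affine_on X f" shows "piecewise_affine_on X (\<lambda>x. f x *\<^sub>R v)"
  by (rule piecewise_affine_on_linear_comp[OF _ assms]) (auto intro!: linearI simp: algebra_simps)

lemma piecewise_affine_on_sum:
  assumes "\<And>i. i \<in> I \<Longrightarrow> piecewise_affine_on X (f i)"
  shows "piecewise_affine_on X (\<lambda>x. \<Sum>i\<in>I. f i x)"
  using assms
  by (induction I rule: infinite_finite_induct)
     (auto intro: piecewise_affine_on_add piecewise_affine_on_const)

lemma piecewise_affine_max0: "piecewise_affine_on X (\<lambda>x::real. max x 0)"
proof (rule piecewise_affine_onI)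
  fix K :: "real set" assume K: "polytope K" "K \<subseteq> X"
  let ?P = "{x \<in> K. 0 \<le> x}" and ?N = "{x \<in> K. 0 \<le> - x}"
  have "polytope ?P" "polytope ?N"
    by (intro polytope_affine_le K affine_map_on_ident affine_map_on_linear linear_uminus)+
  moreover have "affine_map_on ?P (\<lambda>x. max x 0)" "affine_map_on ?N (\<lambda>x. max x 0)"
    unfolding affine_map_on_def
    by (auto simp: max_absorb1 max_absorb2 add_nonneg_nonneg mult_nonneg_nonneg mult_nonneg_nonpos add_nonpos_nonpos)
  moreover have "\<Union>{?P, ?N} = K" by auto
  ultimately show "\<exists>\<K>. finite \<K> \<and> \<Union>\<K> = K \<and> (\<forall>L\<in>\<K>. polytope L \<and> affine_map_on L (\<lambda>x. max x 0))"
    by (intro exI[of _ "{?P, ?N}"]) auto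
qed

lemma piecewise_affine_on_max:
  fixes f g :: "'a::real_vector \<Rightarrow> real"
  assumes "piecewise_affine_on X f" "piecewise_affine_on X g"
  shows "piecewise_affine_on X (\<lambda>x. max (f x) (g x))"
proof -
  have "piecewise_affine_on X (\<lambda>x. max (f x - g x) 0 + g x)"
    using piecewise_affine_on_comp[OF piecewise_affine_on_diff[OF assms] subset_UNIV piecewise_affine_max0] assms(2)
    by (rule piecewise_affine_on_add)
  then show ?thesis by (rule piecewise_affine_on_cong) auto
qed

text \<open>Compactness gives one finite family of pieces for all of \<open>X\<close>. On the image
  of a piece the inverse is affine by injectivity, and these images cut any polytope in the range
  into finitely many polytopes.\<close>

lemma piecewise_affine_on_inverse:
  assumes X: "compact_polyhedron X" and f: "piecewise_affine_on X f" and inj: "inj_on f X"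
  shows "piecewise_affine_on (f ` X) (inv_into X f)"
proof (rule piecewise_affine_onI)
  fix L assume L: "polytope L" "L \<subseteq> f ` X"
  obtain \<X> where \<X>: "finite \<X>" "\<And>K. K \<in> \<X> \<Longrightarrow> polytope K" "\<Union>\<X> = X"
    using X unfolding compact_polyhedron_def by blast
  obtain \<K> where K: "finite \<K>" "\<Union>\<K> = X" "\<And>K. K \<in> \<K> \<Longrightarrow> polytope K \<and> affine_map_on K f"
    using polytopes_refine[OF \<X>(1), of "\<lambda>K. affine_map_on K f"] \<X> f unfolding piecewise_affine_on_def
    by (metis Union_upper)
  show "\<exists>\<L>. finite \<L> \<and> \<Union>\<L> = L \<and> (\<forall>M\<in>\<L>. polytope M \<and> affine_map_on M (inv_into X f))"
  proof (rule exI[of _ "(\<lambda>K. L \<inter> f ` K) ` \<K>"], intro conjI ballI)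
    show "\<Union> ((\<lambda>K. L \<inter> f ` K) ` \<K>) = L" using K(2) L(2) by blast
    fix M assume "M \<in> (\<lambda>K. L \<inter> f ` K) ` \<K>"
    then obtain N where N: "N \<in> \<K>" "M = L \<inter> f ` N" by auto
    have aN: "affine_map_on N f" and pN: "polytope N" "N \<subseteq> X" using K N by auto
    show "polytope M" unfolding N(2) by (intro polytope_Int_polytope L polytope_affine_image[OF aN pN(1)])
    have "affine_map_on (f ` N) (inv_into X f)"
      unfolding affine_map_on_def
    proof clarify
      fix x y and u :: real assume h: "x \<in> N" "y \<in> N" "u \<in> {0..1}"
      have "(1 - u) *\<^sub>R x + u *\<^sub>R y \<in> N"
        using polytope_imp_convex[OF pN(1)] h by (auto simp: convex_alt)
      then have "(1 - u) *\<^sub>R x + u *\<^sub>R y \<in> X" using pN by blast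
      moreover have "f ((1 - u) *\<^sub>R x + u *\<^sub>R y) = (1 - u) *\<^sub>R f x + u *\<^sub>R f y"
        using aN h unfolding affine_map_on_def by blast
      ultimately have "inv_into X f ((1 - u) *\<^sub>R f x + u *\<^sub>R f y) = (1 - u) *\<^sub>R x + u *\<^sub>R y"
        using inv_into_f_f[OF inj] by metis
      moreover have "inv_into X f (f x) = x" "inv_into X f (f y) = y"
        using inv_into_f_f[OF inj] h pN by auto
      ultimately show "inv_into X f ((1 - u) *\<^sub>R f x + u *\<^sub>R f y) =
        (1 - u) *\<^sub>R inv_into X f (f x) + u *\<^sub>R inv_into X f (f y)" by simp
    qed
    then show "affine_map_on M (inv_into X f)" by (rule affine_map_on_subset) (simp add: N)
  qed (use K in simp)
qed

lemma compact_polyhedron_image: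
  assumes "compact_polyhedron X" "piecewise_affine_on X f"
  shows "compact_polyhedron (f ` X)"
proof -
  obtain \<X> where \<X>: "finite \<X>" "\<And>K. K \<in> \<X> \<Longrightarrow> polytope K" "\<Union>\<X> = X"
    using assms(1) unfolding compact_polyhedron_def by blast
  obtain \<K> where K: "finite \<K>" "\<Union>\<K> = X" "\<And>K. K \<in> \<K> \<Longrightarrow> polytope K \<and> affine_map_on K f"
    using polytopes_refine[OF \<X>(1), of "\<lambda>K. affine_map_on K f"] \<X> assms(2) unfolding piecewise_affine_on_def
    by (metis Union_upper)
  show ?thesis unfolding compact_polyhedron_def
    by (rule exI[of _ "(`) f ` \<K>"]) (use K in \<open>auto intro: polytope_affine_image\<close>)
qed

lemma compact_polyhedron_Times:
  assumes "compact_polyhedron X" "compact_polyhedron Y"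
  shows "compact_polyhedron (X \<times> Y)"
proof -
  obtain \<X> where \<X>: "finite \<X>" "\<And>K. K \<in> \<X> \<Longrightarrow> polytope K" "\<Union>\<X> = X"
    using assms(1) unfolding compact_polyhedron_def by blast
  obtain \<Y> where \<Y>: "finite \<Y>" "\<And>K. K \<in> \<Y> \<Longrightarrow> polytope K" "\<Union>\<Y> = Y"
    using assms(2) unfolding compact_polyhedron_def by blast
  show ?thesis unfolding compact_polyhedron_def
    by (rule exI[of _ "(\<lambda>(K,L). K \<times> L) ` (\<X> \<times> \<Y>)"]) (use \<X> \<Y> in \<open>auto intro!: polytope_Times\<close>)
qed

lemma compact_imp_pl_polyhedron:
  assumes "compact_polyhedron X" shows "pl_polyhedron X"
proof -
  obtain \<X> where \<X>: "finite \<X>" "\<And>K. K \<in> \<X> \<Longrightarrow> polytope K" "\<Union>\<X> = X"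
    using assms(1) unfolding compact_polyhedron_def by blast
  have "openin (top_of_set X) X" by simp
  with \<X> show ?thesis unfolding pl_polyhedron_def by (intro ballI exI[of _ \<X>] exI[of _ X]) auto
qed

lemma pl_mapI:
  assumes X: "pl_polyhedron X" and Y: "pl_polyhedron Y" and "f ` X \<subseteq> Y" and f: "piecewise_affine_on X f"
  shows "pl_map f X Y"
  unfolding pl_map_def
proof (intro conjI ballI assms(1-3))
  fix a assume "a \<in> X"
  then obtain \<K> U where *: "finite \<K>" "\<forall>K\<in>\<K>. polytope K \<and> K \<subseteq> X" "openin (top_of_set X) U" "a \<in> U" "U \<subseteq> \<Union>\<K>"
    using X unfolding pl_polyhedron_def by meson
  then have "\<exists>\<L>. finite \<L> \<and> \<Union>\<L> = \<Union>\<K> \<and> (\<forall>L\<in>\<L>. polytope L \<and> affine_map_on L f)"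
    using f by (intro polytopes_refine) (auto simp: piecewise_affine_on_def)
  with * show "\<exists>\<K> U. finite \<K> \<and> (\<forall>K\<in>\<K>. polytope K \<and> K \<subseteq> X \<and> affine_map_on K f) \<and>
        openin (top_of_set X) U \<and> a \<in> U \<and> U \<subseteq> \<Union>\<K>"
    by (metis Union_upper Sup_least order_trans)
qed

lemma pl_homeomorphismI:
  assumes X: "pl_polyhedron X" "pl_polyhedron Y" and fg: "f ` X \<subseteq> Y" "g ` Y \<subseteq> X"
    "\<And>x. x \<in> X \<Longrightarrow> g (f x) = x" "\<And>y. y \<in> Y \<Longrightarrow> f (g y) = y"
    and "piecewise_affine_on X f" "piecewise_affine_on Y g"
  shows "pl_homeomorphism f X Y"
proof -
  have bij: "bij_betw f X Y"
    by (rule bij_betw_byWitness[where f' = g]) (use fg in auto)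
  have eq: "g y = inv_into X f y" if "y \<in> Y" for y
    using inv_into_f_f[OF bij_betw_imp_inj_on[OF bij], of "g y"] fg that by (auto simp: image_subset_iff)
  have "piecewise_affine_on Y (inv_into X f)"
    using assms(8) eq by (rule piecewise_affine_on_cong)
  moreover have "inv_into X f ` Y \<subseteq> X" using eq fg(2) by (auto simp: image_subset_iff)
  ultimately show ?thesis unfolding pl_homeomorphism_def
    using bij X fg(1) assms(7) by (simp add: pl_mapI)
qed

lemma compact_pl_homeomorphism:
  assumes "compact_polyhedron X" "piecewise_affine_on X f" "inj_on f X"
  shows "pl_homeomorphism f X (f ` X)"
proof (rule pl_homeomorphismI[where g = "inv_into X f"])
  show "inv_into X f ` f ` X \<subseteq> X" by (auto intro: inv_into_into)
qed (use assms in \<open>auto intro: compact_imp_pl_polyhedron compact_polyhedron_image piecewise_affine_on_inverse f_inv_into_f\<close>)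

section \<open>Lattice-linear functions\<close>

text \<open>A syntactic class: positive homogeneity, continuity and piecewise affinity follow by
  induction over the rules, and maps with such coordinates compose. Homogeneity is what makes the
  transported maximum a gauge.\<close>

inductive lattice_linear :: "(('i \<Rightarrow> real) \<Rightarrow> real) \<Rightarrow> bool" where
  coord: "lattice_linear (\<lambda>x. x i)"
| add: "lattice_linear f \<Longrightarrow> lattice_linear g \<Longrightarrow> lattice_linear (\<lambda>x. f x + g x)"
| scale: "lattice_linear f \<Longrightarrow> lattice_linear (\<lambda>x. c * f x)"
| max: "lattice_linear f \<Longrightarrow> lattice_linear g \<Longrightarrow> lattice_linear (\<lambda>x. max (f x) (g x))"

lemma lattice_linear_zero: "lattice_linear (\<lambda>x. 0)"
  using lattice_linear.scale[OF lattice_linear.coord, of 0] by simp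

lemma lattice_linear_uminus: "lattice_linear f \<Longrightarrow> lattice_linear (\<lambda>x. - f x)"
  using lattice_linear.scale[of f "-1"] by simp

lemma lattice_linear_diff: "lattice_linear f \<Longrightarrow> lattice_linear g \<Longrightarrow> lattice_linear (\<lambda>x. f x - g x)"
  using lattice_linear.add[OF _ lattice_linear_uminus, of f g] by simp

lemma lattice_linear_min: "lattice_linear f \<Longrightarrow> lattice_linear g \<Longrightarrow> lattice_linear (\<lambda>x. min (f x) (g x))"
  using lattice_linear_uminus[OF lattice_linear.max[OF lattice_linear_uminus lattice_linear_uminus, of f g]]
  by (simp add: minus_max_eq_min)

lemma lattice_linear_if: "lattice_linear f \<Longrightarrow> lattice_linear g \<Longrightarrow> lattice_linear (\<lambda>x. if b then f x else g x)"
  by (cases b) auto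

lemma lattice_linear_Max:
  assumes "finite I" "I \<noteq> {}" "\<And>i. i \<in> I \<Longrightarrow> lattice_linear (f i)"
  shows "lattice_linear (\<lambda>x. Max ((\<lambda>i. f i x) ` I))"
  using assms by (induction I rule: finite_ne_induct) (auto intro: lattice_linear.max)

lemma lattice_linear_Min:
  assumes "finite I" "I \<noteq> {}" "\<And>i. i \<in> I \<Longrightarrow> lattice_linear (f i)"
  shows "lattice_linear (\<lambda>x. Min ((\<lambda>i. f i x) ` I))"
  using assms by (induction I rule: finite_ne_induct) (auto intro: lattice_linear_min)

lemma lattice_linear_comp:
  assumes "lattice_linear f" "\<And>j. lattice_linear (\<lambda>x. \<phi> x j)"
  shows "lattice_linear (\<lambda>x. f (\<phi> x))"
  using assms(1) by induction (auto intro: lattice_linear.intros assms(2))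

lemma lattice_linear_homogeneous:
  assumes "lattice_linear f" "0 \<le> c" shows "f (c *\<^sub>R x) = c * f x"
  using assms(1)
proof induction
  case (max f g)
  then show ?case using assms(2) by (simp add: max_mult_distrib_left)
qed (auto simp: scaleR_fun_def algebra_simps)

lemma lattice_linear_0: "lattice_linear f \<Longrightarrow> f (\<lambda>_. 0) = 0"
  using lattice_linear_homogeneous[of f 0 "\<lambda>_. 0"] by (simp add: scaleR_fun_def)

lemma lattice_linear_continuous: "lattice_linear f \<Longrightarrow> continuous_on X f"
  by (induction rule: lattice_linear.induct)
     (auto intro!: continuous_intros intro: continuous_on_subset[OF continuous_on_product_coordinates])

lemma lattice_linear_continuous_map: "(\<And>j. lattice_linear (\<lambda>x. \<phi> x j)) \<Longrightarrow> continuous_on X \<phi>"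
  by (rule continuous_on_coordinatewise_then_product) (rule lattice_linear_continuous)

lemma linear_coordinate: "linear (\<lambda>x :: 'i \<Rightarrow> real. x i)"
  by (rule linearI) (auto simp: scaleR_fun_def)

lemma lattice_linear_piecewise_affine: "lattice_linear f \<Longrightarrow> piecewise_affine_on X f"
proof (induction rule: lattice_linear.induct)
  case (coord i)
  show ?case by (rule piecewise_affine_on_linear[OF linear_coordinate])
next
  case (scale f c)
  then show ?case by (intro piecewise_affine_on_linear_comp[of "(*) c"]) (auto intro!: linearI simp: algebra_simps)
qed (auto intro: piecewise_affine_on_add piecewise_affine_on_max)

definition unit_vector :: "'i \<Rightarrow> 'i \<Rightarrow> real" where
  "unit_vector j = (\<lambda>i. if i = j then 1 else 0)"

lemma sum_fun_apply: "(\<Sum>i\<in>I. f i) x = (\<Sum>i\<in>I. f i x)" for f :: "'i \<Rightarrow> 'a \<Rightarrow> real"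
  by (induction I rule: infinite_finite_induct) auto

lemma sum_unit_vectors:
  assumes "finite J" "\<And>j. j \<notin> J \<Longrightarrow> x j = 0"
  shows "(\<Sum>j\<in>J. x j *\<^sub>R unit_vector j) = x"
proof
  fix i
  have "(\<Sum>j\<in>J. x j *\<^sub>R unit_vector j) i = (\<Sum>j\<in>J. if i = j then x j else 0)"
    unfolding sum_fun_apply by (rule sum.cong) (auto simp: scaleR_fun_def unit_vector_def)
  also have "\<dots> = x i" using assms by auto
  finally show "(\<Sum>j\<in>J. x j *\<^sub>R unit_vector j) i = x i" .
qed

lemma piecewise_affine_on_coordinatewise:
  fixes \<phi> :: "'a::real_vector \<Rightarrow> 'j \<Rightarrow> real"
  assumes "finite J" "\<And>j. j \<in> J \<Longrightarrow> piecewise_affine_on X (\<lambda>x. \<phi> x j)" "\<And>x j. x \<in> X \<Longrightarrow> j \<notin> J \<Longrightarrow> \<phi> x j = 0"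
  shows "piecewise_affine_on X \<phi>"
proof (rule piecewise_affine_on_cong)
  show "piecewise_affine_on X (\<lambda>x. \<Sum>j\<in>J. \<phi> x j *\<^sub>R unit_vector j)"
    by (intro piecewise_affine_on_sum piecewise_affine_on_scaleR_left assms)
  show "(\<Sum>j\<in>J. \<phi> x j *\<^sub>R unit_vector j) = \<phi> x" if "x \<in> X" for x
    using assms that by (intro sum_unit_vectors) auto
qed

text \<open>A set is compatible with \<open>\<Lambda>\<close> if it lies in a closed cell of the arrangement of the hyperplanes
  \<open>l = \<mu>\<close> with \<open>l, \<mu> \<in> \<Lambda>\<close>.\<close>

definition compatible :: "('a \<Rightarrow> real) set \<Rightarrow> 'a set \<Rightarrow> bool" where
  "compatible \<Lambda> S \<longleftrightarrow> (\<forall>x\<in>S. \<forall>y\<in>S. \<forall>l\<in>\<Lambda>. \<forall>\<mu>\<in>\<Lambda>. 0 \<le> (l x - \<mu> x) * (l y - \<mu> y))"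

text \<open>Continuity is demanded separately because linear functionals on a product of infinitely
  many lines may be discontinuous. \<open>p_comb\<close> and \<open>slope\<close> take for
  \<open>S\<close> just the few points that a computation involves.\<close>

definition selected_from :: "(('i \<Rightarrow> real) \<Rightarrow> real) set \<Rightarrow> (('i \<Rightarrow> real) \<Rightarrow> real) \<Rightarrow> bool" where
  "selected_from \<Lambda> f \<longleftrightarrow> finite \<Lambda> \<and> (\<forall>l\<in>\<Lambda>. linear l \<and> continuous_on UNIV l) \<and>
    (\<forall>S. compatible \<Lambda> S \<longrightarrow> (\<exists>l\<in>\<Lambda>. \<forall>x\<in>S. f x = l x))"

lemma selected_fromD:
  assumes "selected_from \<Lambda> f"
  shows "finite \<Lambda>" "\<forall>l\<in>\<Lambda>. linear l \<and> continuous_on UNIV l" "compatible \<Lambda> S \<Longrightarrow> \<exists>l\<in>\<Lambda>. \<forall>x\<in>S. f x = l x"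
  using assms unfolding selected_from_def by auto

lemma compatible_empty: "compatible \<Lambda> {}"
  by (simp add: compatible_def)

lemma lattice_linear_selection:
  assumes "lattice_linear f"
  shows "\<exists>\<Lambda>. selected_from \<Lambda> f"
  using assms
proof induction
  case (coord i)
  show ?case
    by (rule exI[of _ "{\<lambda>x. x i}"]) (auto simp: selected_from_def linear_coordinate)
next
  case (add f g)
  then obtain \<Lambda> M where s: "selected_from \<Lambda> f" "selected_from M g" by blast
  note \<Lambda> = selected_fromD[OF s(1)] and M = selected_fromD[OF s(2)]
  define N where "N = (\<lambda>(l,\<mu>) x. l x + \<mu> x) ` (\<Lambda> \<times> M)"
  show ?case
  proof (intro exI[of _ N], unfold selected_from_def, intro conjI allI impI)
    show "\<forall>l\<in>N. linear l \<and> continuous_on UNIV l"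
      using \<Lambda>(2) M(2) by (auto simp: N_def intro!: linear_compose_add continuous_intros)
    fix S assume "compatible (N) S"
    then have S: "\<forall>x\<in>S. \<forall>y\<in>S. \<forall>l\<in>N. \<forall>\<mu>\<in>N. 0 \<le> (l x - \<mu> x) * (l y - \<mu> y)"
      by (simp add: compatible_def)
    show "\<exists>l\<in>N. \<forall>x\<in>S. f x + g x = l x"
    proof (cases "S = {}")
      case True
      then show ?thesis using \<Lambda>(3)[OF compatible_empty] M(3)[OF compatible_empty] by (auto simp: N_def)
    next
      case False
      \<comment> \<open>Adding the fixed functional \<open>\<mu>0\<close> or \<open>l0\<close> does
        not change differences within one family, so compatibility with the sums passes to both
        families.\<close>
      obtain l0 \<mu>0 where 0: "l0 \<in> \<Lambda>" "\<mu>0 \<in> M" using \<Lambda>(3)[OF compatible_empty] M(3)[OF compatible_empty] by auto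
      have "\<exists>l\<in>\<Lambda>. \<forall>x\<in>S. f x = l x"
      proof (rule \<Lambda>(3), unfold compatible_def, intro ballI)
        fix x y l \<mu> assume h: "x \<in> S" "y \<in> S" "l \<in> \<Lambda>" "\<mu> \<in> \<Lambda>"
        have "(\<lambda>x. l x + \<mu>0 x) \<in> N" "(\<lambda>x. \<mu> x + \<mu>0 x) \<in> N" using h 0 by (auto simp: N_def)
        then show "0 \<le> (l x - \<mu> x) * (l y - \<mu> y)" using S h by fastforce
      qed
      moreover have "\<exists>l\<in>M. \<forall>x\<in>S. g x = l x"
      proof (rule M(3), unfold compatible_def, intro ballI)
        fix x y l \<mu> assume h: "x \<in> S" "y \<in> S" "l \<in> M" "\<mu> \<in> M"
        have "(\<lambda>x. l0 x + l x) \<in> N" "(\<lambda>x. l0 x + \<mu> x) \<in> N" using h 0 by (auto simp: N_def)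
        then show "0 \<le> (l x - \<mu> x) * (l y - \<mu> y)" using S h by fastforce
      qed
      ultimately show ?thesis by (force simp: N_def)
    qed
  qed (use \<Lambda>(1) M(1) in \<open>auto simp: N_def\<close>)
next
  case (scale f c)
  then obtain \<Lambda> where s: "selected_from \<Lambda> f" by blast
  note \<Lambda> = selected_fromD[OF s]
  define N where "N = (\<lambda>l x. c * l x) ` \<Lambda>"
  show ?case
  proof (intro exI[of _ N], unfold selected_from_def, intro conjI allI impI)
    show "\<forall>l\<in>N. linear l \<and> continuous_on UNIV l"
    proof -
      have "linear (\<lambda>x. c * l x)" if "linear l" for l :: "('a \<Rightarrow> real) \<Rightarrow> real"
        by (rule linearI) (simp_all add: linear_add[OF that] linear_scale[OF that] algebra_simps)
      then show ?thesis using \<Lambda>(2) by (auto simp: N_def intro!: continuous_intros)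
    qed
    fix S assume "compatible (N) S"
    then have S: "\<forall>x\<in>S. \<forall>y\<in>S. \<forall>l\<in>N. \<forall>\<mu>\<in>N. 0 \<le> (l x - \<mu> x) * (l y - \<mu> y)"
      by (simp add: compatible_def)
    show "\<exists>l\<in>N. \<forall>x\<in>S. c * f x = l x"
    \<comment> \<open>For \<open>c = 0\<close> all members of \<open>N\<close> are zero and
      compatibility carries no information, but any member selects.\<close>
    proof (cases "c = 0")
      case True
      then show ?thesis using \<Lambda>(3)[OF compatible_empty] by (auto simp: N_def)
    next
      case False
      have "\<exists>l\<in>\<Lambda>. \<forall>x\<in>S. f x = l x"
      proof (rule \<Lambda>(3), unfold compatible_def, intro ballI)
        fix x y l \<mu> assume h: "x \<in> S" "y \<in> S" "l \<in> \<Lambda>" "\<mu> \<in> \<Lambda>"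
        have "(\<lambda>x. c * l x) \<in> N" "(\<lambda>x. c * \<mu> x) \<in> N" using h by (auto simp: N_def)
        from S[rule_format, OF h(1,2) this]
        have "0 \<le> (c * l x - c * \<mu> x) * (c * l y - c * \<mu> y)" .
        also have "\<dots> = c\<^sup>2 * ((l x - \<mu> x) * (l y - \<mu> y))" by (simp add: power2_eq_square algebra_simps)
        finally show "0 \<le> (l x - \<mu> x) * (l y - \<mu> y)" using False by (simp add: zero_le_mult_iff)
      qed
      then show ?thesis by (force simp: N_def)
    qed
  qed (use \<Lambda>(1) in \<open>auto simp: N_def\<close>)
next
  case (max f g)
  then obtain \<Lambda> M where s: "selected_from \<Lambda> f" "selected_from M g" by blast
  note \<Lambda> = selected_fromD[OF s(1)] and M = selected_fromD[OF s(2)]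
  show ?case
  proof (intro exI[of _ "\<Lambda> \<union> M"], unfold selected_from_def, intro conjI allI impI)
    fix S assume "compatible (\<Lambda> \<union> M) S"
    then have S: "\<forall>x\<in>S. \<forall>y\<in>S. \<forall>l\<in>\<Lambda> \<union> M. \<forall>\<mu>\<in>\<Lambda> \<union> M. 0 \<le> (l x - \<mu> x) * (l y - \<mu> y)"
      by (simp add: compatible_def)
    obtain l where l: "l \<in> \<Lambda>" "\<forall>x\<in>S. f x = l x" using \<Lambda>(3)[of S] S unfolding compatible_def by blast
    obtain \<mu> where \<mu>: "\<mu> \<in> M" "\<forall>x\<in>S. g x = \<mu> x" using M(3)[of S] S unfolding compatible_def by blast
    show "\<exists>\<nu>\<in>\<Lambda> \<union> M. \<forall>x\<in>S. max (f x) (g x) = \<nu> x"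
    \<comment> \<open>Compatibility keeps the sign of \<open>l - \<mu>\<close> weakly constant on
      \<open>S\<close>, so one of the two functionals is the maximum on all of
      \<open>S\<close>.\<close>
    proof (cases "\<exists>x\<in>S. \<mu> x < l x")
      case True
      then obtain x where x: "x \<in> S" "\<mu> x < l x" by blast
      have "\<mu> y \<le> l y" if "y \<in> S" for y
      proof -
        have "0 \<le> (l x - \<mu> x) * (l y - \<mu> y)" using S x(1) that l(1) \<mu>(1) by blast
        then show ?thesis using x(2) by (simp add: zero_le_mult_iff)
      qed
      then show ?thesis using l \<mu> by (intro bexI[of _ l]) auto
    next
      case False
      then show ?thesis using l \<mu> by (intro bexI[of _ \<mu>]) (auto simp: not_less max_absorb2)
    qed
  qed (use \<Lambda>(1,2) M(1,2) in auto)
qed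

section \<open>Polyhedra in function spaces\<close>

lemma polytope_box:
  assumes "finite I"
  shows "polytope {x :: 'i \<Rightarrow> real. (\<forall>i\<in>I. l i \<le> x i \<and> x i \<le> u i) \<and> (\<forall>i. i \<notin> I \<longrightarrow> x i = 0)}"
  using assms
proof (induction I)
  case empty
  have "{x :: 'i \<Rightarrow> real. (\<forall>i\<in>{}. l i \<le> x i \<and> x i \<le> u i) \<and> (\<forall>i. i \<notin> {} \<longrightarrow> x i = 0)} = {\<lambda>_. 0}" by auto
  then show ?case by (simp add: polytope_sing)
next
  case (insert j I)
  let ?B = "{x :: 'i \<Rightarrow> real. (\<forall>i\<in>I. l i \<le> x i \<and> x i \<le> u i) \<and> (\<forall>i. i \<notin> I \<longrightarrow> x i = 0)}"
  let ?C = "{x :: 'i \<Rightarrow> real. (\<forall>i\<in>insert j I. l i \<le> x i \<and> x i \<le> u i) \<and> (\<forall>i. i \<notin> insert j I \<longrightarrow> x i = 0)}"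
  let ?f = "\<lambda>(x, t). x + t *\<^sub>R unit_vector j"
  have "polytope (cbox (l j) (u j))" by (rule polytope_interval)
  then have "polytope (?f ` (?B \<times> cbox (l j) (u j)))"
    using insert.IH by (intro polytope_linear_image polytope_Times linearI) (auto simp: algebra_simps)
  also have "?f ` (?B \<times> cbox (l j) (u j)) = ?C"
  proof (intro equalityI subsetI)
    fix x assume "x \<in> ?C"
    then have "(x(j := 0), x j) \<in> ?B \<times> cbox (l j) (u j)" using insert.hyps by auto
    moreover have "x = ?f (x(j := 0), x j)" by (auto simp: unit_vector_def scaleR_fun_def)
    ultimately show "x \<in> ?f ` (?B \<times> cbox (l j) (u j))" by blast
  qed (use insert.hyps in \<open>auto simp: unit_vector_def scaleR_fun_def\<close>)
  finally show ?case .
qed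

lemma open_fun_contains_box:
  fixes T :: "('i \<Rightarrow> real) set"
  assumes "open T" "a \<in> T"
  obtains J e where "finite J" "e > 0" "{x. \<forall>i\<in>J. \<bar>x i - a i\<bar> \<le> e} \<subseteq> T"
proof -
  have "openin (powertop_real UNIV) T" using assms(1) by (simp add: euclidean_product_topology)
  from product_topology_open_contains_basis[OF this assms(2)]
  obtain X where X: "a \<in> (\<Pi>\<^sub>E i\<in>UNIV. X i)" "\<And>i. open (X i)" "finite {i. X i \<noteq> UNIV}" "(\<Pi>\<^sub>E i\<in>UNIV. X i) \<subseteq> T"
    by auto
  have "\<exists>e>0. cball (a i) e \<subseteq> X i" for i
    using X(1,2) open_contains_cball by (metis PiE_mem UNIV_I)
  then obtain e where e: "\<And>i. e i > 0" "\<And>i. cball (a i) (e i) \<subseteq> X i" by metis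
  let ?J = "{i. X i \<noteq> UNIV}"
  let ?d = "Min (insert 1 (e ` ?J))"
  show ?thesis
  proof (rule that[OF X(3), of ?d])
    show "?d > 0" using X(3) e(1) by (subst Min_gr_iff) auto
    show "{x. \<forall>i\<in>?J. \<bar>x i - a i\<bar> \<le> ?d} \<subseteq> T"
    proof
      fix x assume x: "x \<in> {x. \<forall>i\<in>?J. \<bar>x i - a i\<bar> \<le> ?d}"
      have "x i \<in> X i" for i
      proof (cases "i \<in> ?J")
        case True
        then have "\<bar>x i - a i\<bar> \<le> e i" using x X(3) Min_le[of "insert 1 (e ` ?J)" "e i"] by fastforce
        then show ?thesis using e(2)[of i] by (auto simp: dist_real_def abs_minus_commute)
      qed auto
      then show "x \<in> T" using X(4) by (auto simp: PiE_def)
    qed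
  qed
qed

lemma polytope_Int_box:
  fixes K :: "('i \<Rightarrow> real) set"
  assumes "finite J" "polytope K"
  shows "polytope {x \<in> K. \<forall>i\<in>J. \<bar>x i - a i\<bar> \<le> e}"
  using assms(1)
proof induction
  case empty
  then show ?case using assms(2) by simp
next
  case (insert j J)
  let ?K = "{x \<in> K. \<forall>i\<in>J. \<bar>x i - a i\<bar> \<le> e}"
  have "polytope {x \<in> {x \<in> ?K. a j - e \<le> x j}. - (a j + e) \<le> - x j}"
    by (intro polytope_halfspace[OF linear_compose_neg[OF linear_coordinate]] polytope_halfspace[OF linear_coordinate] insert.IH)
  moreover have "{x \<in> {x \<in> ?K. a j - e \<le> x j}. - (a j + e) \<le> - x j} = {x \<in> K. \<forall>i\<in>insert j J. \<bar>x i - a i\<bar> \<le> e}"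
    by auto
  ultimately show ?case by simp
qed

text \<open>A neighbourhood in the product topology constrains finitely many coordinates, so a small
  closed box cuts the polytopes near \<open>a\<close> down to the open set without leaving the class
  of polytopes.\<close>

lemma pl_polyhedron_openin:
  fixes X :: "('i \<Rightarrow> real) set"
  assumes X: "pl_polyhedron X" and U: "openin (top_of_set X) U"
  shows "pl_polyhedron U"
  unfolding pl_polyhedron_def
proof
  fix a assume a: "a \<in> U"
  obtain T where T: "open T" "U = X \<inter> T" using U by (auto simp: openin_open)
  obtain J e where Je: "finite J" "e > 0" "{x. \<forall>i\<in>J. \<bar>x i - a i\<bar> \<le> e} \<subseteq> T"
    using open_fun_contains_box T a by blast
  obtain \<K> U' where *: "finite \<K>" "\<forall>K\<in>\<K>. polytope K \<and> K \<subseteq> X" "openin (top_of_set X) U'" "a \<in> U'" "U' \<subseteq> \<Union>\<K>"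
  proof -
    have "a \<in> X" using a T(2) by blast
    then show ?thesis using X that unfolding pl_polyhedron_def by meson
  qed
  define \<L> where "\<L> = (\<lambda>K. {x \<in> K. \<forall>i\<in>J. \<bar>x i - a i\<bar> \<le> e}) ` \<K>"
  define O' where "O' = (\<Inter>i\<in>J. {x. \<bar>x i - a i\<bar> < e})"
  have "open {x. \<bar>x i - a i\<bar> < e}" for i
    by (intro open_Collect_less continuous_intros) (auto intro!: continuous_intros continuous_on_product_coordinates)
  then have O: "open O'" unfolding O'_def using Je(1) by blast
  show "\<exists>\<K> V. finite \<K> \<and> (\<forall>K\<in>\<K>. polytope K \<and> K \<subseteq> U) \<and> openin (top_of_set U) V \<and> a \<in> V \<and> V \<subseteq> \<Union>\<K>"
  proof (intro exI[of _ \<L>] exI[of _ "U \<inter> (U' \<inter> O')"] conjI ballI)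
    show "finite \<L>" using *(1) by (simp add: \<L>_def)
    show "polytope K" if "K \<in> \<L>" for K using that *(2) by (auto simp: \<L>_def intro!: polytope_Int_box Je)
    show "K \<subseteq> U" if "K \<in> \<L>" for K using that *(2) Je(3) T(2) by (auto simp: \<L>_def)
    obtain T' where T': "open T'" "U' = X \<inter> T'" using *(3) by (auto simp: openin_open)
    have "U \<inter> (U' \<inter> O') = U \<inter> (T' \<inter> O')" using T' T by auto
    then show "openin (top_of_set U) (U \<inter> (U' \<inter> O'))"
      using T'(1) O by (metis openin_open_Int open_Int)
    show "a \<in> U \<inter> (U' \<inter> O')" using a *(4) Je(2) by (auto simp: O'_def)
    show "U \<inter> (U' \<inter> O') \<subseteq> \<Union>\<L>"
    proof
      fix x assume x: "x \<in> U \<inter> (U' \<inter> O')"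
      then obtain K where K: "K \<in> \<K>" "x \<in> K" using *(5) by blast
      have "x \<in> {x \<in> K. \<forall>i\<in>J. \<bar>x i - a i\<bar> \<le> e}" using x K by (auto simp: O'_def less_imp_le)
      then show "x \<in> \<Union>\<L>" using K(1) unfolding \<L>_def by blast
    qed
  qed
qed

abbreviation coord_space :: "nat \<Rightarrow> (nat \<Rightarrow> real) set" where
  "coord_space n \<equiv> {x. \<forall>i\<ge>n. x i = 0}"

abbreviation coord_half_space :: "nat \<Rightarrow> (nat \<Rightarrow> real) set" where
  "coord_half_space n \<equiv> {x. (\<forall>i\<ge>n. x i = 0) \<and> 0 \<le> x 0}"

lemma half_space_eq: "half_space n = top_of_set (coord_half_space n)"
  unfolding half_space_def Euclidean_space_def subtopology_subtopology euclidean_product_topology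
  by (rule arg_cong[of _ _ "subtopology euclidean"]) auto

lemma Euclidean_space_eq: "Euclidean_space n = top_of_set (coord_space n)"
  unfolding Euclidean_space_def euclidean_product_topology ..

lemma pl_polyhedron_Euclidean_space: "pl_polyhedron (coord_space n)"
  unfolding pl_polyhedron_def
proof
  fix a :: "nat \<Rightarrow> real" assume a: "a \<in> coord_space n"
  let ?X = "coord_space n"
  let ?K = "{x. (\<forall>i\<in>{..<n}. a i - 1 \<le> x i \<and> x i \<le> a i + 1) \<and> (\<forall>i. i \<notin> {..<n} \<longrightarrow> x i = 0)}"
  let ?O = "(\<Inter>i\<in>{..<n}. {x. \<bar>x i - a i\<bar> < 1})"
  have "open {x. \<bar>x i - a i\<bar> < 1}" for i
    by (intro open_Collect_less continuous_intros) (auto intro!: continuous_intros continuous_on_product_coordinates)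
  then have O: "open ?O" by blast
  show "\<exists>\<K> V. finite \<K> \<and> (\<forall>K\<in>\<K>. polytope K \<and> K \<subseteq> ?X) \<and> openin (top_of_set ?X) V \<and> a \<in> V \<and> V \<subseteq> \<Union>\<K>"
  proof (intro exI[of _ "{?K}"] exI[of _ "?X \<inter> ?O"] conjI ballI)
    show "openin (top_of_set ?X) (?X \<inter> ?O)" using O by (rule openin_open_Int)
    show "?X \<inter> ?O \<subseteq> \<Union> {?K}"
    proof
      fix x assume x: "x \<in> ?X \<inter> ?O"
      have "\<bar>x i - a i\<bar> < 1" if "i < n" for i using x that by auto
      then show "x \<in> \<Union> {?K}" using x by (auto simp: abs_less_iff) (smt (verit))+
    qed
    show "polytope K" if "K \<in> {?K}" for K using that polytope_box[of "{..<n}" "\<lambda>i. a i - 1" "\<lambda>i. a i + 1"] by simp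
  qed (use a in auto)
qed

lemma pl_polyhedron_half_space: "pl_polyhedron (coord_half_space n)"
  unfolding pl_polyhedron_def
proof
  let ?X = "coord_half_space n"
  let ?E = "coord_space n"
  fix a :: "nat \<Rightarrow> real" assume a: "a \<in> ?X"
  then obtain \<K> U where *: "finite \<K>" "\<forall>K\<in>\<K>. polytope K \<and> K \<subseteq> ?E" "openin (top_of_set ?E) U" "a \<in> U" "U \<subseteq> \<Union>\<K>"
  proof -
    have "a \<in> ?E" using a by blast
    then show ?thesis using pl_polyhedron_Euclidean_space[of n] that unfolding pl_polyhedron_def by meson
  qed
  obtain T where T: "open T" "U = ?E \<inter> T" using *(3) by (auto simp: openin_open)
  show "\<exists>\<K> V. finite \<K> \<and> (\<forall>K\<in>\<K>. polytope K \<and> K \<subseteq> ?X) \<and> openin (top_of_set ?X) V \<and> a \<in> V \<and> V \<subseteq> \<Union>\<K>"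
  proof (intro exI[of _ "(\<lambda>K. {x\<in>K. 0 \<le> x 0}) ` \<K>"] exI[of _ "?X \<inter> T"] conjI ballI)
    show "polytope K" if "K \<in> (\<lambda>K. {x\<in>K. 0 \<le> x 0}) ` \<K>" for K
      using that *(2) by (auto intro!: polytope_halfspace[OF linear_coordinate])
    show "?X \<inter> T \<subseteq> \<Union> ((\<lambda>K. {x\<in>K. 0 \<le> x 0}) ` \<K>)"
    proof
      fix x assume x: "x \<in> ?X \<inter> T"
      then obtain K where K: "K \<in> \<K>" "x \<in> K" using *(5) T(2) by blast
      have "x \<in> {x\<in>K. 0 \<le> x 0}" using x K by auto
      then show "x \<in> \<Union> ((\<lambda>K. {x\<in>K. 0 \<le> x 0}) ` \<K>)" using K(1) by blast
    qed
    show "K \<subseteq> ?X" if "K \<in> (\<lambda>K. {x\<in>K. 0 \<le> x 0}) ` \<K>" for K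
      using that *(2) by auto
  qed (use * a T in \<open>auto intro: openin_open_Int\<close>)
qed

section \<open>Continuity of piecewise linear maps\<close>

lemma compact_box_fun: "compact {u :: 'i \<Rightarrow> real. \<forall>i. 0 \<le> u i \<and> u i \<le> 1}"
proof -
  have "compactin (powertop_real UNIV) (\<Pi>\<^sub>E i\<in>UNIV. {0..1})"
    by (subst compactin_PiE) auto
  then have "compact (\<Pi>\<^sub>E i\<in>(UNIV::'i set). {0..1::real})" by (simp add: euclidean_product_topology)
  moreover have "(\<Pi>\<^sub>E i\<in>(UNIV::'i set). {0..1::real}) = {u. \<forall>i. 0 \<le> u i \<and> u i \<le> 1}" by (auto simp: PiE_def Pi_def)
  ultimately show ?thesis by simp
qed

lemma compact_imp_closed_fun:
  fixes K :: "('i \<Rightarrow> real) set" assumes "compact K" shows "closed K"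
proof -
  have "Hausdorff_space (powertop_real (UNIV :: 'i set))"
    by (simp add: Hausdorff_space_product_topology)
  then have "closedin (powertop_real UNIV) K"
    using assms by (intro compactin_imp_closedin) (simp_all add: euclidean_product_topology)
  then show ?thesis by (simp add: euclidean_product_topology)
qed

lemma affine_map_on_convex_combination:
  assumes f: "affine_map_on (convex hull W) f" and W: "finite W" and u: "\<And>w. w \<in> W \<Longrightarrow> 0 \<le> u w" "sum u W = 1"
  shows "f (\<Sum>w\<in>W. u w *\<^sub>R w) = (\<Sum>w\<in>W. u w *\<^sub>R f w)"
proof -
  let ?K = "(\<lambda>x. (x, f x)) ` (convex hull W)"
  have "convex ?K" by (intro convex_affine_image affine_map_on_Pair affine_map_on_ident f convex_convex_hull)
  then have "(\<Sum>w\<in>W. u w *\<^sub>R (w, f w)) \<in> ?K"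
    using W u by (intro convex_sum) (auto intro: hull_inc)
  then show ?thesis by (auto simp: sum_prod scaleR_prod_def)
qed

text \<open>The ambient space carries no norm, so a compact space of weights does the work:
  \<open>s\<close> maps it onto \<open>K\<close>, and \<open>f\<close> after \<open>s\<close> is the
  continuous map \<open>t\<close>. The preimage of a closed set under \<open>f\<close> is then the
  image under \<open>s\<close> of a compact set.\<close>

lemma polytope_compact_continuous:
  fixes f :: "('i \<Rightarrow> real) \<Rightarrow> ('j \<Rightarrow> real)"
  assumes K: "polytope K" and f: "affine_map_on K f"
  shows "closed K" "continuous_on K f"
proof -
  obtain W where W: "finite W" "K = convex hull W" using K by (auto simp: polytope_def)
  \<comment> \<open>All weights are confined to the unit interval, also those of points outside
    \<open>W\<close>, so that the set is closed in a compact product.\<close>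
  let ?S = "{u :: ('i \<Rightarrow> real) \<Rightarrow> real. (\<forall>w. 0 \<le> u w \<and> u w \<le> 1) \<and> sum u W = 1}"
  define s where "s u = (\<Sum>w\<in>W. u w *\<^sub>R w)" for u
  define t where "t u = (\<Sum>w\<in>W. u w *\<^sub>R f w)" for u
  have cs: "continuous_on UNIV s" unfolding s_def
    by (intro continuous_on_coordinatewise_then_product)
       (auto simp: sum_fun_apply scaleR_fun_def intro!: continuous_intros continuous_on_product_coordinates)
  have ct: "continuous_on UNIV t" unfolding t_def
    by (intro continuous_on_coordinatewise_then_product)
       (auto simp: sum_fun_apply scaleR_fun_def intro!: continuous_intros continuous_on_product_coordinates)
  have "closed {u :: ('i \<Rightarrow> real) \<Rightarrow> real. sum u W = 1}"
    by (intro closed_Collect_eq continuous_intros continuous_on_product_coordinates)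
  then have "compact ({u. \<forall>w. 0 \<le> u w \<and> u w \<le> 1} \<inter> {u :: ('i \<Rightarrow> real) \<Rightarrow> real. sum u W = 1})"
    by (intro compact_Int_closed compact_box_fun)
  then have S: "compact ?S" by (simp add: Int_def)
  have sS: "s ` ?S = K"
  proof (intro equalityI subsetI)
    fix x assume "x \<in> K"
    then obtain c where c: "\<And>v. v \<in> W \<Longrightarrow> 0 \<le> c v" "sum c W = 1" "(\<Sum>v\<in>W. c v *\<^sub>R v) = x"
      unfolding W(2) convex_hull_finite[OF W(1)] by auto
    define u where "u w = (if w \<in> W then c w else 0)" for w
    have "c w \<le> 1" if "w \<in> W" for w using member_le_sum[of w W c] c W(1) that by auto
    then have "u \<in> ?S" using c by (auto simp: u_def)
    moreover have "s u = x" by (auto simp: s_def u_def c(3)[symmetric])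
    ultimately show "x \<in> s ` ?S" by blast
  next
    fix x assume "x \<in> s ` ?S"
    then show "x \<in> K" unfolding W(2) s_def by (auto intro!: convex_sum[OF W(1) convex_convex_hull] intro: hull_inc)
  qed
  have st: "f (s u) = t u" if "u \<in> ?S" for u
    using that f unfolding W(2) s_def t_def by (intro affine_map_on_convex_combination W) auto
  show cK: "closed K"
    using compact_continuous_image[OF continuous_on_subset[OF cs] S] sS compact_imp_closed_fun by auto
  show "continuous_on K f"
    unfolding continuous_on_closed_vimage[OF cK]
  proof (intro allI impI)
    fix B :: "('j \<Rightarrow> real) set" assume "closed B"
    then have "closed (t -` B)" using ct by (simp add: continuous_on_closed_vimage)
    then have "compact (?S \<inter> t -` B)" using S by (intro compact_Int_closed)
    then have "compact (s ` (?S \<inter> t -` B))"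
      by (intro compact_continuous_image continuous_on_subset[OF cs]) auto
    moreover have "s ` (S \<inter> t -` B) = f -` B \<inter> s ` S" if "\<And>u. u \<in> S \<Longrightarrow> f (s u) = t u" for S
      using that by force
    from this[of ?S, OF st] have "s ` (?S \<inter> t -` B) = f -` B \<inter> K" unfolding sS by simp
    ultimately show "closed (f -` B \<inter> K)" using compact_imp_closed_fun by metis
  qed
qed

lemma pl_map_continuous:
  fixes f :: "('i \<Rightarrow> real) \<Rightarrow> ('j \<Rightarrow> real)"
  assumes "pl_map f X Y"
  shows "continuous_on X f"
  unfolding continuous_on_def
proof
  fix a assume "a \<in> X"
  then obtain \<K> U where *: "finite \<K>" "\<forall>K\<in>\<K>. polytope K \<and> K \<subseteq> X \<and> affine_map_on K f"
    "openin (top_of_set X) U" "a \<in> U" "U \<subseteq> \<Union>\<K>"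
    using assms unfolding pl_map_def by meson
  have "continuous_on (\<Union>K\<in>\<K>. K) f"
    using *(1,2) by (intro continuous_on_closed_Union) (auto intro: polytope_compact_continuous)
  then have "continuous_on U f" using *(5) by (simp add: continuous_on_subset)
  then have cU: "(f \<longlongrightarrow> f a) (at a within U)" using *(4) by (simp add: continuous_on_def)
  obtain T where T: "open T" "U = X \<inter> T" using *(3) by (auto simp: openin_open)
  have "at a within U = at a within X"
    using T *(4) by (intro at_within_nhd[of a T]) auto
  then show "(f \<longlongrightarrow> f a) (at a within X)" using cU by simp
qed

section \<open>Realizations of order complexes\<close>

lemma convex_hull_unit_vectors:
  assumes "finite C"
  shows "convex hull (unit_vector ` C) = {f. (\<forall>v. 0 \<le> f v) \<and> (\<forall>v. v \<notin> C \<longrightarrow> f v = 0) \<and> sum f C = 1}"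
    (is "_ = ?S")
proof
  have "convex ?S"
    by (rule convexI) (auto simp: scaleR_fun_def sum.distrib sum_distrib_left[symmetric])
  moreover have "unit_vector ` C \<subseteq> ?S" using assms by (auto simp: unit_vector_def)
  ultimately show "convex hull (unit_vector ` C) \<subseteq> ?S" by (intro hull_minimal)
  show "?S \<subseteq> convex hull (unit_vector ` C)"
  proof
    fix f assume f: "f \<in> ?S"
    have "(\<Sum>j\<in>C. f j *\<^sub>R unit_vector j) \<in> convex hull (unit_vector ` C)"
      using f by (intro convex_sum[OF assms convex_convex_hull]) (auto intro: hull_inc)
    moreover have "(\<Sum>j\<in>C. f j *\<^sub>R unit_vector j) = f" using f assms by (intro sum_unit_vectors) auto
    ultimately show "f \<in> convex hull (unit_vector ` C)" by simp
  qed
qed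

lemma order_space_iff:
  assumes "finite A"
  shows "f \<in> order_space A \<longleftrightarrow> (\<forall>v. 0 \<le> f v) \<and> {v. f v \<noteq> 0} \<subseteq> A \<and>
    Complete_Partial_Order.chain (\<le>) {v. f v \<noteq> 0} \<and> sum f A = 1"
proof -
  have s: "(\<Sum>v | f v \<noteq> 0. f v) = sum f A" if "{v. f v \<noteq> 0} \<subseteq> A"
    using that assms by (intro sum.mono_neutral_left) auto
  have "{v. f v \<noteq> 0} \<noteq> {}" if "sum f A = 1" using that by (auto simp: sum.neutral) (metis sum.neutral zero_neq_one)
  then show ?thesis
    using s assms unfolding realization_def order_complex_def barycentric_subdivision_def
    by (auto intro: finite_subset)
qed

lemma chain_subset: "Complete_Partial_Order.chain (\<le>) C \<Longrightarrow> D \<subseteq> C \<Longrightarrow> Complete_Partial_Order.chain (\<le>) D"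
  unfolding Complete_Partial_Order.chain_def by blast

lemma order_space_compact_polyhedron:
  assumes "finite A" shows "compact_polyhedron (order_space A)"
proof -
  let ?\<C> = "{C. C \<subseteq> A \<and> Complete_Partial_Order.chain (\<le>) C}"
  have "\<Union>((\<lambda>C. convex hull (unit_vector ` C)) ` ?\<C>) = order_space A"
  proof (intro equalityI subsetI)
    fix f assume "f \<in> \<Union>((\<lambda>C. convex hull (unit_vector ` C)) ` ?\<C>)"
    then obtain C where C: "C \<subseteq> A" "Complete_Partial_Order.chain (\<le>) C" "f \<in> convex hull (unit_vector ` C)" by blast
    then have f: "\<forall>v. 0 \<le> f v" "\<forall>v. v \<notin> C \<longrightarrow> f v = 0" "sum f C = 1"
      using convex_hull_unit_vectors[OF finite_subset[OF C(1) assms]] by auto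
    then have "sum f A = 1" using sum.mono_neutral_left[OF assms C(1), of f] by auto
    moreover have "{v. f v \<noteq> 0} \<subseteq> C" using f(2) by auto
    ultimately show "f \<in> order_space A" using f C chain_subset[OF C(2)] order_space_iff[OF assms] by blast
  next
    fix f assume f: "f \<in> order_space A"
    let ?C = "{v. f v \<noteq> 0}"
    have *: "\<forall>v. 0 \<le> f v" "?C \<subseteq> A" "Complete_Partial_Order.chain (\<le>) ?C" "sum f A = 1"
      using f order_space_iff[OF assms] by auto
    have "sum f ?C = 1" using sum.mono_neutral_left[OF assms *(2), of f] *(4) by simp
    then have "f \<in> convex hull (unit_vector ` ?C)"
      using convex_hull_unit_vectors[OF finite_subset[OF *(2) assms]] *(1) by simp
    then show "f \<in> \<Union>((\<lambda>C. convex hull (unit_vector ` C)) ` ?\<C>)" using *(2,3) by blast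
  qed
  moreover have "polytope (convex hull (unit_vector ` C))" if "C \<subseteq> A" for C
    using finite_subset[OF that assms] by (intro polytope_convex_hull) simp
  ultimately show ?thesis unfolding compact_polyhedron_def using assms
    by (intro exI[of _ "(\<lambda>C. convex hull (unit_vector ` C)) ` ?\<C>"]) auto
qed

section \<open>Flag decompositions\<close>

lemma Union_chain_in:
  assumes "finite S" "Complete_Partial_Order.chain (\<le>) S" "S \<noteq> {}"
  shows "\<Union>S \<in> S"
  using assms(1,3,2)
proof (induction S rule: finite_ne_induct)
  case (insert \<sigma> S)
  have "\<Union>S \<in> S" using insert by (auto intro: chain_subset)
  moreover have "\<sigma> \<subseteq> \<Union>S \<or> \<Union>S \<subseteq> \<sigma>"
    using insert.prems \<open>\<Union>S \<in> S\<close> unfolding Complete_Partial_Order.chain_def by blast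
  ultimately show ?case by (auto simp: sup.absorb1 sup.absorb2)
qed auto

text \<open>A set \<open>D\<close> of vectors is stratified by the sets \<open>ty x\<close> of functionals that are positive at
  \<open>x\<close>, and \<open>c\<close> picks a vector in each stratum. Subtracting from \<open>x\<close> the largest possible multiple of
  \<open>c (ty x)\<close> leads to a smaller stratum, and so \<open>x\<close> is a unique positive combination of the
  \<open>c \<sigma>\<close> along a chain of strata.\<close>

locale flag_fan =
  fixes I :: "'l set" and ev :: "'l \<Rightarrow> 'x::real_vector \<Rightarrow> real" and D :: "'x set" and c :: "'l set \<Rightarrow> 'x"
    and ty :: "'x \<Rightarrow> 'l set"
  assumes ty_eq: "\<And>x. ty x = {l\<in>I. 0 < ev l x}" and fin: "finite I" and lin: "\<And>l. l \<in> I \<Longrightarrow> linear (ev l)"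
    and ty_empty: "\<And>x. x \<in> D \<Longrightarrow> ty x = {} \<Longrightarrow> x = 0"
    and ty_c: "\<And>x. x \<in> D \<Longrightarrow> x \<noteq> 0 \<Longrightarrow> ty (c (ty x)) = ty x"
    and sub: "\<And>x t. x \<in> D \<Longrightarrow> x \<noteq> 0 \<Longrightarrow> 0 \<le> t \<Longrightarrow> (\<And>l. l \<in> ty x \<Longrightarrow> t * ev l (c (ty x)) \<le> ev l x) \<Longrightarrow>
      x - t *\<^sub>R c (ty x) \<in> D \<and> ty (x - t *\<^sub>R c (ty x)) \<subseteq> ty x"
    and pos: "\<And>x y l. x \<in> D \<Longrightarrow> y \<in> D \<Longrightarrow> x \<noteq> 0 \<Longrightarrow> y \<noteq> 0 \<Longrightarrow> ty x \<subseteq> ty y \<Longrightarrow> l \<in> ty y \<Longrightarrow> 0 \<le> ev l (c (ty x))"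
begin

definition types :: "'l set set" where "types = ty ` (D - {0})"

definition flags :: "('l set \<Rightarrow> real) set" where
  "flags = {t. (\<forall>\<sigma>. 0 \<le> t \<sigma>) \<and> {\<sigma>. t \<sigma> \<noteq> 0} \<subseteq> types \<and> Complete_Partial_Order.chain (\<le>) {\<sigma>. t \<sigma> \<noteq> 0}}"

definition comb :: "('l set \<Rightarrow> real) \<Rightarrow> 'x" where
  "comb t = (\<Sum>\<sigma>\<in>types. t \<sigma> *\<^sub>R c \<sigma>)"

lemma finite_types: "finite types"
  unfolding types_def by (rule finite_subset[of _ "Pow I"]) (auto simp: ty_eq fin)

lemma flagsD:
  assumes "t \<in> flags"
  shows "0 \<le> t \<sigma>" "{\<sigma>. t \<sigma> \<noteq> 0} \<subseteq> types" "Complete_Partial_Order.chain (\<le>) {\<sigma>. t \<sigma> \<noteq> 0}" "finite {\<sigma>. t \<sigma> \<noteq> 0}"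
  using assms finite_types unfolding flags_def by (auto intro: finite_subset)

lemma typesE:
  assumes "\<sigma> \<in> types" obtains x where "x \<in> D" "x \<noteq> 0" "\<sigma> = ty x"
  using assms unfolding types_def by blast

lemma types_nonempty: "\<sigma> \<in> types \<Longrightarrow> \<sigma> \<noteq> {}"
  using ty_empty by (auto elim!: typesE)

lemma types_c: "\<sigma> \<in> types \<Longrightarrow> ty (c \<sigma>) = \<sigma>"
  using ty_c by (auto elim!: typesE)

lemma types_pos: "\<sigma> \<in> types \<Longrightarrow> \<tau> \<in> types \<Longrightarrow> \<sigma> \<subseteq> \<tau> \<Longrightarrow> l \<in> \<tau> \<Longrightarrow> 0 \<le> ev l (c \<sigma>)"
  using pos by (metis typesE)

lemma linear_comb: "linear comb"
  unfolding comb_def by (rule linearI) (auto simp: scaleR_fun_def algebra_simps sum.distrib scaleR_sum_right)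

lemma comb_update:
  assumes "\<sigma> \<in> types" shows "comb (t(\<sigma> := a)) = comb t + (a - t \<sigma>) *\<^sub>R c \<sigma>"
proof -
  have "(\<Sum>\<tau>\<in>types - {\<sigma>}. (t(\<sigma> := a)) \<tau> *\<^sub>R c \<tau>) = (\<Sum>\<tau>\<in>types - {\<sigma>}. t \<tau> *\<^sub>R c \<tau>)"
    by (rule sum.cong) auto
  then show ?thesis
    unfolding comb_def using sum.remove[OF finite_types assms, of "\<lambda>\<tau>. (t(\<sigma> := a)) \<tau> *\<^sub>R c \<tau>"]
      sum.remove[OF finite_types assms, of "\<lambda>\<tau>. t \<tau> *\<^sub>R c \<tau>"] by (simp add: algebra_simps)
qed

lemma flags_update:
  assumes "t \<in> flags" "\<sigma> \<in> types" "0 \<le> a" "\<And>\<tau>. t \<tau> \<noteq> 0 \<Longrightarrow> \<tau> \<subseteq> \<sigma> \<or> \<sigma> \<subseteq> \<tau>"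
  shows "t(\<sigma> := a) \<in> flags"
proof -
  have "{\<tau>. (t(\<sigma> := a)) \<tau> \<noteq> 0} \<subseteq> insert \<sigma> {\<tau>. t \<tau> \<noteq> 0}" by auto
  moreover have "Complete_Partial_Order.chain (\<le>) (insert \<sigma> {\<tau>. t \<tau> \<noteq> 0})"
    using flagsD(3)[OF assms(1)] assms(4) unfolding Complete_Partial_Order.chain_def by blast
  ultimately have "Complete_Partial_Order.chain (\<le>) {\<tau>. (t(\<sigma> := a)) \<tau> \<noteq> 0}" by (rule chain_subset[rotated])
  moreover have "{\<tau>. (t(\<sigma> := a)) \<tau> \<noteq> 0} \<subseteq> types" using flagsD(2)[OF assms(1)] assms(2) by auto
  ultimately show ?thesis using flagsD(1)[OF assms(1)] assms(3) unfolding flags_def by simp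
qed

lemma ev_comb: "l \<in> I \<Longrightarrow> ev l (comb t) = (\<Sum>\<sigma>\<in>types. t \<sigma> * ev l (c \<sigma>))"
  unfolding comb_def by (simp add: linear_sum[OF lin] linear_scale[OF lin])

text \<open>By \<open>pos\<close> the vectors of smaller strata cannot cancel a functional that is
  positive on a larger one, so the largest stratum of a flag can be read off from the point. This
  drives the injectivity below.\<close>

lemma ty_comb:
  assumes t: "t \<in> flags"
  shows "ty (comb t) = \<Union>{\<sigma>. t \<sigma> \<noteq> 0}"
proof (intro equalityI subsetI)
  fix l assume "l \<in> \<Union>{\<sigma>. t \<sigma> \<noteq> 0}"
  then obtain \<sigma> where s: "t \<sigma> \<noteq> 0" "l \<in> \<sigma>" by blast
  have st: "\<sigma> \<in> types" using s flagsD(2)[OF t] by blast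
  have lty: "l \<in> I \<and> 0 < ev l (c \<tau>)" if "\<tau> \<in> types" "l \<in> \<tau>" for \<tau>
  proof -
    have "l \<in> ty (c \<tau>)" using types_c[OF that(1)] that(2) by simp
    then show ?thesis by (simp add: ty_eq)
  qed
  have lI: "l \<in> I" using lty[OF st s(2)] by simp
  have "0 \<le> t \<tau> * ev l (c \<tau>)" if "\<tau> \<in> types" for \<tau>
  proof (cases "t \<tau> = 0")
    case False
    then have "\<tau> \<subseteq> \<sigma> \<or> \<sigma> \<subseteq> \<tau>" using flagsD(3)[OF t] s unfolding Complete_Partial_Order.chain_def by blast
    then have "0 \<le> ev l (c \<tau>)"
      using types_pos[OF that st] s(2) lty[OF that] by (meson less_imp_le subsetD)
    then show ?thesis using flagsD(1)[OF t] by simp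
  qed simp
  moreover have "0 < t \<sigma> * ev l (c \<sigma>)" using s lty[OF st s(2)] flagsD(1)[OF t, of \<sigma>] by simp
  ultimately have "0 < (\<Sum>\<tau>\<in>types. t \<tau> * ev l (c \<tau>))"
    using st finite_types by (intro sum_pos2)
  then show "l \<in> ty (comb t)" using lI by (simp add: ty_eq ev_comb)
next
  fix l assume l: "l \<in> ty (comb t)"
  then have lI: "l \<in> I" and "0 < (\<Sum>\<tau>\<in>types. t \<tau> * ev l (c \<tau>))" by (auto simp: ty_eq ev_comb)
  then obtain \<tau> where \<tau>: "\<tau> \<in> types" "0 < t \<tau> * ev l (c \<tau>)"
    using sum_nonpos[of types "\<lambda>\<tau>. t \<tau> * ev l (c \<tau>)"] by (meson not_less)
  then have "0 < ev l (c \<tau>)" "t \<tau> \<noteq> 0" using flagsD(1)[OF t, of \<tau>] by (auto simp: zero_less_mult_iff)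
  then have "l \<in> ty (c \<tau>)" using lI by (simp add: ty_eq)
  then show "l \<in> \<Union>{\<sigma>. t \<sigma> \<noteq> 0}" using types_c[OF \<tau>(1)] \<open>t \<tau> \<noteq> 0\<close> by blast
qed

lemma comb_surj:
  assumes "x \<in> D"
  shows "\<exists>t\<in>flags. comb t = x \<and> (\<forall>\<sigma>. t \<sigma> \<noteq> 0 \<longrightarrow> \<sigma> \<subseteq> ty x)"
  using assms
proof (induction "card (ty x)" arbitrary: x rule: less_induct)
  case less
  have fty: "finite (ty x)" for x using fin by (simp add: ty_eq)
  show ?case
  proof (cases "x = 0")
    case True
    have "(\<lambda>_. 0) \<in> flags" "comb (\<lambda>_. 0) = x" using True by (auto simp: flags_def comb_def chain_def)
    then show ?thesis by (intro bexI[of _ "\<lambda>_. 0"]) auto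
  next
    case False
    let ?\<sigma> = "ty x"
    have ne: "?\<sigma> \<noteq> {}" using ty_empty less.prems False by blast
    have st: "?\<sigma> \<in> types" using less.prems False by (auto simp: types_def)
    have cpos: "0 < ev l (c ?\<sigma>)" if "l \<in> ?\<sigma>" for l
    proof -
      have "l \<in> ty (c ?\<sigma>)" using types_c[OF st] that by simp
      then show ?thesis by (simp add: ty_eq)
    qed
    have xpos: "0 < ev l x" if "l \<in> ?\<sigma>" for l using that by (simp add: ty_eq)
    \<comment> \<open>The moment at which a functional of the stratum first vanishes: the remainder
      is still in \<open>D\<close>, and its stratum is strictly smaller because \<open>k\<close>
      drops out.\<close>
    define T where "T = Min ((\<lambda>l. ev l x / ev l (c ?\<sigma>)) ` ?\<sigma>)"
    have "T \<in> (\<lambda>l. ev l x / ev l (c ?\<sigma>)) ` ?\<sigma>" unfolding T_def using fty ne by (intro Min_in) auto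
    then obtain k where k: "k \<in> ?\<sigma>" "T = ev k x / ev k (c ?\<sigma>)" by blast
    have T0: "0 < T" using k cpos xpos by simp
    have le: "T * ev l (c ?\<sigma>) \<le> ev l x" if "l \<in> ?\<sigma>" for l
    proof -
      have "T \<le> ev l x / ev l (c ?\<sigma>)" unfolding T_def using fty that by (intro Min_le) auto
      then show ?thesis using cpos[OF that] by (simp add: pos_le_divide_eq)
    qed
    let ?y = "x - T *\<^sub>R c ?\<sigma>"
    have y: "?y \<in> D" "ty ?y \<subseteq> ?\<sigma>" using sub[OF less.prems False less_imp_le[OF T0] le] by auto
    have "ev k ?y = 0" using k cpos[OF k(1)] lin[of k] by (simp add: ty_eq linear_diff linear_scale)
    then have "k \<notin> ty ?y" by (simp add: ty_eq)
    then have ps: "ty ?y \<subset> ?\<sigma>" using y(2) k(1) by blast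
    then have "card (ty ?y) < card ?\<sigma>" using fty by (intro psubset_card_mono)
    from less.hyps[OF this y(1)] obtain t where
      t: "t \<in> flags" "comb t = ?y" "\<And>\<tau>. t \<tau> \<noteq> 0 \<Longrightarrow> \<tau> \<subseteq> ty ?y" by blast
    have t0: "t ?\<sigma> = 0" using t(3)[of ?\<sigma>] ps by blast
    have "t(?\<sigma> := T) \<in> flags" using t(3) ps by (intro flags_update t(1) st less_imp_le[OF T0]) blast
    moreover have "comb (t(?\<sigma> := T)) = x" unfolding comb_update[OF st] t0 t(2) by simp
    moreover have "\<tau> \<subseteq> ?\<sigma>" if "(t(?\<sigma> := T)) \<tau> \<noteq> 0" for \<tau>
      using that t(3)[of \<tau>] y(2) by (cases "\<tau> = ?\<sigma>") auto
    ultimately show ?thesis by blast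
  qed
qed

text \<open>Equal points have the same largest stratum by \<open>ty_comb\<close>. Subtracting the
  smaller of its two coefficients from both flags leaves equal points; either induction applies, or
  only the second flag has lost its largest stratum, which is impossible.\<close>

lemma comb_inj:
  assumes "t \<in> flags" "t' \<in> flags" "comb t = comb t'"
  shows "t = t'"
  using assms
proof (induction "card {\<sigma>. t \<sigma> \<noteq> 0}" arbitrary: t t' rule: less_induct)
  case less
  let ?S = "{\<sigma>. t \<sigma> \<noteq> 0}" and ?S' = "{\<sigma>. t' \<sigma> \<noteq> 0}"
  have U: "\<Union>?S = \<Union>?S'" using ty_comb less.prems by metis
  have ne: "\<Union>{\<sigma>. u \<sigma> \<noteq> 0} \<noteq> {}" if "u \<in> flags" "{\<sigma>. u \<sigma> \<noteq> 0} \<noteq> {}" for u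
    using flagsD(2)[OF that(1)] types_nonempty that(2) by blast
  show ?case
  proof (cases "?S = {}")
    case True
    then have "?S' = {}" using ne[OF less.prems(2)] U by auto
    then show ?thesis using True by auto
  next
    case False
    let ?\<sigma> = "\<Union>?S"
    have S: "?\<sigma> \<in> ?S" by (intro Union_chain_in flagsD(3,4)[OF less.prems(1)] False)
    have "?S' \<noteq> {}" using ne[OF less.prems(1) False] U by auto
    then have S': "?\<sigma> \<in> ?S'" unfolding U by (intro Union_chain_in flagsD(3,4)[OF less.prems(2)])
    have st: "?\<sigma> \<in> types" using S flagsD(2)[OF less.prems(1)] by blast
    have cmp: "\<tau> \<subseteq> ?\<sigma> \<or> ?\<sigma> \<subseteq> \<tau>" if "t \<tau> \<noteq> 0" for \<tau> using that by blast
    have cmp': "\<tau> \<subseteq> ?\<sigma> \<or> ?\<sigma> \<subseteq> \<tau>" if "t' \<tau> \<noteq> 0" for \<tau> using that U by blast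
    show ?thesis
    proof (cases "t ?\<sigma> \<le> t' ?\<sigma>")
      case True
      let ?u = "t(?\<sigma> := 0)" and ?u' = "t'(?\<sigma> := t' ?\<sigma> - t ?\<sigma>)"
      have u: "?u \<in> flags" "?u' \<in> flags"
        using True by (auto intro!: flags_update[OF less.prems(1) st _ cmp] flags_update[OF less.prems(2) st _ cmp'] simp del: Union_iff)
      have "comb ?u = comb ?u'" unfolding comb_update[OF st] less.prems(3) by (simp add: algebra_simps)
      moreover have "{\<sigma>. ?u \<sigma> \<noteq> 0} \<subset> ?S" using S by auto
      then have "card {\<sigma>. ?u \<sigma> \<noteq> 0} < card ?S" by (intro psubset_card_mono flagsD(4) less.prems(1))
      ultimately have eq: "?u = ?u'" using less.hyps u by blast
      show ?thesis
      proof
        fix \<tau> show "t \<tau> = t' \<tau>" using fun_cong[OF eq, of \<tau>] by (cases "\<tau> = ?\<sigma>") auto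
      qed
    next
      case False
      let ?u = "t(?\<sigma> := t ?\<sigma> - t' ?\<sigma>)" and ?u' = "t'(?\<sigma> := 0)"
      have u: "?u \<in> flags" "?u' \<in> flags"
        using False by (auto intro!: flags_update[OF less.prems(1) st _ cmp] flags_update[OF less.prems(2) st _ cmp'] simp del: Union_iff)
      have "comb ?u = comb ?u'" unfolding comb_update[OF st] less.prems(3) by (simp add: algebra_simps)
      then have eq: "\<Union>{\<tau>. ?u \<tau> \<noteq> 0} = \<Union>{\<tau>. ?u' \<tau> \<noteq> 0}" using ty_comb u by metis
      have "?\<sigma> \<in> {\<tau>. ?u \<tau> \<noteq> 0}" using False by auto
      then have sub: "?\<sigma> \<subseteq> \<Union>{\<tau>. ?u' \<tau> \<noteq> 0}" unfolding eq[symmetric] by blast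
      then have "{\<tau>. ?u' \<tau> \<noteq> 0} \<noteq> {}" using types_nonempty[OF st] by (metis Union_empty subset_empty)
      then have "\<Union>{\<tau>. ?u' \<tau> \<noteq> 0} \<in> {\<tau>. ?u' \<tau> \<noteq> 0}" by (intro Union_chain_in flagsD(3,4)[OF u(2)])
      moreover have "\<Union>{\<tau>. ?u' \<tau> \<noteq> 0} \<subseteq> ?\<sigma>" unfolding U by (auto split: if_splits)
      ultimately have "?\<sigma> \<in> {\<tau>. ?u' \<tau> \<noteq> 0}" using sub by (metis subset_antisym)
      then show ?thesis by simp
    qed
  qed
qed

text \<open>Adding the empty stratum with weight \<open>1 - \<Sum>t\<close> turns flags of total weight at most \<open>1\<close> into
  points of an order complex.\<close>

lemma flags_order_space:
  assumes "f \<in> order_space (insert {} types)"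
  shows "f({} := 0) \<in> flags" "comb (f({} := 0)) = comb f" "sum (f({} := 0)) types \<le> 1"
proof -
  have f: "\<forall>v. 0 \<le> f v" "{v. f v \<noteq> 0} \<subseteq> insert {} types" "Complete_Partial_Order.chain (\<le>) {v. f v \<noteq> 0}"
    "sum f (insert {} types) = 1"
    using assms finite_types order_space_iff[of "insert {} types" f] by auto
  have n: "{} \<notin> types" using types_nonempty by blast
  have "Complete_Partial_Order.chain (\<le>) {v. (f({} := 0)) v \<noteq> 0}"
    by (rule chain_subset[OF f(3)]) auto
  then show "f({} := 0) \<in> flags" using f(1,2) unfolding flags_def by (auto split: if_splits)
  show "comb (f({} := 0)) = comb f" unfolding comb_def using n by (intro sum.cong) auto
  have "sum (f({} := 0)) types = sum f types" using n by (intro sum.cong) auto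
  then show "sum (f({} := 0)) types \<le> 1" using f(1,4) n finite_types by (simp add: )
      (metis add_le_cancel_right add_0 f(1))
qed

lemma order_space_flags:
  assumes t: "t \<in> flags" "sum t types \<le> 1"
  shows "t({} := 1 - sum t types) \<in> order_space (insert {} types)" "comb (t({} := 1 - sum t types)) = comb t"
proof -
  have n: "{} \<notin> types" using types_nonempty by blast
  let ?f = "t({} := 1 - sum t types)"
  have s: "sum ?f types = sum t types" using n by (intro sum.cong) auto
  have "{v. ?f v \<noteq> 0} \<subseteq> insert {} {v. t v \<noteq> 0}" by auto
  moreover have "Complete_Partial_Order.chain (\<le>) (insert {} {v. t v \<noteq> 0})"
    using flagsD(3)[OF t(1)] unfolding Complete_Partial_Order.chain_def by blast
  ultimately have "Complete_Partial_Order.chain (\<le>) {v. ?f v \<noteq> 0}" by (rule chain_subset[rotated])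
  moreover have "{v. ?f v \<noteq> 0} \<subseteq> insert {} types" using flagsD(2)[OF t(1)] by auto
  moreover have "sum ?f (insert {} types) = 1" using n finite_types s by simp
  ultimately show "?f \<in> order_space (insert {} types)"
    using finite_types order_space_iff[of "insert {} types" ?f] flagsD(1)[OF t(1)] t(2) by simp
  show "comb ?f = comb t" unfolding comb_def using n by (intro sum.cong) auto
qed

lemma order_space_comb_inj: "inj_on comb (order_space (insert {} types))"
proof (rule inj_onI)
  fix f g assume fg: "f \<in> order_space (insert {} types)" "g \<in> order_space (insert {} types)" "comb f = comb g"
  have eq: "f({} := 0) = g({} := 0)"
    using comb_inj[OF flags_order_space(1)[OF fg(1)] flags_order_space(1)[OF fg(2)]]
      flags_order_space(2)[OF fg(1)] flags_order_space(2)[OF fg(2)] fg(3) by metis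
  then have e: "f \<tau> = g \<tau>" if "\<tau> \<noteq> {}" for \<tau> using eq that by (metis fun_upd_other)
  have n: "{} \<notin> types" using types_nonempty by blast
  have "sum f (insert {} types) = 1" "sum g (insert {} types) = 1"
    using fg finite_types order_space_iff[of "insert {} types"] by auto
  moreover have "sum f types = sum g types" by (intro sum.cong refl e) (use n in blast)
  ultimately have "f {} = g {}" using n finite_types by simp
  then show "f = g" using e by (metis ext)
qed

end

section \<open>Unit balls of lattice-linear gauges\<close>

text \<open>Homogeneity is part of lattice-linearity, so the unit ball is star-shaped about the
  origin; it is in general not convex.\<close>

locale gauge =
  fixes n :: nat and p :: "(nat \<Rightarrow> real) \<Rightarrow> real"
  assumes LLp: "lattice_linear p" and p_pos: "\<And>x. x \<in> coord_space n \<Longrightarrow> x \<noteq> (\<lambda>_. 0) \<Longrightarrow> 0 < p x"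
begin

definition gauge_ball :: "(nat \<Rightarrow> real) set" where
  "gauge_ball = {x \<in> coord_space n. p x \<le> 1}"

end

lemma coord_space_scaleR: "x \<in> coord_space n \<Longrightarrow> a *\<^sub>R x \<in> coord_space n"
  by (auto simp: scaleR_fun_def)

lemma coord_space_add: "x \<in> coord_space n \<Longrightarrow> y \<in> coord_space n \<Longrightarrow> x + y \<in> coord_space n"
  by auto

lemma coord_space_diff: "x \<in> coord_space n \<Longrightarrow> y \<in> coord_space n \<Longrightarrow> x - y \<in> coord_space n"
  by auto

lemma coord_space_sum: "(\<And>i. i \<in> I \<Longrightarrow> f i \<in> coord_space n) \<Longrightarrow> sum f I \<in> coord_space n"
  by (auto simp: sum_fun_apply)

text \<open>Closure under negation makes the positive functionals at a point record its full sign
  vector, including the zeros, so that \<open>ty\<close> names the cells of the arrangement. The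
  coordinates are included so that only the origin has the empty type.\<close>

locale symmetric_functionals =
  fixes L :: "((nat \<Rightarrow> real) \<Rightarrow> real) set" and n :: nat
  assumes finL: "finite L" and linL: "\<And>l. l \<in> L \<Longrightarrow> linear l"
    and symL: "\<And>l. l \<in> L \<Longrightarrow> (\<lambda>x. - l x) \<in> L"
    and coordL: "\<And>i. i < n \<Longrightarrow> (\<lambda>x. x i) \<in> L"
begin

definition ty :: "(nat \<Rightarrow> real) \<Rightarrow> ((nat \<Rightarrow> real) \<Rightarrow> real) set" where
  "ty = (\<lambda>x. {l\<in>L. 0 < l x})"

lemma ty_scaleR: "0 < a \<Longrightarrow> ty (a *\<^sub>R x) = ty x"
  unfolding ty_def using linL by (auto simp: linear_scale zero_less_mult_iff)

text \<open>A functional and its negative cannot both be positive at \<open>z\<close>, so points in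
  the closure of the cell of \<open>z\<close> never lie strictly on opposite sides.\<close>

lemma ty_same_sign:
  assumes "ty u \<subseteq> ty z" "ty w \<subseteq> ty z" "l \<in> L"
  shows "0 \<le> l u * l w"
proof (rule ccontr)
  have m: "(\<lambda>x. - l x) \<in> L" using symL[OF assms(3)] .
  assume "\<not> 0 \<le> l u * l w"
  then have "l u > 0 \<and> l w < 0 \<or> l u < 0 \<and> l w > 0" by (simp add: not_le mult_less_0_iff)
  then have "l \<in> ty z \<and> (\<lambda>x. - l x) \<in> ty z"
    using assms m by (auto simp: ty_def subset_iff)
  then show False by (auto simp: ty_def)
qed

lemma fan:
  assumes c: "\<And>x. x \<in> coord_space n \<Longrightarrow> x \<noteq> 0 \<Longrightarrow> c (ty x) \<in> coord_space n \<and> ty (c (ty x)) = ty x"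
  shows "flag_fan L (\<lambda>l. l) (coord_space n) c ty"
proof (rule flag_fan.intro)
  show "ty x = {l\<in>L. 0 < l x}" for x by (simp add: ty_def)
  fix x assume x: "x \<in> coord_space n"
  show "x = 0" if e: "ty x = {}"
  proof
    fix i show "x i = 0 i"
    proof (cases "i < n")
      case True
      have "\<not> 0 < l x" if "l \<in> L" for l using e that by (auto simp: ty_def)
      then have "\<not> 0 < x i" "\<not> 0 < - x i" using coordL[OF True] symL[OF coordL[OF True]] by blast+
      then show ?thesis by simp
    qed (use x in simp)
  qed
  assume x0: "x \<noteq> 0"
  show "ty (c (ty x)) = ty x" using c[OF x x0] by simp
  let ?c = "c (ty x)"
  have cc: "?c \<in> coord_space n" "ty ?c = ty x" using c[OF x x0] by auto
  show "0 \<le> l (c (ty x))" if "y \<in> coord_space n" "y \<noteq> 0" "ty x \<subseteq> ty y" "l \<in> ty y" for y l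
  proof -
    have "0 \<le> l y * l ?c" using that cc(2) by (intro ty_same_sign[of y y]) (auto simp: ty_def)
    then show ?thesis using that(4) by (auto simp: ty_def zero_le_mult_iff)
  qed
  fix t :: real assume t: "0 \<le> t" "\<And>l. l \<in> ty x \<Longrightarrow> t * l (c (ty x)) \<le> l x"
  have "x - t *\<^sub>R ?c \<in> coord_space n" by (intro coord_space_diff coord_space_scaleR x cc)
  moreover have "l \<in> ty x" if "l \<in> ty (x - t *\<^sub>R ?c)" for l
  proof (rule ccontr)
    assume l: "l \<notin> ty x"
    have lL: "l \<in> L" "0 < l x - t * l ?c" using that linL by (auto simp: ty_def linear_diff linear_scale)
    have "l x \<le> 0" using l lL by (auto simp: ty_def)
    then have neg: "l ?c < 0" using lL t(1) by (smt (verit) mult_nonneg_nonneg)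
    then have "(\<lambda>x. - l x) \<in> ty ?c" using symL[OF lL(1)] by (simp add: ty_def)
    \<comment> \<open>The bound on \<open>t\<close> applied to the negated functional: the
      subtraction cannot carry the point across a hyperplane on whose negative side it
      started.\<close>
    then have "t * - l ?c \<le> - l x" using t(2)[of "\<lambda>x. - l x"] cc(2) by simp
    then show False using lL(2) by simp
  qed
  ultimately show "x - t *\<^sub>R ?c \<in> coord_space n \<and> ty (x - t *\<^sub>R ?c) \<subseteq> ty x" by blast
qed (rule finL, rule linL)

end

locale gauge_fan = symmetric_functionals L n + gauge n p for L n p +
  fixes \<Lambda> assumes sel: "selected_from \<Lambda> p" and diffL: "\<And>l m. l \<in> \<Lambda> \<Longrightarrow> m \<in> \<Lambda> \<Longrightarrow> (\<lambda>x. l x - m x) \<in> L"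
begin

definition representative :: "((nat \<Rightarrow> real) \<Rightarrow> real) set \<Rightarrow> nat \<Rightarrow> real" where
  "representative \<sigma> = (SOME x. x \<in> coord_space n \<and> x \<noteq> 0 \<and> ty x = \<sigma>)"

text \<open>The representative of a cell is chosen without reference to the gauge; only its scaling
  to the unit sphere depends on \<open>p\<close>. Hence two gauges over the same \<open>L\<close>
  share all combinatorial data.\<close>

definition vertex :: "((nat \<Rightarrow> real) \<Rightarrow> real) set \<Rightarrow> nat \<Rightarrow> real" where
  "vertex \<sigma> = (1 / p (representative \<sigma>)) *\<^sub>R representative \<sigma>"

lemma representative:
  assumes "x \<in> coord_space n" "x \<noteq> 0"
  shows "representative (ty x) \<in> coord_space n" "representative (ty x) \<noteq> 0" "ty (representative (ty x)) = ty x"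
proof -
  have "\<exists>y. y \<in> coord_space n \<and> y \<noteq> 0 \<and> ty y = ty x" using assms by blast
  from someI_ex[OF this] show "representative (ty x) \<in> coord_space n" "representative (ty x) \<noteq> 0" "ty (representative (ty x)) = ty x"
    unfolding representative_def by blast+
qed

lemma vertex:
  assumes "x \<in> coord_space n" "x \<noteq> 0"
  shows "vertex (ty x) \<in> coord_space n" "ty (vertex (ty x)) = ty x" "p (vertex (ty x)) = 1"
proof -
  let ?r = "representative (ty x)"
  note r = representative[OF assms]
  have pp: "0 < p ?r" using p_pos[OF r(1)] r(2) by (simp add: zero_fun_def)
  show "vertex (ty x) \<in> coord_space n" unfolding vertex_def by (rule coord_space_scaleR[OF r(1)])
  show "ty (vertex (ty x)) = ty x" unfolding vertex_def using ty_scaleR[of "1 / p ?r"] pp r(3) by simp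
  show "p (vertex (ty x)) = 1" unfolding vertex_def using lattice_linear_homogeneous[OF LLp, of "1 / p ?r"] pp by simp
qed

sublocale flag_fan L "\<lambda>l. l" "coord_space n" vertex ty
  by (rule fan) (use vertex in blast)

lemma comb_in: "comb t \<in> coord_space n"
proof -
  have "vertex \<sigma> \<in> coord_space n" if "\<sigma> \<in> types" for \<sigma> using that vertex(1) by (auto elim!: typesE)
  then show ?thesis unfolding comb_def by (intro coord_space_sum coord_space_scaleR)
qed

text \<open>The vertices along a flag and their combination all lie in the closed cell of the
  combination, so a single linear functional computes \<open>p\<close> at all of them, and it is 1
  at each vertex that occurs.\<close>

lemma p_comb:
  assumes t: "t \<in> flags"
  shows "p (comb t) = sum t types"
proof -
  let ?S = "insert (comb t) (vertex ` {\<sigma>. t \<sigma> \<noteq> 0})"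
  have sub: "ty u \<subseteq> ty (comb t)" if uS: "u \<in> ?S" for u
  proof -
    consider "u = comb t" | \<sigma> where "t \<sigma> \<noteq> 0" "u = vertex \<sigma>" using uS by blast
    then show ?thesis
    proof cases
      case 2
      then have "ty u = \<sigma>" using types_c[of \<sigma>] flagsD(2)[OF t] by auto
      then show ?thesis using 2(1) unfolding ty_comb[OF t] by blast
    qed simp
  qed
  have "compatible \<Lambda> ?S"
    unfolding compatible_def
  proof (intro ballI)
    fix u w l m assume h: "u \<in> ?S" "w \<in> ?S" "l \<in> \<Lambda>" "m \<in> \<Lambda>"
    show "0 \<le> (l u - m u) * (l w - m w)"
      using ty_same_sign[OF sub[OF h(1)] sub[OF h(2)] diffL[OF h(3,4)]] .
  qed
  then obtain l where l: "l \<in> \<Lambda>" "\<forall>x\<in>?S. p x = l x" using selected_fromD(3)[OF sel] by blast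
  have ll: "linear l" using selected_fromD(2)[OF sel] l(1) by blast
  have "p (comb t) = l (comb t)" using l(2) by blast
  also have "\<dots> = (\<Sum>\<sigma>\<in>types. t \<sigma> * l (vertex \<sigma>))" unfolding comb_def by (simp add: linear_sum[OF ll] linear_scale[OF ll])
  also have "\<dots> = sum t types"
  proof (rule sum.cong[OF refl])
    fix \<sigma> assume s: "\<sigma> \<in> types"
    show "t \<sigma> * l (vertex \<sigma>) = t \<sigma>"
    proof (cases "t \<sigma> = 0")
      case False
      then have "p (vertex \<sigma>) = l (vertex \<sigma>)" using l(2) by blast
      moreover have "p (vertex \<sigma>) = 1" using s vertex(3) by (auto elim!: typesE)
      ultimately show ?thesis by simp
    qed simp
  qed
  finally show ?thesis .
qed

lemma comb_gauge_ball: "comb ` order_space (insert {} types) = gauge_ball"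
proof (intro equalityI subsetI)
  fix x assume "x \<in> comb ` order_space (insert {} types)"
  then obtain f where f: "f \<in> order_space (insert {} types)" "x = comb f" by blast
  note * = flags_order_space[OF f(1)]
  have "p x \<le> 1" using p_comb[OF *(1)] *(2,3) f(2) by simp
  then show "x \<in> gauge_ball" using comb_in f(2) by (simp add: gauge_ball_def)
next
  fix x assume x: "x \<in> gauge_ball"
  then have "x \<in> coord_space n" by (simp add: gauge_ball_def)
  then obtain t where t: "t \<in> flags" "comb t = x" using comb_surj by blast
  then have "sum t types \<le> 1" using x p_comb[OF t(1)] by (simp add: gauge_ball_def)
  note o = order_space_flags[OF t(1) this]
  have "x = comb (t({} := 1 - sum t types))" using o(2) t(2) by simp
  then show "x \<in> comb ` order_space (insert {} types)" using o(1) by (rule image_eqI)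
qed

end

lemma gauge_balls_piecewise_affine_bijection:
  assumes "gauge n p" "gauge n q"
  shows "\<exists>f. piecewise_affine_on (gauge.gauge_ball n p) f \<and>
    bij_betw f (gauge.gauge_ball n p) (gauge.gauge_ball n q)"
proof -
  obtain \<Lambda> where \<Lambda>: "selected_from \<Lambda> p" using lattice_linear_selection[OF gauge.LLp[OF assms(1)]] by blast
  obtain M where M: "selected_from M q" using lattice_linear_selection[OF gauge.LLp[OF assms(2)]] by blast
  define B where "B = \<Lambda> \<union> M"
  define C :: "((nat \<Rightarrow> real) \<Rightarrow> real) set" where "C = (\<lambda>i x. x i) ` {..<n}"
  \<comment> \<open>The differences of selecting functionals of both gauges make every closed cell
    compatible with either selection. They are closed under negation already; the coordinates need
    their negatives added.\<close>
  define L :: "((nat \<Rightarrow> real) \<Rightarrow> real) set"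
    where "L = (\<lambda>(l, m) x. l x - m x) ` (B \<times> B) \<union> C \<union> (\<lambda>l x. - l x) ` C"
  have B: "finite B" "\<And>l. l \<in> B \<Longrightarrow> linear l"
    using selected_fromD(1,2)[OF \<Lambda>] selected_fromD(1,2)[OF M] by (auto simp: B_def)
  have s: "symmetric_functionals L n"
  proof (rule symmetric_functionals.intro)
    show "finite L" using B by (simp add: L_def C_def)
    show "linear l" if "l \<in> L" for l
      using that B(2) by (auto simp: L_def C_def intro!: linear_compose_sub linear_compose_neg linear_coordinate)
    show "(\<lambda>x. - l x) \<in> L" if "l \<in> L" for l
    proof -
      from that consider (diff) "l \<in> (\<lambda>(l, m) x. l x - m x) ` (B \<times> B)" | (coord) "l \<in> C" | (neg) "l \<in> (\<lambda>l x. - l x) ` C"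
        unfolding L_def by (elim UnE)
      then show ?thesis
      proof cases
        case diff
        then obtain u v where "u \<in> B" "v \<in> B" "l = (\<lambda>x. u x - v x)" by auto
        then have "(\<lambda>x. - l x) = (\<lambda>(l, m) x. l x - m x) (v, u)" "(v, u) \<in> B \<times> B" by auto
        then have "(\<lambda>x. - l x) \<in> (\<lambda>(l, m) x. l x - m x) ` (B \<times> B)" by (rule image_eqI)
        then show ?thesis by (simp add: L_def)
      next
        case coord
        then have "(\<lambda>x. - l x) \<in> (\<lambda>l x. - l x) ` C" by (rule imageI)
        then show ?thesis by (simp add: L_def)
      next
        case neg
        then obtain m where "m \<in> C" "l = (\<lambda>x. - m x)" by blast
        then show ?thesis by (simp add: L_def)
      qed
    qed
    show "(\<lambda>x. x i) \<in> L" if "i < n" for i using that by (auto simp: L_def C_def)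
  qed
  have d: "(\<lambda>x. l x - m x) \<in> L" if "l \<in> B" "m \<in> B" for l m
  proof -
    have "(\<lambda>x. l x - m x) = (\<lambda>(l, m) x. l x - m x) (l, m)" by simp
    then show ?thesis using that unfolding L_def by blast
  qed
  interpret P: gauge_fan L n p \<Lambda>
    using s assms(1) by (intro gauge_fan.intro gauge_fan_axioms.intro \<Lambda> d) (auto simp: B_def)
  interpret Q: gauge_fan L n q M
    using s assms(2) by (intro gauge_fan.intro gauge_fan_axioms.intro M d) (auto simp: B_def)
  \<comment> \<open>The strata depend on \<open>L\<close> and \<open>n\<close> only, so the same
    order complex also parametrizes the ball of \<open>q\<close>.\<close>
  let ?T = "order_space (insert {} P.types)"

  have T: "compact_polyhedron ?T" by (intro order_space_compact_polyhedron) (simp add: P.finite_types)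
  let ?i = "inv_into ?T P.comb"
  have pi: "piecewise_affine_on P.gauge_ball ?i"
    using piecewise_affine_on_inverse[OF T piecewise_affine_on_linear[OF P.linear_comb] P.order_space_comb_inj]
    unfolding P.comb_gauge_ball .
  have bi: "bij_betw ?i P.gauge_ball ?T"
    by (rule bij_betw_inv_into) (use P.order_space_comb_inj P.comb_gauge_ball in \<open>simp add: bij_betw_def\<close>)
  have "piecewise_affine_on P.gauge_ball (\<lambda>x. Q.comb (?i x))"
    by (rule piecewise_affine_on_linear_comp[OF Q.linear_comb pi])
  moreover have bq: "bij_betw Q.comb ?T Q.gauge_ball"
    using Q.order_space_comb_inj Q.comb_gauge_ball by (simp add: bij_betw_def)
  have b: "bij_betw (\<lambda>x. Q.comb (?i x)) P.gauge_ball Q.gauge_ball"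
    using bij_betw_trans[OF bi bq] by (simp add: o_def)
  ultimately show ?thesis by blast
qed

text \<open>The index \<open>n\<close> is included although this coordinate vanishes: it keeps the
  set under \<open>Max\<close> nonempty for \<open>n = 0\<close>.\<close>

lemma max_gauge:
  "gauge n (\<lambda>x. Max ((\<lambda>i. max (x i) (- x i)) ` {..n}))"
  "gauge.gauge_ball n (\<lambda>x. Max ((\<lambda>i. max (x i) (- x i)) ` {..n})) = pl_cube n"
proof -
  show g: "gauge n (\<lambda>x. Max ((\<lambda>i. max (x i) (- x i)) ` {..n}))"
  proof
    show "lattice_linear (\<lambda>x. Max ((\<lambda>i. max (x i) (- x i)) ` {..n}))"
      by (intro lattice_linear_Max lattice_linear.max lattice_linear_uminus lattice_linear.coord) auto
    fix x assume x: "x \<in> coord_space n" "x \<noteq> (\<lambda>_. 0)"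
    then obtain i where i: "x i \<noteq> 0" by blast
    then have "i \<le> n" using x by (metis (mono_tags) mem_Collect_eq nat_le_linear)
    then have "max (x i) (- x i) \<le> Max ((\<lambda>i. max (x i) (- x i)) ` {..n})" by (intro Max_ge) auto
    then show "0 < Max ((\<lambda>i. max (x i) (- x i)) ` {..n})" using i by (auto simp: max_def split: if_splits)
  qed
  show "gauge.gauge_ball n (\<lambda>x. Max ((\<lambda>i. max (x i) (- x i)) ` {..n})) = pl_cube n"
  proof (intro equalityI subsetI)
    fix x assume "x \<in> gauge.gauge_ball n (\<lambda>x. Max ((\<lambda>i. max (x i) (- x i)) ` {..n}))"
    then have "x \<in> coord_space n" "\<And>i. i \<le> n \<Longrightarrow> max (x i) (- x i) \<le> 1"
      unfolding gauge.gauge_ball_def[OF g] by auto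
    then show "x \<in> pl_cube n" by (auto simp: pl_cube_def topspace_Euclidean_space)
  next
    fix x assume "x \<in> pl_cube n"
    then have x: "x \<in> coord_space n" "\<And>i. i < n \<Longrightarrow> - 1 \<le> x i \<and> x i \<le> 1"
      by (auto simp: pl_cube_def topspace_Euclidean_space)
    have "max (x i) (- x i) \<le> 1" if "i \<le> n" for i
      using x that by (cases "i < n") auto
    then show "x \<in> gauge.gauge_ball n (\<lambda>x. Max ((\<lambda>i. max (x i) (- x i)) ` {..n}))"
      using x(1) unfolding gauge.gauge_ball_def[OF g] by simp
  qed
qed

section \<open>Charts of gauge balls\<close>

context gauge
begin

text \<open>Points near \<open>b\<close> share with \<open>b\<close> a closed cell of an arrangement on whose cells \<open>p\<close> is linear. Hence
  \<open>p\<close> is a coordinate transversal to the unit sphere near \<open>b\<close>.\<close>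

lemma slope:
  assumes b: "p b = 1"
  obtains N where "open N" "b \<in> N" "\<And>x t. x \<in> N \<Longrightarrow> x + t *\<^sub>R b \<in> N \<Longrightarrow> p (x + t *\<^sub>R b) = p x + t"
proof -
  obtain \<Lambda> where \<Lambda>: "selected_from \<Lambda> p" using lattice_linear_selection[OF LLp] by blast
  note s = selected_fromD[OF \<Lambda>]
  \<comment> \<open>\<open>N\<close> preserves the strict inequalities that hold at
    \<open>b\<close>. Pairs that agree at \<open>b\<close> are dealt with separately: their
    difference is constant along the direction \<open>b\<close>.\<close>
  define K where "K = {(l, m) \<in> \<Lambda> \<times> \<Lambda>. l b \<noteq> m b}"
  define N where "N = (\<Inter>(l, m)\<in>K. {x. 0 < (l x - m x) * (l b - m b)})"
  have "finite K" using s(1) unfolding K_def by (auto intro: finite_subset[of _ "\<Lambda> \<times> \<Lambda>"])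
  moreover have "open {x. 0 < (l x - m x) * (l b - m b)}" if "(l, m) \<in> K" for l m
    using s(2) that unfolding K_def by (intro open_Collect_less continuous_intros) auto
  ultimately have "open N" unfolding N_def by (intro open_INT) auto
  moreover have "b \<in> N" unfolding N_def K_def by (auto simp: zero_less_mult_iff)
  moreover have "p (x + t *\<^sub>R b) = p x + t" if x: "x \<in> N" "x + t *\<^sub>R b \<in> N" for x t
  proof -
    have ll: "linear l" if "l \<in> \<Lambda>" for l using s(2) that by blast
    have "compatible \<Lambda> {x, x + t *\<^sub>R b, b}"
      unfolding compatible_def
    proof (intro ballI)
      fix u w l m assume h: "u \<in> {x, x + t *\<^sub>R b, b}" "w \<in> {x, x + t *\<^sub>R b, b}" "l \<in> \<Lambda>" "m \<in> \<Lambda>"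
      show "0 \<le> (l u - m u) * (l w - m w)"
      proof (cases "l b = m b")
        case True
        have "l (x + t *\<^sub>R b) - m (x + t *\<^sub>R b) = l x - m x"
          using True by (simp add: linear_add[OF ll[OF h(3)]] linear_add[OF ll[OF h(4)]] linear_scale[OF ll[OF h(3)]] linear_scale[OF ll[OF h(4)]])
        then show ?thesis using h(1,2) True by auto
      next
        case False
        have "(l, m) \<in> K" using h False by (simp add: K_def)
        then have *: "0 < (l v - m v) * (l b - m b)" if "v \<in> N" for v using that by (auto simp: N_def)
        have **: "0 < (l v - m v) * (l b - m b)" if "v \<in> {x, x + t *\<^sub>R b, b}" for v
          using that * x \<open>b \<in> N\<close> by auto
        show ?thesis using **[OF h(1)] **[OF h(2)] by (auto simp: zero_less_mult_iff zero_le_mult_iff)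
      qed
    qed
    then obtain l where l: "l \<in> \<Lambda>" "\<forall>v\<in>{x, x + t *\<^sub>R b, b}. p v = l v" using s(3) by blast
    then have "p (x + t *\<^sub>R b) = p x + t * p b" by (simp add: linear_add[OF ll] linear_scale[OF ll])
    then show ?thesis using b by simp
  qed
  ultimately show ?thesis by (rule that)
qed

text \<open>The defect \<open>1 - p x\<close> is used as the half-space coordinate, and the
  projection along \<open>b\<close> to a coordinate hyperplane supplies the others. By
  \<open>slope\<close>, near \<open>b\<close> the defect is an affine coordinate along each line in
  direction \<open>b\<close>.\<close>

lemma boundary_chart:
  assumes b: "b \<in> coord_space n" "p b = 1"
  obtains N V \<beta> \<beta>' where "open N" "b \<in> N" "openin (half_space n) V"
    "\<beta> ` (gauge_ball \<inter> N) \<subseteq> V" "\<beta>' ` V \<subseteq> gauge_ball \<inter> N"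
    "\<And>x. x \<in> gauge_ball \<inter> N \<Longrightarrow> \<beta>' (\<beta> x) = x" "\<And>z. z \<in> V \<Longrightarrow> \<beta> (\<beta>' z) = z"
    "piecewise_affine_on (coord_space n) \<beta>" "piecewise_affine_on (coord_space n) \<beta>'"
proof -
  have "b \<noteq> (\<lambda>_. 0)" using b(2) lattice_linear_0[OF LLp] by auto
  then obtain k where k: "b k \<noteq> 0" by blast
  then have kn: "k < n" using b(1) by (metis (mono_tags) mem_Collect_eq not_le)
  obtain N0 where N0: "open N0" "b \<in> N0" "\<And>x t. x \<in> N0 \<Longrightarrow> x + t *\<^sub>R b \<in> N0 \<Longrightarrow> p (x + t *\<^sub>R b) = p x + t"
    using slope[OF b(2)] by blast
  \<comment> \<open>The half-space reserves coordinate 0 for the defect; the transposition moves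
    coordinate 0 of \<open>y x\<close> to the slot \<open>k\<close>, which the projection has
    emptied.\<close>
  define \<pi> where "\<pi> i = (if i = 0 then k else if i = k then 0 else i)" for i :: nat
  have \<pi>\<pi>: "\<pi> (\<pi> i) = i" for i by (simp add: \<pi>_def)
  have \<pi>n: "\<pi> i = i" if "n \<le> i" for i using that kn by (auto simp: \<pi>_def)
  define y where "y x = x - (x k / b k) *\<^sub>R b" for x
  define \<beta> where "\<beta> x i = (if i = 0 then 1 - p x else y x (\<pi> i))" for x i
  define \<eta> where "\<eta> z i = (if i = k then 0 else z (\<pi> i))" for z :: "nat \<Rightarrow> real" and i
  \<comment> \<open>The line over \<open>z\<close> is entered at \<open>\<eta> z + b\<close>, which
    for \<open>z\<close> in \<open>V\<close> lies where \<open>slope\<close> is valid. Moving on by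
    \<open>1 - z 0 - p (\<eta> z + b)\<close> along \<open>b\<close> reaches the level
    \<open>1 - z 0\<close>; the entry point accounts for the other 1.\<close>
  define \<beta>' where "\<beta>' z = \<eta> z + (2 - z 0 - p (\<eta> z + b)) *\<^sub>R b" for z
  have yk: "y x k = 0" for x using k by (simp add: y_def scaleR_fun_def)
  have yy: "y (u + t *\<^sub>R b) = u" if "u k = 0" for u t using that k by (auto simp: y_def scaleR_fun_def)
  have \<eta>\<beta>: "\<eta> (\<beta> x) = y x" for x
    using yk[of x] by (auto simp: \<eta>_def \<beta>_def fun_eq_iff \<pi>\<pi>) (auto simp: \<pi>_def split: if_splits)
  have \<eta>k: "\<eta> z k = 0" for z by (simp add: \<eta>_def)
  define N where "N = {x \<in> N0. y x + b \<in> N0}"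
  define V where "V = {z \<in> coord_half_space n. \<beta>' z \<in> N0 \<and> \<eta> z + b \<in> N0}"
  have cy: "continuous_on UNIV (\<lambda>x. y x + b)"
    unfolding y_def by (intro continuous_on_coordinatewise_then_product)
      (auto simp: scaleR_fun_def intro!: continuous_intros continuous_on_product_coordinates k)
  have c\<eta>: "continuous_on UNIV (\<lambda>z. \<eta> z + b)"
  proof (rule continuous_on_coordinatewise_then_product)
    show "continuous_on UNIV (\<lambda>z. (\<eta> z + b) i)" for i
      unfolding \<eta>_def by (cases "i = k") (auto intro!: continuous_intros continuous_on_product_coordinates)
  qed
  have cp\<eta>: "continuous_on UNIV (\<lambda>z. p (\<eta> z + b))"
    by (rule continuous_on_compose2[OF lattice_linear_continuous[OF LLp, of UNIV] c\<eta>]) auto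
  have c\<beta>': "continuous_on UNIV \<beta>'"
  proof (rule continuous_on_coordinatewise_then_product)
    fix i
    have "continuous_on UNIV (\<lambda>z. \<eta> z i)"
      unfolding \<eta>_def by (cases "i = k") (auto intro!: continuous_intros continuous_on_product_coordinates)
    then show "continuous_on UNIV (\<lambda>z. \<beta>' z i)"
      unfolding \<beta>'_def by (auto simp: scaleR_fun_def intro!: continuous_intros continuous_on_product_coordinates cp\<eta>)
  qed
  have shift: "p x = p (y x + b) - (1 - x k / b k)" if "x \<in> N0" "y x + b \<in> N0" for x
  proof -
    have "x + (1 - x k / b k) *\<^sub>R b = y x + b" by (auto simp: y_def algebra_simps)
    then show ?thesis using N0(3)[of x "1 - x k / b k"] that by simp
  qed
  have y\<beta>': "y (\<beta>' z) = \<eta> z" and rk: "\<beta>' z k / b k = 2 - z 0 - p (\<eta> z + b)" for z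
    using yy[of "\<eta> z"] k \<eta>k[of z] by (simp_all add: \<beta>'_def scaleR_fun_def)
  have p\<beta>': "p (\<beta>' z) = 1 - z 0" if "z \<in> V" for z
    using shift[of "\<beta>' z"] that unfolding y\<beta>' rk by (simp add: V_def)
  have \<eta>in: "\<eta> z \<in> coord_space n" if "z \<in> coord_space n" for z using that \<pi>n kn by (auto simp: \<eta>_def)
  have \<beta>'in: "\<beta>' z \<in> coord_space n" if "z \<in> coord_space n" for z
    unfolding \<beta>'_def by (intro coord_space_add coord_space_scaleR b \<eta>in that)
  have yin: "y x \<in> coord_space n" if "x \<in> coord_space n" for x
    unfolding y_def by (intro coord_space_diff coord_space_scaleR b that)
  have \<beta>in: "\<beta> x \<in> coord_space n" if "x \<in> coord_space n" for x
    using yin[OF that] \<pi>n kn by (auto simp: \<beta>_def)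
  have inv1: "\<beta>' (\<beta> x) = x" if x: "x \<in> N" for x
  proof -
    have "2 - \<beta> x 0 - p (y x + b) = x k / b k" using shift[of x] x by (simp add: N_def \<beta>_def)
    then show ?thesis unfolding \<beta>'_def \<eta>\<beta> by (simp add: y_def)
  qed
  show ?thesis
  proof (rule that[of N V \<beta> \<beta>'])
    have "N = N0 \<inter> (\<lambda>x. y x + b) -` N0" by (auto simp: N_def)
    then show "open N" using open_Int[OF N0(1) open_vimage[OF N0(1) cy]] by simp
    show "b \<in> N" using N0(2) k by (simp add: N_def y_def)
    have "V = coord_half_space n \<inter> (\<beta>' -` N0 \<inter> (\<lambda>z. \<eta> z + b) -` N0)" by (auto simp: V_def)
    then show "openin (half_space n) V" unfolding half_space_eq
      using openin_open_Int[OF open_Int[OF open_vimage[OF N0(1) c\<beta>'] open_vimage[OF N0(1) c\<eta>]], of "coord_half_space n"]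
      by simp
    show "\<beta> ` (gauge_ball \<inter> N) \<subseteq> V"
    proof clarify
      fix x assume x: "x \<in> gauge_ball" "x \<in> N"
      have "\<beta> x \<in> coord_space n" using x \<beta>in by (simp add: gauge_ball_def)
      moreover have "0 \<le> \<beta> x 0" using x by (simp add: gauge_ball_def \<beta>_def)
      ultimately show "\<beta> x \<in> V" using x(2) inv1[OF x(2)] by (simp add: N_def V_def \<eta>\<beta>)
    qed
    show "\<beta>' ` V \<subseteq> gauge_ball \<inter> N"
    proof clarify
      fix z assume z: "z \<in> V"
      have "\<beta>' z \<in> coord_space n" "0 \<le> z 0" using z \<beta>'in by (auto simp: V_def)
      then have "\<beta>' z \<in> gauge_ball" using p\<beta>'[OF z] by (simp add: gauge_ball_def)
      then show "\<beta>' z \<in> gauge_ball \<inter> N" using z by (simp add: N_def V_def y\<beta>')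
    qed
    show "\<beta>' (\<beta> x) = x" if "x \<in> gauge_ball \<inter> N" for x using inv1 that by blast
    show "\<beta> (\<beta>' z) = z" if z: "z \<in> V" for z
    proof
      fix i show "\<beta> (\<beta>' z) i = z i"
        using p\<beta>'[OF z] y\<beta>'[of z] by (auto simp: \<beta>_def \<eta>_def \<pi>\<pi>) (auto simp: \<pi>_def split: if_splits)
    qed
    have ll: "piecewise_affine_on X p" for X by (rule lattice_linear_piecewise_affine[OF LLp])
    have pc: "piecewise_affine_on X (\<lambda>x::nat\<Rightarrow>real. x i)" for X i by (rule piecewise_affine_on_linear[OF linear_coordinate])
    have pm: "piecewise_affine_on X (\<lambda>x. f x * a)" if "piecewise_affine_on X f" for X and f :: "(nat \<Rightarrow> real) \<Rightarrow> real" and a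
      using piecewise_affine_on_scaleR_left[OF that, of a] by simp
    show "piecewise_affine_on (coord_space n) \<beta>"
    proof (rule piecewise_affine_on_coordinatewise[of "{..<n}"])
      show "piecewise_affine_on (coord_space n) (\<lambda>x. \<beta> x j)" for j
      proof (cases "j = 0")
        case True
        then show ?thesis by (simp add: \<beta>_def piecewise_affine_on_diff piecewise_affine_on_const ll)
      next
        case False
        have "piecewise_affine_on (coord_space n) (\<lambda>x. x (\<pi> j) - x k * (b (\<pi> j) / b k))"
          by (intro piecewise_affine_on_diff pc pm)
        then show ?thesis using False by (simp add: \<beta>_def y_def scaleR_fun_def)
      qed
    qed (use \<beta>in in auto)
    have p\<eta>: "piecewise_affine_on (coord_space n) (\<lambda>z. \<eta> z j)" for j
      by (cases "j = k") (simp_all add: \<eta>_def piecewise_affine_on_const pc)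
    have "piecewise_affine_on (coord_space n) \<eta>"
      by (rule piecewise_affine_on_coordinatewise[of "{..<n}"]) (use p\<eta> \<eta>in in auto)
    then have "piecewise_affine_on (coord_space n) (\<lambda>z. \<eta> z + b)"
      by (intro piecewise_affine_on_add piecewise_affine_on_const)
    then have "piecewise_affine_on (coord_space n) (\<lambda>z. p (\<eta> z + b))"
      by (rule piecewise_affine_on_comp[OF _ subset_UNIV ll])
    then have pp: "piecewise_affine_on (coord_space n) (\<lambda>z. (2 - z 0 - p (\<eta> z + b)) * b j)" for j
      by (intro pm piecewise_affine_on_diff piecewise_affine_on_const pc)
    show "piecewise_affine_on (coord_space n) \<beta>'"
    proof (rule piecewise_affine_on_coordinatewise[of "{..<n}"])
      show "piecewise_affine_on (coord_space n) (\<lambda>x. \<beta>' x j)" for j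
        using piecewise_affine_on_add[OF p\<eta> pp, of j j] by (simp add: \<beta>'_def scaleR_fun_def)
    qed (use \<beta>'in in auto)
  qed
qed

context
  fixes X :: "('i \<Rightarrow> real) set" and \<theta> :: "('i \<Rightarrow> real) \<Rightarrow> nat \<Rightarrow> real"
  assumes X: "compact_polyhedron X" and \<theta>: "piecewise_affine_on X \<theta>" and bij: "bij_betw \<theta> X gauge_ball"
begin

lemma ball_homeomorphism: "pl_homeomorphism \<theta> X gauge_ball"
  using compact_pl_homeomorphism[OF X \<theta>] bij by (auto simp: bij_betw_def)

lemma ball_continuous: "continuous_on X \<theta>" "continuous_on gauge_ball (inv_into X \<theta>)"
  using ball_homeomorphism pl_map_continuous unfolding pl_homeomorphism_def by blast+

lemma ball_inverse:
  "a \<in> X \<Longrightarrow> inv_into X \<theta> (\<theta> a) = a" "x \<in> gauge_ball \<Longrightarrow> \<theta> (inv_into X \<theta> x) = x"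
  "a \<in> X \<Longrightarrow> \<theta> a \<in> gauge_ball" "x \<in> gauge_ball \<Longrightarrow> inv_into X \<theta> x \<in> X"
  using bij by (auto simp: bij_betw_def f_inv_into_f inv_into_into)

lemma ball_inverse_piecewise_affine: "piecewise_affine_on gauge_ball (inv_into X \<theta>)"
  using piecewise_affine_on_inverse[OF X \<theta>] bij by (simp add: bij_betw_def)

lemma local_chart:
  assumes N: "open N" and V: "pl_polyhedron V" "V \<subseteq> coord_space n"
    and maps: "\<beta> ` (gauge_ball \<inter> N) \<subseteq> V" "\<beta>' ` V \<subseteq> gauge_ball \<inter> N"
    and inv: "\<And>x. x \<in> gauge_ball \<inter> N \<Longrightarrow> \<beta>' (\<beta> x) = x" "\<And>z. z \<in> V \<Longrightarrow> \<beta> (\<beta>' z) = z"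
    and pa: "piecewise_affine_on (coord_space n) \<beta>" "piecewise_affine_on (coord_space n) \<beta>'"
  shows "openin (top_of_set X) {a\<in>X. \<theta> a \<in> N}" "pl_homeomorphic {a\<in>X. \<theta> a \<in> N} V"
proof -
  let ?U = "{a\<in>X. \<theta> a \<in> N}"
  have "?U = X \<inter> \<theta> -` N" by auto
  then show U: "openin (top_of_set X) ?U"
    using continuous_openin_preimage_gen[OF ball_continuous(1) N] by simp
  have "pl_homeomorphism (\<lambda>a. \<beta> (\<theta> a)) ?U V"
  proof (rule pl_homeomorphismI[where g = "\<lambda>z. inv_into X \<theta> (\<beta>' z)"])
    show "pl_polyhedron ?U" using pl_polyhedron_openin[OF compact_imp_pl_polyhedron[OF X] U] .
    show "(\<lambda>a. \<beta> (\<theta> a)) ` ?U \<subseteq> V" using maps(1) ball_inverse(3) by (auto simp: image_subset_iff)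
    show "(\<lambda>z. inv_into X \<theta> (\<beta>' z)) ` V \<subseteq> ?U"
      using maps(2) ball_inverse(2,4) by (auto simp: image_subset_iff)
    show "inv_into X \<theta> (\<beta>' (\<beta> (\<theta> a))) = a" if "a \<in> ?U" for a
      using that inv(1)[of "\<theta> a"] ball_inverse by simp
    show "\<beta> (\<theta> (inv_into X \<theta> (\<beta>' z))) = z" if "z \<in> V" for z
      using that inv(2)[of z] ball_inverse(2)[of "\<beta>' z"] maps(2) by (auto simp: image_subset_iff)
    have "\<theta> ` ?U \<subseteq> coord_space n" using ball_inverse(3) by (auto simp: gauge_ball_def)
    then show "piecewise_affine_on ?U (\<lambda>a. \<beta> (\<theta> a))"
      by (intro piecewise_affine_on_comp[OF _ _ pa(1)] piecewise_affine_on_subset[OF \<theta>]) auto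
    show "piecewise_affine_on V (\<lambda>z. inv_into X \<theta> (\<beta>' z))"
      using maps(2) by (intro piecewise_affine_on_comp[OF _ _ ball_inverse_piecewise_affine] piecewise_affine_on_subset[OF pa(2) V(2)]) auto
  qed (rule V(1))
  then show "pl_homeomorphic ?U V" unfolding pl_homeomorphic_def by blast
qed

lemma open_gauge: "open {x. p x < 1}"
  by (intro open_Collect_less lattice_linear_continuous LLp continuous_on_const)

text \<open>Where \<open>p < 1\<close>, the ball is open in Euclidean space. Conversely, a Euclidean
  chart at \<open>a\<close> makes the ball a neighbourhood of \<open>\<theta> a\<close> by
  invariance of domain, so some multiple of \<open>\<theta> a\<close> by a factor above 1 is still
  in the ball, and homogeneity gives \<open>p (\<theta> a) < 1\<close>.\<close>

lemma ball_interior: "pl_interior (int n) X = {a\<in>X. p (\<theta> a) < 1}"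
proof (intro equalityI subsetI)
  fix a assume "a \<in> {a\<in>X. p (\<theta> a) < 1}"
  then have a: "a \<in> X" "\<theta> a \<in> {x. p x < 1}" by auto
  let ?V = "coord_space n \<inter> {x. p x < 1}"
  have oV: "openin (top_of_set (coord_space n)) ?V" by (rule openin_open_Int[OF open_gauge])
  have V: "pl_polyhedron ?V" by (rule pl_polyhedron_openin[OF pl_polyhedron_Euclidean_space oV])
  have eq: "gauge_ball \<inter> {x. p x < 1} = ?V" by (auto simp: gauge_ball_def)
  have "openin (top_of_set X) {a\<in>X. \<theta> a \<in> {x. p x < 1}}" "pl_homeomorphic {a\<in>X. \<theta> a \<in> {x. p x < 1}} ?V"
    by (rule local_chart[OF open_gauge V, of "\<lambda>x. x" "\<lambda>x. x"]; auto simp: eq piecewise_affine_on_ident)+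
  moreover have "openin (Euclidean_space n) ?V" unfolding Euclidean_space_eq by (rule oV)
  moreover have "a \<in> {a\<in>X. \<theta> a \<in> {x. p x < 1}}" using a by blast
  ultimately show "a \<in> pl_interior (int n) X"
    unfolding pl_interior_def using a(1) by (intro CollectI conjI exI) auto
next
  fix a assume "a \<in> pl_interior (int n) X"
  then obtain U V k where a: "a \<in> X" and U: "openin (top_of_set X) U" "a \<in> U" and V: "openin (Euclidean_space n) V"
    and k: "pl_homeomorphism k U V"
    unfolding pl_interior_def pl_homeomorphic_def by auto
  let ?b = "\<theta> a" and ?m = "\<lambda>z. \<theta> (inv_into U k z)"
  have b: "?b \<in> gauge_ball" by (rule ball_inverse(3)[OF a])
  have UX: "U \<subseteq> X" using U(1) openin_imp_subset by blast
  have bk: "bij_betw (inv_into U k) V U" using k unfolding pl_homeomorphism_def by (simp add: bij_betw_inv_into)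
  have ck: "continuous_on V (inv_into U k)" using k pl_map_continuous unfolding pl_homeomorphism_def by blast
  have cm: "continuous_on V ?m"
    by (rule continuous_on_compose2[OF ball_continuous(1) ck]) (use bk UX in \<open>auto simp: bij_betw_def\<close>)
  have im: "inj_on ?m V"
  proof (rule inj_onI)
    fix z w assume h: "z \<in> V" "w \<in> V" "?m z = ?m w"
    have "inv_into U k z \<in> X" "inv_into U k w \<in> X" using h bk UX by (auto simp: bij_betw_def)
    then have "inv_into U k z = inv_into U k w" using h(3) bij by (metis bij_betw_imp_inj_on inj_onD)
    then show "z = w" using h bk by (metis bij_betw_imp_inj_on inj_onD)
  qed
  have mb: "?m ` V \<subseteq> gauge_ball" using bk UX ball_inverse(3) by (auto simp: bij_betw_def)
  then have mc: "?m ` V \<subseteq> coord_space n" by (auto simp: gauge_ball_def)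
  have "continuous_map (subtopology (Euclidean_space n) V) (Euclidean_space n) ?m"
    unfolding Euclidean_space_eq subtopology_subtopology continuous_map_in_subtopology
    using cm mc by (auto intro: continuous_on_subset)
  then have "openin (Euclidean_space n) (?m ` V)"
    by (intro invariance_of_domain_Euclidean_space V im)
  then obtain T where T: "open T" "?m ` V = coord_space n \<inter> T"
    unfolding Euclidean_space_eq by (auto simp: openin_open)
  have "a \<in> inv_into U k ` V" using bk U(2) by (simp add: bij_betw_def)
  then obtain z where z: "z \<in> V" "inv_into U k z = a" by blast
  then have "?b \<in> ?m ` V" by (intro image_eqI[of _ _ z]) auto
  then have bT: "?b \<in> T" using T(2) by blast
  have "continuous_on UNIV (\<lambda>t. t *\<^sub>R ?b)"
    by (intro continuous_on_coordinatewise_then_product) (auto simp: scaleR_fun_def intro!: continuous_intros)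
  then have "open ((\<lambda>t. t *\<^sub>R ?b) -` T)" by (rule open_vimage[OF T(1)])
  moreover have "1 \<in> (\<lambda>t. t *\<^sub>R ?b) -` T" using bT by simp
  ultimately have "\<exists>r>0. \<forall>y. dist y 1 < r \<longrightarrow> y \<in> (\<lambda>t. t *\<^sub>R ?b) -` T" unfolding open_dist by (rule bspec)
  then obtain r where r: "r > 0" "\<And>t. \<bar>t - 1\<bar> < r \<Longrightarrow> t *\<^sub>R ?b \<in> T" by (auto simp: dist_real_def)
  let ?t = "1 + r / 2"
  have "?t *\<^sub>R ?b \<in> T" using r by simp
  moreover have "?t *\<^sub>R ?b \<in> coord_space n" using b by (intro coord_space_scaleR) (simp add: gauge_ball_def)
  ultimately have "?t *\<^sub>R ?b \<in> gauge_ball" using T(2) mb by blast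
  then have "?t * p ?b \<le> 1" using lattice_linear_homogeneous[OF LLp, of ?t ?b] r(1) by (simp add: gauge_ball_def)
  moreover have "1 < ?t" using r(1) by simp
  ultimately have "p ?b < 1"
    using mult_less_cancel_left_pos[of ?t "p ?b" 1] by (smt (verit) mult.right_neutral mult_left_mono)
  then show "a \<in> {a\<in>X. p (\<theta> a) < 1}" using a by simp
qed

lemma ball_boundary: "pl_boundary (int n) X = {a\<in>X. p (\<theta> a) = 1}"
  unfolding pl_boundary_def ball_interior using ball_inverse(3) by (force simp: gauge_ball_def)

lemma ball_manifold: "pl_manifold (int n) X"
  unfolding pl_manifold_def
proof (intro conjI ballI)
  show "pl_polyhedron X" by (rule compact_imp_pl_polyhedron[OF X])
  \<comment> \<open>The ambient space of \<open>X\<close> may have uncountably many coordinates, so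
    second countability is transported from the ball.\<close>
  obtain \<B> :: "(nat \<Rightarrow> real) set set" where \<B>: "countable \<B>" "topological_basis \<B>"
    using ex_countable_basis by blast
  have "second_countable (euclidean :: (nat \<Rightarrow> real) topology)"
    unfolding second_countable_def
  proof (intro exI[of _ \<B>] conjI ballI allI impI)
    show "openin euclidean V" if "V \<in> \<B>" for V using topological_basis_open[OF \<B>(2) that] by simp
    fix U :: "(nat \<Rightarrow> real) set" and x assume "openin euclidean U \<and> x \<in> U"
    then obtain V where "V \<in> \<B>" "x \<in> V" "V \<subseteq> U" using topological_basisE[OF \<B>(2), of U x] by auto
    then show "\<exists>V\<in>\<B>. x \<in> V \<and> V \<subseteq> U" by blast
  qed (rule \<B>(1))
  then have "second_countable (top_of_set gauge_ball)" by (rule second_countable_subtopology)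
  moreover have "top_of_set X homeomorphic_space top_of_set gauge_ball"
    unfolding homeomorphic_space_def homeomorphic_maps_def
    by (rule exI[of _ \<theta>], rule exI[of _ "inv_into X \<theta>"])
       (use ball_continuous ball_inverse in \<open>auto simp: image_subset_iff\<close>)
  ultimately show "second_countable (top_of_set X)" using homeomorphic_space_second_countability by blast
  fix a assume a: "a \<in> X"
  let ?b = "\<theta> a"
  have b: "?b \<in> coord_space n" "p ?b \<le> 1" using ball_inverse(3)[OF a] by (auto simp: gauge_ball_def)
  show "0 \<le> int n" by simp
  show "\<exists>U V. openin (top_of_set X) U \<and> a \<in> U \<and> openin (half_space (nat (int n))) V \<and> pl_homeomorphic U V"
  proof (cases "p ?b = 1")
    case True
    obtain N V \<beta> \<beta>' where *: "open N" "?b \<in> N" "openin (half_space n) V"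
      "\<beta> ` (gauge_ball \<inter> N) \<subseteq> V" "\<beta>' ` V \<subseteq> gauge_ball \<inter> N"
      "\<And>x. x \<in> gauge_ball \<inter> N \<Longrightarrow> \<beta>' (\<beta> x) = x" "\<And>z. z \<in> V \<Longrightarrow> \<beta> (\<beta>' z) = z"
      "piecewise_affine_on (coord_space n) \<beta>" "piecewise_affine_on (coord_space n) \<beta>'"
      by (rule boundary_chart[OF b(1) True]) (rule that)
    have oV: "openin (top_of_set (coord_half_space n)) V" using *(3) unfolding half_space_eq .
    have V: "pl_polyhedron V" "V \<subseteq> coord_space n"
      using pl_polyhedron_openin[OF pl_polyhedron_half_space oV] openin_imp_subset[OF oV] by auto
    have "openin (top_of_set X) {a\<in>X. \<theta> a \<in> N}" "pl_homeomorphic {a\<in>X. \<theta> a \<in> N} V"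
      using local_chart[OF *(1) V *(4-9)] by auto
    moreover have "a \<in> {a\<in>X. \<theta> a \<in> N}" using a *(2) by simp
    ultimately show ?thesis using *(3) by auto
  next
    case False
    \<comment> \<open>A chart at an interior point has to land in a half-space as well: translating
      coordinate 0 so that it becomes 1 at the image of \<open>a\<close> keeps it positive within
      distance 1. For \<open>n = 0\<close> the half-space is a point and leaves no room for a
      translation.\<close>
    define c where "c = (if n = 0 then 0 else 1 - ?b 0)"
    define e where "e = c *\<^sub>R (unit_vector 0 :: nat \<Rightarrow> real)"
    have e: "e \<in> coord_space n" "e 0 = c" by (auto simp: e_def c_def unit_vector_def scaleR_fun_def)
    define N where "N = {x. p x < 1} \<inter> {x. \<bar>x 0 - ?b 0\<bar> < 1}"
    have N: "open N" unfolding N_def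
      by (intro open_Int open_gauge open_Collect_less continuous_intros continuous_on_product_coordinates)
    define V where "V = coord_half_space n \<inter> {z. z - e \<in> N}"
    have "continuous_on UNIV (\<lambda>z::nat \<Rightarrow> real. z - e)"
      by (intro continuous_on_coordinatewise_then_product) (auto intro!: continuous_intros continuous_on_product_coordinates)
    then have "open {z. z - e \<in> N}" using open_vimage[OF N, of "\<lambda>z. z - e"] by (simp add: vimage_def)
    then have oV: "openin (top_of_set (coord_half_space n)) V" unfolding V_def by (rule openin_open_Int)
    have V: "pl_polyhedron V" "V \<subseteq> coord_space n"
      using pl_polyhedron_openin[OF pl_polyhedron_half_space oV] openin_imp_subset[OF oV] by auto
    have pos: "0 \<le> x 0 + c" if "x \<in> N" "x \<in> coord_space n" for x
      using that by (auto simp: N_def c_def)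
    have m: "(\<lambda>x. x + e) ` (gauge_ball \<inter> N) \<subseteq> V" "(\<lambda>x. x - e) ` V \<subseteq> gauge_ball \<inter> N"
    proof safe
      fix x assume x: "x \<in> gauge_ball" "x \<in> N"
      have xc: "x \<in> coord_space n" using x by (simp add: gauge_ball_def)
      show "x + e \<in> V" using coord_space_add[OF xc e(1)] pos[OF x(2) xc] e(2) x(2) by (simp add: V_def)
    next
      fix z assume z: "z \<in> V"
      then have "z - e \<in> N" "z - e \<in> coord_space n" using coord_space_diff[OF _ e(1)] V(2) by (auto simp: V_def)
      then show "z - e \<in> gauge_ball" "z - e \<in> N" by (auto simp: gauge_ball_def N_def)
    qed
    have "openin (top_of_set X) {a\<in>X. \<theta> a \<in> N}" "pl_homeomorphic {a\<in>X. \<theta> a \<in> N} V"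
      by (rule local_chart[OF N V m]; simp add: piecewise_affine_on_add piecewise_affine_on_diff piecewise_affine_on_ident piecewise_affine_on_const)+
    moreover have "a \<in> {a\<in>X. \<theta> a \<in> N}" using a b(2) False by (simp add: N_def)
    moreover have "openin (half_space n) V" unfolding half_space_eq by (rule oV)
    ultimately show ?thesis by auto
  qed
qed

lemma ball_cube: "pl_homeomorphic X (pl_cube n)"
proof -
  obtain f where f: "piecewise_affine_on gauge_ball f" "bij_betw f gauge_ball (pl_cube n)"
    using gauge_balls_piecewise_affine_bijection[OF gauge_axioms max_gauge(1)] unfolding max_gauge(2) by blast
  have "bij_betw (\<lambda>a. f (\<theta> a)) X (pl_cube n)" using bij_betw_trans[OF bij f(2)] by (simp add: o_def)
  moreover have "piecewise_affine_on X (\<lambda>a. f (\<theta> a))"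
    by (rule piecewise_affine_on_comp[OF \<theta> _ f(1)]) (use bij in \<open>simp add: bij_betw_def\<close>)
  ultimately have "pl_homeomorphism (\<lambda>a. f (\<theta> a)) X (pl_cube n)"
    using compact_pl_homeomorphism[OF X, of "\<lambda>a. f (\<theta> a)"] by (simp add: bij_betw_def)
  then show ?thesis unfolding pl_homeomorphic_def by blast
qed

end

end

section \<open>Cones over shellable complexes\<close>

definition cone_complex :: "'v set set \<Rightarrow> ('v \<Rightarrow> real) set" where
  "cone_complex \<F> = {h. (\<forall>v. 0 \<le> h v) \<and> (\<exists>F\<in>\<F>. {v. h v \<noteq> 0} \<subseteq> F)}"

text \<open>The cones over the free ridges, that is, those contained in a single facet. Their union
  is what \<open>half_chart\<close> sends to the boundary hyperplane.\<close>

definition cone_boundary :: "'v set set \<Rightarrow> ('v \<Rightarrow> real) set" where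
  "cone_boundary \<F> = {h. (\<forall>v. 0 \<le> h v) \<and>
     (\<exists>F\<in>\<F>. \<exists>x\<in>F. (\<forall>G\<in>\<F>. F - {x} \<subseteq> G \<longrightarrow> G = F) \<and> {v. h v \<noteq> 0} \<subseteq> F - {x})}"

text \<open>The step says that \<open>F\<close> meets the earlier facets in a union of ridges, each
  shared with some earlier facet; only the set of facets attached so far is recorded, not their
  order.\<close>

inductive shelling :: "'v set set \<Rightarrow> bool" where
  single: "shelling {F}"
| step: "shelling \<G> \<Longrightarrow> F \<notin> \<G> \<Longrightarrow>
    (\<And>G. G \<in> \<G> \<Longrightarrow> \<exists>x\<in>F. \<exists>K\<in>\<G>. G \<inter> F \<subseteq> F - {x} \<and> F - {x} \<subseteq> K) \<Longrightarrow> shelling (insert F \<G>)"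

text \<open>The height over the boundary is the last coordinate \<open>d\<close>, so that the
  boundary hyperplane is literally \<open>coord_space d\<close> and invariance of domain can be
  applied to it.\<close>

definition half_chart :: "'v set set \<Rightarrow> nat \<Rightarrow> (('v \<Rightarrow> real) \<Rightarrow> nat \<Rightarrow> real) \<Rightarrow> ((nat \<Rightarrow> real) \<Rightarrow> 'v \<Rightarrow> real) \<Rightarrow> bool" where
  "half_chart \<F> d \<phi> \<psi> \<longleftrightarrow>
     (\<forall>j. lattice_linear (\<lambda>h. \<phi> h j)) \<and> (\<forall>v. lattice_linear (\<lambda>x. \<psi> x v)) \<and>
     (\<forall>h\<in>cone_complex \<F>. \<phi> h \<in> coord_space (Suc d) \<and> 0 \<le> \<phi> h d \<and> \<psi> (\<phi> h) = h \<and>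
        (\<phi> h d = 0 \<longleftrightarrow> h \<in> cone_boundary \<F>)) \<and>
     (\<forall>x\<in>coord_space (Suc d). 0 \<le> x d \<longrightarrow> \<psi> x \<in> cone_complex \<F> \<and> \<phi> (\<psi> x) = x)"

definition full_chart :: "'v set set \<Rightarrow> nat \<Rightarrow> (('v \<Rightarrow> real) \<Rightarrow> nat \<Rightarrow> real) \<Rightarrow> ((nat \<Rightarrow> real) \<Rightarrow> 'v \<Rightarrow> real) \<Rightarrow> bool" where
  "full_chart \<F> n \<phi> \<psi> \<longleftrightarrow>
     (\<forall>j. lattice_linear (\<lambda>h. \<phi> h j)) \<and> (\<forall>v. lattice_linear (\<lambda>x. \<psi> x v)) \<and>
     (\<forall>h\<in>cone_complex \<F>. \<phi> h \<in> coord_space n \<and> \<psi> (\<phi> h) = h) \<and>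
     (\<forall>x\<in>coord_space n. \<psi> x \<in> cone_complex \<F> \<and> \<phi> (\<psi> x) = x)"

lemma cone_boundary_subset: "cone_boundary \<F> \<subseteq> cone_complex \<F>"
proof
  fix h assume "h \<in> cone_boundary \<F>"
  then obtain F x where "F \<in> \<F>" "{v. h v \<noteq> 0} \<subseteq> F - {x}" "\<forall>v. 0 \<le> h v"
    unfolding cone_boundary_def by auto
  then show "h \<in> cone_complex \<F>" unfolding cone_complex_def by auto
qed

text \<open>An orthant is a half-space: project along \<open>(1, \<dots>, 1)\<close> to its boundary; the height over the
  boundary is the least coordinate.\<close>

lemma half_chart_single:
  assumes F: "finite F" "card F = Suc d"
  shows "\<exists>\<phi> \<psi>. half_chart {F} d \<phi> \<psi>"
proof -
  have "F \<noteq> {}" using F by auto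
  then obtain i0 where i0: "i0 \<in> F" by blast
  have "\<exists>e. bij_betw e (F - {i0}) {..<d}"
    using F i0 by (intro finite_same_card_bij) auto
  then obtain e where e: "bij_betw e (F - {i0}) {..<d}" by blast
  define e' where "e' = inv_into (F - {i0}) e"
  have e'e: "e' (e v) = v" if "v \<in> F" "v \<noteq> i0" for v
    using that e unfolding e'_def by (simp add: bij_betw_inv_into_left)
  have ee': "e (e' k) = k" "e' k \<in> F" "e' k \<noteq> i0" if "k < d" for k
    using that e bij_betw_inv_into_right[OF e] inv_into_into[of k e "F - {i0}"]
    unfolding e'_def by (auto simp: bij_betw_def)
  have ed: "e v < d" if "v \<in> F" "v \<noteq> i0" for v using e that by (auto simp: bij_betw_def)
  define \<phi> where "\<phi> h j = (if j = d then Min (h ` F) else if j < d then h (e' j) - h i0 else 0)" for h :: "'a \<Rightarrow> real" and j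
  \<comment> \<open>Relative to \<open>h i0\<close>, the vertex \<open>i0\<close> itself has
    coordinate 0, whence the case distinction. So \<open>m\<close> recovers the excess of
    \<open>h i0\<close> over the least coordinate of \<open>h\<close>.\<close>
  define m where "m y = Max ((\<lambda>v. if v = i0 then 0 else - y (e v)) ` F)" for y :: "nat \<Rightarrow> real"
  define \<psi> where "\<psi> x v = (if v = i0 then m x + x d else if v \<in> F then x (e v) + m x + x d else 0)" for x and v
  have ne: "F \<noteq> {}" using i0 by auto
  have LLphi: "lattice_linear (\<lambda>h. \<phi> h j)" for j
    unfolding \<phi>_def
    by (intro lattice_linear_if lattice_linear_Min[OF F(1) ne, of "\<lambda>i h. h i"] lattice_linear.coord lattice_linear_diff lattice_linear_zero)
  have LLm: "lattice_linear m" unfolding m_def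
    by (intro lattice_linear_Max[OF F(1) ne] lattice_linear_if lattice_linear_uminus lattice_linear.coord lattice_linear_zero)
  have LLpsi: "lattice_linear (\<lambda>x. \<psi> x v)" for v
    unfolding \<psi>_def by (intro lattice_linear_if lattice_linear.add lattice_linear.coord LLm lattice_linear_zero)
  have mge: "0 \<le> m x" "v \<in> F \<Longrightarrow> v \<noteq> i0 \<Longrightarrow> - x (e v) \<le> m x" for x v
    using F(1) i0 unfolding m_def by (auto intro!: Max_ge image_eqI[of _ _ i0] image_eqI[of _ _ v])
  have mex: "m x = 0 \<or> (\<exists>v\<in>F. v \<noteq> i0 \<and> m x = - x (e v))" for x
  proof -
    have "m x \<in> (\<lambda>v. if v = i0 then 0 else - x (e v)) ` F" unfolding m_def using F(1) ne by (intro Max_in) auto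
    then show ?thesis by (auto split: if_splits)
  qed
  have Cc: "cone_complex {F} = {h. (\<forall>v. 0 \<le> h v) \<and> (\<forall>v. v \<notin> F \<longrightarrow> h v = 0)}"
    unfolding cone_complex_def by auto
  have bd: "h \<in> cone_boundary {F} \<longleftrightarrow> (\<exists>v\<in>F. h v = 0)" if "h \<in> cone_complex {F}" for h
    using that unfolding cone_boundary_def Cc by auto
  have psige: "x d \<le> \<psi> x v" if "v \<in> F" for x v
    using that mge(1)[of x] mge(2)[of v x] by (cases "v = i0") (simp_all add: \<psi>_def)
  have minpsi: "Min (\<psi> x ` F) = x d" for x
  proof (rule Min_eqI)
    show "x d \<le> y" if "y \<in> \<psi> x ` F" for y
      using that psige by blast
    have "\<exists>v\<in>F. \<psi> x v = x d"
      using mex[of x]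
    proof
      assume "m x = 0"
      then show ?thesis using i0 by (intro bexI[of _ i0]) (simp_all add: \<psi>_def)
    next
      assume "\<exists>v\<in>F. v \<noteq> i0 \<and> m x = - x (e v)"
      then obtain v where "v \<in> F" "v \<noteq> i0" "m x = - x (e v)" by blast
      then show ?thesis by (intro bexI[of _ v]) (simp_all add: \<psi>_def)
    qed
    then show "x d \<in> \<psi> x ` F" by force
  qed (use F in simp)
  have "half_chart {F} d \<phi> \<psi>"
    unfolding half_chart_def
  proof (intro conjI allI ballI impI LLphi LLpsi)
    fix h assume h: "h \<in> cone_complex {F}"
    then have h0: "\<And>v. 0 \<le> h v" "\<And>v. v \<notin> F \<Longrightarrow> h v = 0" unfolding Cc by auto
    let ?t = "Min (h ` F)"
    have t: "?t \<le> h v" if "v \<in> F" for v using that F(1) by simp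
    have "?t \<in> h ` F" using F(1) ne by (intro Min_in) auto
    then obtain w where w: "w \<in> F" "?t = h w" by blast
    show "\<phi> h \<in> coord_space (Suc d)" by (auto simp: \<phi>_def)
    show "0 \<le> \<phi> h d" using w h0 by (simp add: \<phi>_def)
    show "\<phi> h d = 0 \<longleftrightarrow> h \<in> cone_boundary {F}"
      unfolding bd[OF h] using w t h0(1) by (auto simp: \<phi>_def) (metis order_antisym)
    have m: "m (\<phi> h) = h i0 - ?t" unfolding m_def
    proof (rule Max_eqI)
      have eq: "(if v = i0 then 0 else - \<phi> h (e v)) = h i0 - h v" if "v \<in> F" for v
        using that ed[of v] e'e[of v] by (auto simp: \<phi>_def)
      show "y \<le> h i0 - ?t" if "y \<in> (\<lambda>v. if v = i0 then 0 else - \<phi> h (e v)) ` F" for y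
      proof -
        obtain v where v: "v \<in> F" "y = (if v = i0 then 0 else - \<phi> h (e v))" using \<open>y \<in> _\<close> by blast
        then show ?thesis using eq[OF v(1)] t[OF v(1)] by simp
      qed
      show "h i0 - ?t \<in> (\<lambda>v. if v = i0 then 0 else - \<phi> h (e v)) ` F"
        using w by (intro image_eqI[where x = w]) (simp_all only: eq)
    qed (use F in simp)
    show "\<psi> (\<phi> h) = h"
    proof
      fix v show "\<psi> (\<phi> h) v = h v"
        using ed[of v] e'e[of v] h0(2)[of v] unfolding \<psi>_def m by (auto simp: \<phi>_def)
    qed
  next
    fix x assume x: "x \<in> coord_space (Suc d)" "0 \<le> x d"
    have "0 \<le> \<psi> x v" for v
    proof (cases "v \<in> F")
      case True
      then show ?thesis using psige[OF True, of x] x(2) by linarith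
    qed (use i0 in \<open>auto simp: \<psi>_def\<close>)
    moreover have "\<psi> x v = 0" if "v \<notin> F" for v using that i0 by (auto simp: \<psi>_def)
    ultimately show "\<psi> x \<in> cone_complex {F}" unfolding Cc by simp
    show "\<phi> (\<psi> x) = x"
    proof
      fix j show "\<phi> (\<psi> x) j = x j"
        unfolding \<phi>_def minpsi using x(1) ee'[of j] i0 by (auto simp: \<psi>_def)
    qed
  qed
  then show ?thesis by blast
qed

section \<open>Attaching a facet along part of the boundary\<close>

locale attach_facet =
  fixes \<G> :: "'v set set" and F :: "'v set" and d :: nat
    and \<phi> :: "('v \<Rightarrow> real) \<Rightarrow> nat \<Rightarrow> real" and \<psi> :: "(nat \<Rightarrow> real) \<Rightarrow> 'v \<Rightarrow> real"
  assumes chart: "half_chart \<G> d \<phi> \<psi>"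
    and F: "finite F" "card F = Suc d" "F \<notin> \<G>"
    and G: "finite \<G>" "\<G> \<noteq> {}" "\<And>G. G \<in> \<G> \<Longrightarrow> finite G" "\<And>G. G \<in> \<G> \<Longrightarrow> card G = Suc d"
    and shell: "\<And>G. G \<in> \<G> \<Longrightarrow> \<exists>x\<in>F. \<exists>K\<in>\<G>. G \<inter> F \<subseteq> F - {x} \<and> F - {x} \<subseteq> K"
    and thin: "\<And>x. x \<in> F \<Longrightarrow> card {K\<in>insert F \<G>. F - {x} \<subseteq> K} \<le> 2"
begin

lemma chart_facts:
  shows LLphi: "\<And>j. lattice_linear (\<lambda>h. \<phi> h j)" and LLpsi: "\<And>v. lattice_linear (\<lambda>x. \<psi> x v)"
    and phi: "\<And>h. h \<in> cone_complex \<G> \<Longrightarrow> \<phi> h \<in> coord_space (Suc d)"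
    and phi_d: "\<And>h. h \<in> cone_complex \<G> \<Longrightarrow> 0 \<le> \<phi> h d"
    and psi_phi: "\<And>h. h \<in> cone_complex \<G> \<Longrightarrow> \<psi> (\<phi> h) = h"
    and phi_bd: "\<And>h. h \<in> cone_complex \<G> \<Longrightarrow> \<phi> h d = 0 \<longleftrightarrow> h \<in> cone_boundary \<G>"
    and psi: "\<And>x. x \<in> coord_space (Suc d) \<Longrightarrow> 0 \<le> x d \<Longrightarrow> \<psi> x \<in> cone_complex \<G>"
    and phi_psi: "\<And>x. x \<in> coord_space (Suc d) \<Longrightarrow> 0 \<le> x d \<Longrightarrow> \<phi> (\<psi> x) = x"
  using chart unfolding half_chart_def by blast+

text \<open>\<open>R\<close> is the set of vertices opposite to the ridges that \<open>F\<close> shares with earlier facets. A point of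
  the new orthant is \<open>a + t *\<^sub>R push\<close> with \<open>a\<close> in the shared part of its boundary and \<open>0 \<le> t \<le> depth a\<close>
  (no upper bound if \<open>R = F\<close>), so the new chart is the old one followed by the shear by \<open>depth\<close>.\<close>

definition R where "R = {x\<in>F. \<exists>G\<in>\<G>. F - {x} \<subseteq> G}"

lemma R_F: "R \<subseteq> F" "finite R" "finite (F - R)" using F(1) by (auto simp: R_def)

text \<open>No earlier facet contains \<open>R\<close>. Consequently every point of the old cone
  vanishes somewhere on \<open>R\<close>, so that \<open>height\<close> is 0 there.\<close>

lemma R_missed: assumes "G \<in> \<G>" obtains x where "x \<in> R" "x \<notin> G"
  using shell[OF assms] that unfolding R_def by blast

lemma R_nonempty: "R \<noteq> {}"
  using G(2) R_missed by blast

text \<open>\<open>F\<close> takes one of the at most two places at the ridge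
  \<open>F - {x}\<close>, so before \<open>F\<close> is attached this ridge is free:
  \<open>G\<close> is the only facet there, with opposite vertex \<open>y\<close>.\<close>

lemma R_partner:
  assumes x: "x \<in> R"
  obtains G y where "G \<in> \<G>" "y \<in> G" "y \<notin> F" "G - {y} = F - {x}" "\<And>K. K \<in> \<G> \<Longrightarrow> F - {x} \<subseteq> K \<Longrightarrow> K = G"
proof -
  obtain G' where G': "G' \<in> \<G>" "F - {x} \<subseteq> G'" "x \<in> F" using x by (auto simp: R_def)
  have un: "K = G'" if K: "K \<in> \<G>" "F - {x} \<subseteq> K" for K
  proof (rule ccontr)
    assume "K \<noteq> G'"
    moreover have "F \<noteq> G'" "F \<noteq> K" using K G' F(3) by auto
    ultimately have "card {F, G', K} = 3" by simp
    moreover have "{F, G', K} \<subseteq> {K\<in>insert F \<G>. F - {x} \<subseteq> K}" using K G' by auto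
    ultimately show False using thin[OF G'(3)] card_mono[of "{K\<in>insert F \<G>. F - {x} \<subseteq> K}" "{F, G', K}"] G(1) by auto
  qed
  have "card (F - {x}) = d" using F G' by simp
  then have "card (G' - (F - {x})) = 1" using G(3,4)[OF G'(1)] G'(2) card_Diff_subset[of "F - {x}" G'] F(1) by simp
  then obtain y where y: "G' - (F - {x}) = {y}" by (auto simp: card_1_singleton_iff)
  have "G' \<noteq> F" using G'(1) F(3) by auto
  have "y \<notin> F"
  proof
    assume "y \<in> F"
    then have "y = x" using y by auto
    then have "F \<subseteq> G'" using G'(2) y by auto
    then have "F = G'" using card_subset_eq[OF G(3)[OF G'(1)]] F(2) G(4)[OF G'(1)] by auto
    with \<open>G' \<noteq> F\<close> show False by simp
  qed
  then show ?thesis using that[of G' y] un G' y by blast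
qed

lemma partial_boundary:
  assumes "\<And>v. 0 \<le> a v" "{v. a v \<noteq> 0} \<subseteq> F" "x \<in> R" "a x = 0"
  shows "a \<in> cone_boundary \<G>"
proof -
  obtain G y where *: "G \<in> \<G>" "y \<in> G" "y \<notin> F" "G - {y} = F - {x}" "\<And>K. K \<in> \<G> \<Longrightarrow> F - {x} \<subseteq> K \<Longrightarrow> K = G"
    using R_partner[OF assms(3)] by metis
  have "{v. a v \<noteq> 0} \<subseteq> G - {y}" unfolding *(4) using assms(2,4) by auto
  moreover have "\<forall>K\<in>\<G>. G - {y} \<subseteq> K \<longrightarrow> K = G" unfolding *(4) using *(5) by blast
  ultimately show ?thesis unfolding cone_boundary_def using assms(1) *(1,2) by blast
qed

lemma cone_boundary_zero:
  assumes "h \<in> cone_complex \<G>" obtains x where "x \<in> R" "h x = 0"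
  using assms R_missed unfolding cone_complex_def by blast

text \<open>Invariance of domain: the open star of \<open>F - R\<close> in the boundary lies in \<open>F\<close>, because
  the part of the boundary of the orthant over \<open>F\<close> near \<open>F - R\<close> is embedded as an open subset.\<close>

lemma boundary_star:
  assumes b: "b \<in> cone_boundary \<G>" and pos: "\<And>j. j \<in> F - R \<Longrightarrow> 0 < b j"
  shows "{v. b v \<noteq> 0} \<subseteq> F"
proof -
  obtain i0 where i0: "i0 \<in> R" using R_nonempty by blast
  then have i0F: "i0 \<in> F" using R_F by blast
  have "\<exists>e. bij_betw e (F - {i0}) {..<d}"
    using F i0F by (intro finite_same_card_bij) auto
  then obtain e where e: "bij_betw e (F - {i0}) {..<d}" by blast
  have ed: "e v < d" if "v \<in> F" "v \<noteq> i0" for v using e that by (auto simp: bij_betw_def)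
  have einj: "v = w" if "e v = e w" "v \<in> F" "v \<noteq> i0" "w \<in> F" "w \<noteq> i0" for v w
    using e that by (auto simp: bij_betw_def inj_on_def)
  have esurj: "\<exists>v. v \<in> F \<and> v \<noteq> i0 \<and> e v = k" if "k < d" for k
  proof -
    have "k \<in> e ` (F - {i0})" using e that by (simp add: bij_betw_def)
    then show ?thesis by auto
  qed
  \<comment> \<open>The analogue of the orthant chart, with projection along the direction that is 1
    on \<open>R\<close> and -1 on \<open>F - R\<close>: with \<open>i0\<close> normalised to 0,
    \<open>m y\<close> is the least shift that makes the coordinates on \<open>R\<close>
    nonnegative, one of them becoming 0. \<open>W\<close> asks that those on \<open>F - R\<close>
    remain positive under this shift.\<close>
  define m where "m y = Max ((\<lambda>v. if v = i0 then 0 else - y (e v)) ` R)" for y :: "nat \<Rightarrow> real"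
  define \<alpha> where "\<alpha> y v = (if v = i0 then m y else if v \<in> R then y (e v) + m y else if v \<in> F then y (e v) - m y else 0)" for y v
  define W where "W = {y \<in> coord_space d. \<forall>j\<in>F - R. m y < y (e j)}"
  have LLm: "lattice_linear m" unfolding m_def
    by (intro lattice_linear_Max[OF R_F(2) R_nonempty] lattice_linear_if lattice_linear_uminus lattice_linear.coord lattice_linear_zero)
  have LLa: "lattice_linear (\<lambda>y. \<alpha> y v)" for v
    unfolding \<alpha>_def by (intro lattice_linear_if lattice_linear.add lattice_linear_diff lattice_linear.coord LLm lattice_linear_zero)
  have mge: "0 \<le> m y" "v \<in> R \<Longrightarrow> v \<noteq> i0 \<Longrightarrow> - y (e v) \<le> m y" for y v
    using R_F(2) i0 unfolding m_def by (auto intro!: Max_ge image_eqI[of _ _ i0] image_eqI[of _ _ v])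
  have mex: "m y = 0 \<or> (\<exists>v\<in>R. v \<noteq> i0 \<and> m y = - y (e v))" for y
  proof -
    have "m y \<in> (\<lambda>v. if v = i0 then 0 else - y (e v)) ` R" unfolding m_def using R_F R_nonempty by (intro Max_in) auto
    then show ?thesis by (auto split: if_splits)
  qed
  have asupp: "{v. \<alpha> y v \<noteq> 0} \<subseteq> F" for y using R_F i0F by (auto simp: \<alpha>_def)
  have abd: "\<alpha> y \<in> cone_boundary \<G>" if y: "y \<in> W" for y
  proof -
    obtain x where "x \<in> R" "\<alpha> y x = 0" using mex[of y] i0 by (auto simp: \<alpha>_def)
    moreover have "0 \<le> \<alpha> y v" for v
      using y mge[where y=y] unfolding \<alpha>_def W_def by (smt (verit) DiffI mem_Collect_eq)
    ultimately show ?thesis using partial_boundary asupp by blast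
  qed
  have acone: "\<alpha> y \<in> cone_complex \<G>" if "y \<in> W" for y using abd[OF that] cone_boundary_subset by blast
  have ainj: "inj_on \<alpha> W"
  proof (rule inj_onI)
    fix y z assume h: "y \<in> W" "z \<in> W" "\<alpha> y = \<alpha> z"
    have mm: "m y = m z" using fun_cong[OF h(3), of i0] by (simp add: \<alpha>_def)
    show "y = z"
    proof
      fix k show "y k = z k"
      proof (cases "k < d")
        case True
        then obtain v where v: "v \<in> F" "v \<noteq> i0" "e v = k" using esurj by blast
        then show ?thesis using fun_cong[OF h(3), of v] mm by (auto simp: \<alpha>_def split: if_splits)
      next
        case False
        then show ?thesis using h by (simp add: W_def)
      qed
    qed
  qed
  have "inj_on (\<lambda>y. \<phi> (\<alpha> y)) W"
    by (rule inj_onI) (metis acone psi_phi ainj inj_onD)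
  moreover have "openin (Euclidean_space d) W"
  proof -
    have "open {y. m y < y (e j)}" for j
      by (intro open_Collect_less lattice_linear_continuous LLm lattice_linear.coord)
    then have "open (\<Inter>j\<in>F - R. {y. m y < y (e j)})" using R_F(3) by blast
    moreover have "W = coord_space d \<inter> (\<Inter>j\<in>F - R. {y. m y < y (e j)})" unfolding W_def by auto
    ultimately show ?thesis unfolding Euclidean_space_eq by (simp add: openin_open_Int)
  qed
  moreover have "continuous_map (subtopology (Euclidean_space d) W) (Euclidean_space d) (\<lambda>y. \<phi> (\<alpha> y))"
  proof -
    have c: "continuous_on W (\<lambda>y. \<phi> (\<alpha> y))"
      by (rule lattice_linear_continuous_map) (rule lattice_linear_comp[OF LLphi LLa])
    have "\<phi> (\<alpha> y) \<in> coord_space d" if "y \<in> W" for y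
      using phi[OF acone[OF that]] phi_bd[OF acone[OF that]] abd[OF that]
      by (auto simp: less_Suc_eq_le) (metis le_less Suc_leI)
    then show ?thesis using c unfolding Euclidean_space_eq subtopology_subtopology continuous_map_in_subtopology
      by (auto intro: continuous_on_subset simp: image_subset_iff_funcset[symmetric] image_subset_iff)
  qed
  ultimately have "openin (Euclidean_space d) ((\<lambda>y. \<phi> (\<alpha> y)) ` W)"
    by (intro invariance_of_domain_Euclidean_space)
  then obtain T where T: "open T" "(\<lambda>y. \<phi> (\<alpha> y)) ` W = coord_space d \<inter> T"
    unfolding Euclidean_space_eq by (auto simp: openin_open)
  \<comment> \<open>The indicator \<open>s\<close> of \<open>F - R\<close> lies in the open image,
    and the segment from \<open>s\<close> to \<open>b\<close> stays over one free ridge because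
    \<open>b\<close> is positive on \<open>F - R\<close>. A point of it close to \<open>s\<close>
    lies in the cone over \<open>F\<close>, but outside \<open>F\<close> it is nonzero wherever
    \<open>b\<close> is; so \<open>b\<close> vanishes there.\<close>
  define s where "s v = (if v \<in> F - R then 1 else 0 :: real)" for v
  define y0 where "y0 k = (if \<exists>j\<in>F - R. e j = k then 1 else 0 :: real)" for k
  have y0e: "y0 (e v) = s v" if "v \<in> F" "v \<noteq> i0" for v
    using that einj i0 by (auto simp: y0_def s_def)
  have my0: "m y0 = 0"
    using mex[of y0] y0e R_F by (auto simp: s_def)
  have ay0: "\<alpha> y0 = s"
  proof
    fix v show "\<alpha> y0 v = s v" using y0e[of v] my0 i0 i0F R_F by (auto simp: \<alpha>_def s_def)
  qed
  have "y0 k = 0" if "d \<le> k" for k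
    using ed i0 that unfolding y0_def by (metis Diff_iff not_le)
  moreover have "m y0 < y0 (e j)" if "j \<in> F - R" for j
  proof -
    have "j \<in> F" "j \<noteq> i0" using that i0 by auto
    then show ?thesis using y0e[of j] that unfolding my0 by (simp add: s_def)
  qed
  ultimately have y0W: "y0 \<in> W" unfolding W_def by auto
  define \<gamma> where "\<gamma> t v = (1 - t) * s v + t * b v" for t v
  obtain F' x' where F': "F' \<in> \<G>" "x' \<in> F'" "\<forall>G\<in>\<G>. F' - {x'} \<subseteq> G \<longrightarrow> G = F'" "{v. b v \<noteq> 0} \<subseteq> F' - {x'}"
    and b0: "\<And>v. 0 \<le> b v"
    using b unfolding cone_boundary_def by blast
  have gbd: "\<gamma> t \<in> cone_boundary \<G>" if "0 \<le> t" "t \<le> 1" for t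
  proof -
    have "b v \<noteq> 0" if "s v \<noteq> 0" for v using pos[of v] that by (auto simp: s_def split: if_splits)
    then have "b v \<noteq> 0" if "\<gamma> t v \<noteq> 0" for v using that by (cases "s v = 0") (auto simp: \<gamma>_def)
    then have "{v. \<gamma> t v \<noteq> 0} \<subseteq> F' - {x'}" using F'(4) by blast
    moreover have "0 \<le> \<gamma> t v" for v using that b0 by (simp add: \<gamma>_def s_def)
    ultimately show ?thesis unfolding cone_boundary_def using F' by blast
  qed
  have cg: "continuous_on UNIV (\<lambda>t. \<phi> (\<gamma> t))"
  proof (rule continuous_on_compose2[of UNIV \<phi>])
    show "continuous_on UNIV \<phi>" by (rule lattice_linear_continuous_map) (rule LLphi)
    show "continuous_on UNIV \<gamma>"
      unfolding \<gamma>_def by (intro continuous_on_coordinatewise_then_product continuous_intros)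
  qed auto
  have "open ((\<lambda>t. \<phi> (\<gamma> t)) -` T)" using open_vimage[OF T(1) cg] .
  moreover have "0 \<in> (\<lambda>t. \<phi> (\<gamma> t)) -` T"
  proof -
    have "\<gamma> 0 = \<alpha> y0" unfolding ay0 by (auto simp: \<gamma>_def)
    then show ?thesis using y0W T(2) by auto
  qed
  ultimately have "\<exists>r>0. \<forall>y. dist y 0 < r \<longrightarrow> y \<in> (\<lambda>t. \<phi> (\<gamma> t)) -` T"
    unfolding open_dist by (rule bspec)
  then obtain r where r: "r > 0" "\<And>t. \<bar>t\<bar> < r \<Longrightarrow> \<phi> (\<gamma> t) \<in> T"
    by (auto simp: dist_real_def)
  define t where "t = min (r/2) 1"
  have t: "0 < t" "t \<le> 1" "\<bar>t\<bar> < r" using r(1) by (auto simp: t_def)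
  have gc: "\<gamma> t \<in> cone_complex \<G>" using gbd[of t] t cone_boundary_subset by fastforce
  have "\<phi> (\<gamma> t) \<in> coord_space d"
    using phi[OF gc] phi_bd[OF gc] gbd[of t] t by (auto simp: less_Suc_eq_le) (metis le_less Suc_leI)
  then have "\<phi> (\<gamma> t) \<in> (\<lambda>y. \<phi> (\<alpha> y)) ` W" using T(2) r(2)[OF t(3)] by blast
  then obtain y where "y \<in> W" "\<phi> (\<gamma> t) = \<phi> (\<alpha> y)" by blast
  then have "\<gamma> t = \<alpha> y" using psi_phi gc acone by metis
  then have "{v. \<gamma> t v \<noteq> 0} \<subseteq> F" using asupp by simp
  then have gF: "{v. \<gamma> t v \<noteq> 0} \<subseteq> F" .
  have "v \<in> F" if "b v \<noteq> 0" for v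
  proof (rule ccontr)
    assume v: "v \<notin> F"
    then have "\<gamma> t v \<noteq> 0" using that t(1) by (simp add: \<gamma>_def s_def)
    then show False using gF v by blast
  qed
  then show ?thesis by blast
qed

text \<open>The parameter \<open>t\<close> of a new point \<open>a + t *\<^sub>R push\<close>,
  because \<open>a\<close> has least coordinate 0 on \<open>R\<close>; \<open>retract\<close> then
  gives \<open>a\<close>. On the old cone it is 0, so one formula serves both parts.\<close>

definition height :: "('v \<Rightarrow> real) \<Rightarrow> real" where
  "height h = Min ((\<lambda>v. h v) ` R)"

text \<open>For \<open>R = F\<close> nothing bounds \<open>t\<close> from above; the value 0 makes
  the shear trivial, and the new orthant fills the lower half-space.\<close>

definition depth :: "('v \<Rightarrow> real) \<Rightarrow> real" where
  "depth h = (if R = F then 0 else Min ((\<lambda>v. h v) ` (F - R)))"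

definition push :: "'v \<Rightarrow> real" where
  "push v = (if v \<in> R then 1 else if v \<in> F then - 1 else 0)"

definition retract :: "('v \<Rightarrow> real) \<Rightarrow> 'v \<Rightarrow> real" where
  "retract h v = h v - height h * push v"

definition floor_point :: "(nat \<Rightarrow> real) \<Rightarrow> nat \<Rightarrow> real" where
  "floor_point x j = (if j = d then 0 else x j)"

text \<open>On the old cone the last coordinate is raised by the depth over the floor. A new point
  retracts to the floor, and its last coordinate is the depth there minus \<open>t\<close>; for
  \<open>R \<noteq> F\<close> it thus lies between 0 and the graph.\<close>

definition \<phi>' :: "('v \<Rightarrow> real) \<Rightarrow> nat \<Rightarrow> real" where
  "\<phi>' h j = (if j = d then \<phi> (retract h) d + depth (\<psi> (floor_point (\<phi> (retract h)))) - height h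
     else \<phi> (retract h) j)"

definition drop_height :: "(nat \<Rightarrow> real) \<Rightarrow> real" where
  "drop_height x = x d - depth (\<psi> (floor_point x))"

definition clip :: "(nat \<Rightarrow> real) \<Rightarrow> nat \<Rightarrow> real" where
  "clip x j = (if j = d then max (drop_height x) 0 else x j)"

text \<open>Undoing the shear leaves the signed height \<open>drop_height\<close> over the old
  floor. Its positive part is fed to the old chart and its negative part to \<open>push\<close>, so
  the two cases combine in a lattice-linear formula.\<close>

definition \<psi>' :: "(nat \<Rightarrow> real) \<Rightarrow> 'v \<Rightarrow> real" where
  "\<psi>' x v = \<psi> (clip x) v + push v * max (- drop_height x) 0"

lemma LL_height: "lattice_linear height"
  unfolding height_def by (intro lattice_linear_Min R_F(2) R_nonempty lattice_linear.coord)

lemma LL_depth: "lattice_linear depth"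
proof (cases "R = F")
  case True
  then show ?thesis by (simp add: depth_def[abs_def] lattice_linear_zero)
next
  case False
  then have "F - R \<noteq> {}" using R_F(1) by blast
  then have "lattice_linear (\<lambda>h. Min ((\<lambda>v. h v) ` (F - R)))"
    by (intro lattice_linear_Min R_F(3) lattice_linear.coord)
  then show ?thesis using False by (simp only: depth_def[abs_def] if_False)
qed

lemma LL_retract: "lattice_linear (\<lambda>h. retract h v)"
  using lattice_linear_diff[OF lattice_linear.coord lattice_linear.scale[OF LL_height], of v "push v"]
  by (simp add: retract_def mult.commute)

lemma LL_floor: "lattice_linear (\<lambda>x. floor_point x j)"
  unfolding floor_point_def by (intro lattice_linear_if lattice_linear_zero lattice_linear.coord)

lemma LL_phi_retract: "lattice_linear (\<lambda>h. \<phi> (retract h) j)"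
  by (rule lattice_linear_comp[OF LLphi LL_retract])

lemma LL_psi_floor: "lattice_linear (\<lambda>x. \<psi> (floor_point x) v)"
  by (rule lattice_linear_comp[OF LLpsi LL_floor])

lemma LL_depth_floor: "lattice_linear (\<lambda>x. depth (\<psi> (floor_point x)))"
  by (rule lattice_linear_comp[OF LL_depth LL_psi_floor])

lemma LL_phi': "lattice_linear (\<lambda>h. \<phi>' h j)"
  unfolding \<phi>'_def
  by (intro lattice_linear_if lattice_linear_diff lattice_linear.add LL_phi_retract LL_height
      lattice_linear_comp[OF LL_depth_floor LL_phi_retract])

lemma LL_drop: "lattice_linear drop_height"
  unfolding drop_height_def[abs_def] by (intro lattice_linear_diff lattice_linear.coord LL_depth_floor)

lemma LL_clip: "lattice_linear (\<lambda>x. clip x j)"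
  unfolding clip_def by (intro lattice_linear_if lattice_linear.max LL_drop lattice_linear_zero lattice_linear.coord)

lemma LL_psi': "lattice_linear (\<lambda>x. \<psi>' x v)"
  unfolding \<psi>'_def
  by (intro lattice_linear.add lattice_linear.scale lattice_linear.max lattice_linear_uminus LL_drop lattice_linear_zero
      lattice_linear_comp[OF LLpsi LL_clip])

lemma height_le: "v \<in> R \<Longrightarrow> height h \<le> h v"
  unfolding height_def using R_F(2) by simp

lemma height_attained: obtains v where "v \<in> R" "height h = h v"
proof -
  have "height h \<in> (\<lambda>v. h v) ` R" unfolding height_def using R_F(2) R_nonempty by (intro Min_in) auto
  then show ?thesis using that by blast
qed

lemma depth_le: "v \<in> F - R \<Longrightarrow> depth h \<le> h v"
  unfolding depth_def using R_F(3) by auto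

lemma depth_attained: assumes "R \<noteq> F" obtains v where "v \<in> F - R" "depth h = h v"
proof -
  have "F - R \<noteq> {}" using R_F(1) assms by blast
  then have "depth h \<in> (\<lambda>v. h v) ` (F - R)" unfolding depth_def using R_F(3) assms by (simp del: image_ident)
  then show ?thesis using that by blast
qed

lemma depth_nonneg: "(\<And>v. 0 \<le> h v) \<Longrightarrow> 0 \<le> depth h"
proof (cases "R = F")
  case False
  assume h: "\<And>v. 0 \<le> h v"
  obtain v where "depth h = h v" using depth_attained[OF False] by blast
  then show ?thesis using h by simp
qed (simp add: depth_def)

lemma coneD: "h \<in> cone_complex \<F> \<Longrightarrow> 0 \<le> h v"
  by (simp add: cone_complex_def)

lemma height_old: assumes "h \<in> cone_complex \<G>" shows "height h = 0"
proof -
  obtain x where x: "x \<in> R" "h x = 0" using cone_boundary_zero[OF assms] .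
  then have "height h \<le> 0" using height_le by metis
  moreover obtain v where "v \<in> R" "height h = h v" by (rule height_attained)
  ultimately show ?thesis using coneD[OF assms, of v] by simp
qed

lemma retract_old: "h \<in> cone_complex \<G> \<Longrightarrow> retract h = h"
  by (simp add: retract_def[abs_def] height_old)

lemma floor_point_floor: "x d = 0 \<Longrightarrow> floor_point x = x"
  by (auto simp: floor_point_def)

lemma floor_in: "x \<in> coord_space (Suc d) \<Longrightarrow> floor_point x \<in> coord_space (Suc d) \<and> floor_point x d = 0"
  by (auto simp: floor_point_def)

lemma floor_bd:
  assumes "x \<in> coord_space (Suc d)"
  shows "\<psi> (floor_point x) \<in> cone_complex \<G>" "\<psi> (floor_point x) \<in> cone_boundary \<G>" "\<phi> (\<psi> (floor_point x)) = floor_point x"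
proof -
  have f: "floor_point x \<in> coord_space (Suc d)" "floor_point x d = 0" using floor_in[OF assms] by auto
  show 1: "\<psi> (floor_point x) \<in> cone_complex \<G>" and 2: "\<phi> (\<psi> (floor_point x)) = floor_point x"
    using psi[OF f(1)] phi_psi[OF f(1)] f(2) by auto
  show "\<psi> (floor_point x) \<in> cone_boundary \<G>" using phi_bd[OF 1] f(2) by (simp add: 2)
qed

lemma new_cone:
  assumes "\<And>v. 0 \<le> h v" "{v. h v \<noteq> 0} \<subseteq> F"
  shows "retract h \<in> cone_boundary \<G>" "depth (retract h) = (if R = F then 0 else depth h + height h)" "0 \<le> height h"
proof -
  obtain w where w: "w \<in> R" "height h = h w" by (rule height_attained)
  show h0: "0 \<le> height h" using w assms by simp
  show "retract h \<in> cone_boundary \<G>"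
  proof (rule partial_boundary[OF _ _ w(1)])
    show "0 \<le> retract h v" for v
      using height_le[of v h] h0 assms(1)[of v] by (auto simp: retract_def push_def)
    show "{v. retract h v \<noteq> 0} \<subseteq> F"
      using assms(2) R_F(1) by (auto simp: retract_def push_def split: if_splits)
    show "retract h w = 0" using w by (simp add: retract_def push_def)
  qed
  show "depth (retract h) = (if R = F then 0 else depth h + height h)"
  proof (cases "R = F")
    case False
    obtain v where v: "v \<in> F - R" "depth h = h v" using depth_attained[OF False] by metis
    obtain u where u: "u \<in> F - R" "depth (retract h) = retract h u" using depth_attained[OF False] by metis
    have r: "retract h z = h z + height h" if "z \<in> F - R" for z using that by (auto simp: retract_def push_def)
    have "depth (retract h) \<le> retract h v" using v depth_le by blast
    moreover have "depth h \<le> h u" using u depth_le by blast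
    ultimately show ?thesis using False v u r by auto
  qed (simp add: depth_def)
qed

lemma phi'_old:
  assumes h: "h \<in> cone_complex \<G>"
  shows "\<phi>' h = (\<lambda>j. if j = d then \<phi> h d + depth (\<psi> (floor_point (\<phi> h))) else \<phi> h j)"
  by (auto simp: \<phi>'_def retract_old[OF h] height_old[OF h])

lemma phi'_new:
  assumes h: "\<And>v. 0 \<le> h v" "{v. h v \<noteq> 0} \<subseteq> F"
  shows "\<phi>' h = (\<lambda>j. if j = d then (if R = F then - height h else depth h) else \<phi> (retract h) j)"
    "\<phi> (retract h) \<in> coord_space (Suc d)" "\<phi> (retract h) d = 0" "\<psi> (\<phi> (retract h)) = retract h"
proof -
  have c: "retract h \<in> cone_complex \<G>" using new_cone(1)[OF h] cone_boundary_subset by blast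
  show 1: "\<phi> (retract h) \<in> coord_space (Suc d)" "\<phi> (retract h) d = 0" and 2: "\<psi> (\<phi> (retract h)) = retract h"
    using phi[OF c] phi_bd[OF c] new_cone(1)[OF h] psi_phi[OF c] by auto
  show "\<phi>' h = (\<lambda>j. if j = d then (if R = F then - height h else depth h) else \<phi> (retract h) j)"
    using new_cone(2)[OF h]
    by (intro ext, cases "R = F") (simp_all add: \<phi>'_def floor_point_floor[of "\<phi> (retract h)", OF 1(2)] 1(2) 2)
qed

lemma cone_insert_cases:
  assumes "h \<in> cone_complex (insert F \<G>)"
  obtains (old) "h \<in> cone_complex \<G>" | (new) "\<And>v. 0 \<le> h v" "{v. h v \<noteq> 0} \<subseteq> F"
  using assms unfolding cone_complex_def by blast

lemma phi'_in:
  assumes "h \<in> cone_complex (insert F \<G>)"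
  shows "\<phi>' h \<in> coord_space (Suc d)" "R \<noteq> F \<Longrightarrow> 0 \<le> \<phi>' h d"
proof -
  have "\<phi>' h \<in> coord_space (Suc d) \<and> (R \<noteq> F \<longrightarrow> 0 \<le> \<phi>' h d)"
    using assms
  proof (cases rule: cone_insert_cases)
    case old
    have "0 \<le> depth (\<psi> (floor_point (\<phi> h)))"
      by (rule depth_nonneg) (rule coneD[OF floor_bd(1)[OF phi[OF old]]])
    then show ?thesis using phi[OF old] phi_d[OF old] by (auto simp: phi'_old[OF old])
  next
    case new
    then show ?thesis using phi'_new[OF new] depth_nonneg[OF new(1)] by auto
  qed
  then show "\<phi>' h \<in> coord_space (Suc d)" "R \<noteq> F \<Longrightarrow> 0 \<le> \<phi>' h d" by auto
qed

lemma psi'_phi':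
  assumes "h \<in> cone_complex (insert F \<G>)"
  shows "\<psi>' (\<phi>' h) = h"
  using assms
proof (cases rule: cone_insert_cases)
  case old
  have f: "floor_point (\<phi>' h) = floor_point (\<phi> h)" by (auto simp: floor_point_def phi'_old[OF old])
  have s: "drop_height (\<phi>' h) = \<phi> h d" unfolding drop_height_def f by (simp add: phi'_old[OF old])
  have "clip (\<phi>' h) j = \<phi> h j" for j
    unfolding clip_def s using phi_d[OF old] by (simp add: phi'_old[OF old])
  then have "clip (\<phi>' h) = \<phi> h" by blast
  then show ?thesis using phi_d[OF old] psi_phi[OF old] by (auto simp: \<psi>'_def[abs_def] s)
next
  case new
  note n = phi'_new[OF new]
  have f: "floor_point (\<phi>' h) = \<phi> (retract h)" using n(3) by (auto simp: floor_point_def n(1))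
  have s: "drop_height (\<phi>' h) = - height h" unfolding drop_height_def f n(4) new_cone(2)[OF new] by (simp add: n(1))
  have "clip (\<phi>' h) j = \<phi> (retract h) j" for j
    unfolding clip_def s using n(3) new_cone(3)[OF new] by (simp add: n(1))
  then have "clip (\<phi>' h) = \<phi> (retract h)" by blast
  then show ?thesis
    using n(4) new_cone(3)[OF new] by (auto simp: \<psi>'_def[abs_def] s retract_def)
qed

lemma psi'_in:
  assumes x: "x \<in> coord_space (Suc d)" "R \<noteq> F \<Longrightarrow> 0 \<le> x d"
  shows "\<psi>' x \<in> cone_complex (insert F \<G>)" "\<phi>' (\<psi>' x) = x"
proof -
  let ?b = "\<psi> (floor_point x)" and ?s = "drop_height x"
  have "\<psi>' x \<in> cone_complex (insert F \<G>) \<and> \<phi>' (\<psi>' x) = x"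
  proof (cases "0 \<le> ?s")
    case True
    have c: "clip x \<in> coord_space (Suc d)" "clip x d = ?s" using x(1) True by (auto simp: clip_def)
    have e: "\<psi>' x = \<psi> (clip x)" using True by (auto simp: \<psi>'_def[abs_def] max_absorb2)
    have o: "\<psi> (clip x) \<in> cone_complex \<G>" and p: "\<phi> (\<psi> (clip x)) = clip x"
      using psi[OF c(1)] phi_psi[OF c(1)] True c(2) by auto
    have f: "floor_point (clip x) = floor_point x" by (auto simp: floor_point_def clip_def)
    have "\<phi>' (\<psi>' x) = x"
      unfolding e phi'_old[OF o] p f using c(2) by (auto simp: drop_height_def clip_def)
    moreover have "\<psi>' x \<in> cone_complex (insert F \<G>)" using o unfolding e cone_complex_def by auto
    ultimately show ?thesis by blast
  next
    case False
    have cl: "clip x = floor_point x" using False by (auto simp: clip_def floor_point_def max_absorb2)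
    note b = floor_bd[OF x(1)]
    have b0: "0 \<le> ?b v" for v by (rule coneD[OF b(1)])
    have e: "\<psi>' x v = ?b v - ?s * push v" for v using False by (simp add: \<psi>'_def cl)
    have sd: "- ?s \<le> depth ?b" if "R \<noteq> F" using x(2)[OF that] by (simp add: drop_height_def)
    \<comment> \<open>For \<open>R \<noteq> F\<close>, a point below the graph has positive depth at
      its floor point, which is what \<open>boundary_star\<close> needs to place the latter in the
      cone over \<open>F\<close>. For \<open>R = F\<close> the condition is empty.\<close>
    have "0 < ?b j" if "j \<in> F - R" for j
    proof -
      have "R \<noteq> F" using that by auto
      then show ?thesis using sd False depth_le[OF that, of ?b] by simp
    qed
    then have bF: "{v. ?b v \<noteq> 0} \<subseteq> F" by (rule boundary_star[OF b(2)])
    have h: "0 \<le> \<psi>' x v" for v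
    proof (cases "v \<in> F - R")
      case True
      then have "R \<noteq> F" by auto
      then show ?thesis using sd depth_le[OF True, of ?b] True by (simp add: e push_def)
    qed (use False b0[of v] in \<open>auto simp: e push_def\<close>)
    have hF: "{v. \<psi>' x v \<noteq> 0} \<subseteq> F" using bF R_F(1) by (auto simp: e push_def split: if_splits)
    have ht: "height (\<psi>' x) = - ?s"
    proof -
      obtain w where w: "w \<in> R" "?b w = 0" using cone_boundary_zero[OF b(1)] .
      obtain u where u: "u \<in> R" "height (\<psi>' x) = \<psi>' x u" by (rule height_attained)
      have "height (\<psi>' x) \<le> \<psi>' x w" using w height_le by blast
      then show ?thesis using w u b0[of u] by (auto simp: e push_def)
    qed
    have rt: "retract (\<psi>' x) = ?b" by (auto simp: retract_def e ht)
    have "\<phi>' (\<psi>' x) = x"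
    proof
      fix j show "\<phi>' (\<psi>' x) j = x j"
      proof (cases "j = d")
        case True
        have "x d = depth ?b + ?s" by (simp add: drop_height_def)
        then show ?thesis using True new_cone(2)[OF h hF] unfolding phi'_new(1)[OF h hF] rt ht by (auto simp: depth_def)
      next
        case False
        then show ?thesis unfolding phi'_new(1)[OF h hF] rt b(3) by (simp add: floor_point_def)
      qed
    qed
    moreover have "\<psi>' x \<in> cone_complex (insert F \<G>)" using h hF unfolding cone_complex_def by auto
    ultimately show ?thesis by blast
  qed
  then show "\<psi>' x \<in> cone_complex (insert F \<G>)" "\<phi>' (\<psi>' x) = x" by auto
qed

text \<open>\<open>boundary_star\<close> for the indicator of a free ridge: if the ridge contains
  \<open>F - R\<close>, it belongs to \<open>F\<close> as well and stops being free.\<close>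

lemma ridge_in_both:
  assumes "G \<in> \<G>" "x \<in> G" "\<And>K. K \<in> \<G> \<Longrightarrow> G - {x} \<subseteq> K \<Longrightarrow> K = G" "\<And>j. j \<in> F - R \<Longrightarrow> j \<in> G - {x}"
  shows "G - {x} \<subseteq> F"
proof -
  let ?b = "\<lambda>v. if v \<in> G - {x} then 1 else 0 :: real"
  have "?b \<in> cone_boundary \<G>" unfolding cone_boundary_def using assms(1-3) by auto
  then have sub: "{v. ?b v \<noteq> 0} \<subseteq> F" by (rule boundary_star) (use assms(4) in auto)
  have "v \<in> F" if "v \<in> G - {x}" for v using subsetD[OF sub, of v] that by simp
  then show ?thesis by blast
qed

text \<open>The free ridges after attaching are those opposite to vertices of \<open>F - R\<close>
  and the old free ones not contained in \<open>F\<close>. The latter miss a vertex of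
  \<open>F - R\<close> by \<open>ridge_in_both\<close>, so the depth vanishes on them and the shear
  leaves them on the floor.\<close>

lemma phi'_boundary:
  assumes RF: "R \<noteq> F" and h: "h \<in> cone_complex (insert F \<G>)"
  shows "\<phi>' h d = 0 \<longleftrightarrow> h \<in> cone_boundary (insert F \<G>)"
proof
  assume z: "\<phi>' h d = 0"
  have free: "h \<in> cone_boundary (insert F \<G>)" if hF: "{v. h v \<noteq> 0} \<subseteq> F" and j: "j \<in> F - R" "h j = 0" for j
  proof -
    have "\<forall>K\<in>insert F \<G>. F - {j} \<subseteq> K \<longrightarrow> K = F" using j(1) by (auto simp: R_def)
    moreover have "{v. h v \<noteq> 0} \<subseteq> F - {j}" using hF j(2) by auto
    ultimately show ?thesis unfolding cone_boundary_def using j(1) coneD[OF h] by blast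
  qed
  from h show "h \<in> cone_boundary (insert F \<G>)"
  proof (cases rule: cone_insert_cases)
    case new
    then have "depth h = 0" using z RF phi'_new(1)[OF new] by simp
    then obtain j where "j \<in> F - R" "h j = 0" using depth_attained[OF RF] by metis
    then show ?thesis using free new(2) by blast
  next
    case old
    note b = floor_bd[OF phi[OF old]]
    have "0 \<le> depth (\<psi> (floor_point (\<phi> h)))" by (rule depth_nonneg) (rule coneD[OF b(1)])
    then have z2: "\<phi> h d = 0" "depth (\<psi> (floor_point (\<phi> h))) = 0" using z phi_d[OF old] by (simp_all add: phi'_old[OF old])
    then have d0: "depth h = 0" using psi_phi[OF old] by (simp add: floor_point_floor)
    then obtain j where j: "j \<in> F - R" "h j = 0" using depth_attained[OF RF] by metis
    have "h \<in> cone_boundary \<G>" using z2 phi_bd[OF old] by simp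
    then obtain G x where Gx: "G \<in> \<G>" "x \<in> G" "\<forall>K\<in>\<G>. G - {x} \<subseteq> K \<longrightarrow> K = G" "{v. h v \<noteq> 0} \<subseteq> G - {x}"
      unfolding cone_boundary_def by blast
    show ?thesis
    proof (cases "G - {x} \<subseteq> F")
      case True
      then show ?thesis using free j Gx(4) by blast
    next
      case False
      then have "\<forall>K\<in>insert F \<G>. G - {x} \<subseteq> K \<longrightarrow> K = G" using Gx(3) by blast
      then show ?thesis unfolding cone_boundary_def using Gx coneD[OF h] by blast
    qed
  qed
next
  assume "h \<in> cone_boundary (insert F \<G>)"
  then obtain G x where Gx: "G \<in> insert F \<G>" "x \<in> G" "\<forall>K\<in>insert F \<G>. G - {x} \<subseteq> K \<longrightarrow> K = G" "{v. h v \<noteq> 0} \<subseteq> G - {x}"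
    and h0: "\<And>v. 0 \<le> h v"
    unfolding cone_boundary_def by blast
  show "\<phi>' h d = 0"
  proof (cases "G = F")
    case True
    have hF: "{v. h v \<noteq> 0} \<subseteq> F" "h x = 0" using Gx(4) True by auto
    have "x \<in> F - R" using Gx(2,3) True F(3) by (auto simp: R_def)
    then have "depth h \<le> 0" using depth_le[of x h] hF(2) by simp
    then have "depth h = 0" using depth_nonneg[of h] h0 by simp
    then show ?thesis using RF phi'_new(1)[OF h0 hF(1)] by simp
  next
    case False
    then have GG: "G \<in> \<G>" using Gx(1) by simp
    have nF: "\<not> G - {x} \<subseteq> F" using Gx(3) False by blast
    have "\<forall>K\<in>\<G>. G - {x} \<subseteq> K \<longrightarrow> K = G" using Gx(3) by simp
    then have "\<exists>G\<in>\<G>. \<exists>x\<in>G. (\<forall>K\<in>\<G>. G - {x} \<subseteq> K \<longrightarrow> K = G) \<and> {v. h v \<noteq> 0} \<subseteq> G - {x}"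
      using GG Gx(2,4) by metis
    then have bd: "h \<in> cone_boundary \<G>" unfolding cone_boundary_def using h0 by simp
    then have old: "h \<in> cone_complex \<G>" using cone_boundary_subset by blast
    have pd: "\<phi> h d = 0" using phi_bd[OF old] bd by simp
    have "\<exists>j\<in>F - R. h j = 0"
    proof (rule ccontr)
      assume "\<not> ?thesis"
      then have "\<And>j. j \<in> F - R \<Longrightarrow> j \<in> G - {x}" using Gx(4) by blast
      with ridge_in_both[OF GG Gx(2)] Gx(3) nF show False by blast
    qed
    then obtain j where j: "j \<in> F - R" "h j = 0" by blast
    then have "depth h \<le> 0" using depth_le[of j h] by simp
    then have "depth h = 0" using depth_nonneg[of h] h0 by simp
    then show ?thesis using pd psi_phi[OF old] by (simp add: phi'_old[OF old] floor_point_floor)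
  qed
qed

lemma attached_half_chart: "R \<noteq> F \<Longrightarrow> half_chart (insert F \<G>) d \<phi>' \<psi>'"
  unfolding half_chart_def using LL_phi' LL_psi' phi'_in psi'_phi' psi'_in phi'_boundary by auto

lemma attached_full_chart: "R = F \<Longrightarrow> full_chart (insert F \<G>) (Suc d) \<phi>' \<psi>'"
  unfolding full_chart_def using LL_phi' LL_psi' phi'_in psi'_phi' psi'_in by auto

text \<open>With \<open>F - R\<close> empty, \<open>ridge_in_both\<close> puts every old free ridge
  into \<open>F\<close>, so that no free ridge is left. \<open>shelling_chart\<close> uses this to
  exclude any further facet.\<close>

lemma attached_closed:
  assumes "R = F" "G \<in> insert F \<G>" "x \<in> G"
  shows "\<exists>K\<in>insert F \<G>. K \<noteq> G \<and> G - {x} \<subseteq> K"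
proof (cases "G = F")
  case True
  then have "x \<in> R" using assms(1,3) by simp
  then obtain K where "K \<in> \<G>" "F - {x} \<subseteq> K" by (auto simp: R_def)
  moreover have "K \<noteq> F" using calculation(1) F(3) by auto
  ultimately show ?thesis unfolding True by (intro bexI[of _ K]) auto
next
  case False
  then have GG: "G \<in> \<G>" using assms by simp
  show ?thesis
  proof (rule ccontr)
    assume n: "\<not> ?thesis"
    then have "G - {x} \<subseteq> F" using ridge_in_both[OF GG assms(3)] assms(1) by blast
    then show False using n False by blast
  qed
qed

end

lemma shelling_chart:
  assumes "shelling \<G>" "finite \<F>" "\<G> \<subseteq> \<F>" "\<And>F. F \<in> \<F> \<Longrightarrow> finite F" "\<And>F. F \<in> \<F> \<Longrightarrow> card F = Suc d"
    and thin: "\<And>F x. F \<in> \<F> \<Longrightarrow> x \<in> F \<Longrightarrow> card {K\<in>\<F>. F - {x} \<subseteq> K} \<le> 2"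
  shows "\<exists>\<phi> \<psi>. half_chart \<G> d \<phi> \<psi> \<or>
    full_chart \<G> (Suc d) \<phi> \<psi> \<and> (\<forall>G\<in>\<G>. \<forall>x\<in>G. \<exists>K\<in>\<G>. K \<noteq> G \<and> G - {x} \<subseteq> K)"
  using assms(1,3)
proof (induction \<G>)
  case (single F)
  then show ?case using half_chart_single[of F d] assms(4,5) by blast
next
  case (step \<G> F)
  have "\<G> \<subseteq> \<F>" using step.prems by simp
  from step.IH[OF this] obtain \<phi> \<psi> where IH: "half_chart \<G> d \<phi> \<psi> \<or>
    full_chart \<G> (Suc d) \<phi> \<psi> \<and> (\<forall>G\<in>\<G>. \<forall>x\<in>G. \<exists>K\<in>\<G>. K \<noteq> G \<and> G - {x} \<subseteq> K)"
    by (elim exE)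
  have sub: "insert F \<G> \<subseteq> \<F>" using step.prems .
  have fin: "finite (insert F \<G>)" using sub assms(2) by (rule finite_subset)
  have ne: "\<G> \<noteq> {}" using step.hyps(1) by cases auto
  have thin': "card {K\<in>insert F \<G>. F - {x} \<subseteq> K} \<le> 2" if "x \<in> F" for x
  proof -
    have "card {K\<in>insert F \<G>. F - {x} \<subseteq> K} \<le> card {K\<in>\<F>. F - {x} \<subseteq> K}"
      using sub assms(2) by (intro card_mono) auto
    then show ?thesis using thin[of F x] that sub by simp
  qed
  from IH show ?case
  proof
    assume "half_chart \<G> d \<phi> \<psi>"
    then interpret attach_facet \<G> F d \<phi> \<psi>
      using assms(4,5) sub fin ne step.hyps thin' by unfold_locales auto
    show ?thesis using attached_half_chart attached_full_chart attached_closed by metis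
  next
    \<comment> \<open>In a closed complex the ridge that \<open>F\<close> shares with
      \<open>G\<close> already lies in two facets; \<open>F\<close> would be the third, against
      thinness.\<close>
    assume full: "full_chart \<G> (Suc d) \<phi> \<psi> \<and> (\<forall>G\<in>\<G>. \<forall>x\<in>G. \<exists>K\<in>\<G>. K \<noteq> G \<and> G - {x} \<subseteq> K)"
    obtain x G where x: "x \<in> F" "G \<in> \<G>" "F - {x} \<subseteq> G" using step.hyps(3) ne by blast
    have cF: "card (F - {x}) = d" and fF: "finite F" using assms(4,5) sub x by auto
    have cG: "finite G" "card G = Suc d" using assms(4,5) sub x by auto
    have "card (G - (F - {x})) = 1" using cF cG x(3) card_Diff_subset[of "F - {x}" G] fF by simp
    then obtain y where y: "G - (F - {x}) = {y}" by (auto simp: card_1_singleton_iff)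
    then have yG: "y \<in> G" "G - {y} = F - {x}" using x(3) by auto
    obtain K where K: "K \<in> \<G>" "K \<noteq> G" "G - {y} \<subseteq> K" using full x(2) yG(1) by blast
    have "F \<noteq> G" "F \<noteq> K" using x K step.hyps(2) by auto
    then have "card {F, G, K} = 3" using K(2) by auto
    moreover have "{F, G, K} \<subseteq> {K\<in>insert F \<G>. F - {x} \<subseteq> K}" using x K yG by auto
    ultimately have "3 \<le> card {K\<in>insert F \<G>. F - {x} \<subseteq> K}" using card_mono[of "{K\<in>insert F \<G>. F - {x} \<subseteq> K}" "{F, G, K}"] fin by auto
    then show ?thesis using thin'[OF x(1)] by simp
  qed
qed

theorem shellable_sphere_chart:
  assumes "shelling \<F>" "finite \<F>" "\<And>F. F \<in> \<F> \<Longrightarrow> finite F" "\<And>F. F \<in> \<F> \<Longrightarrow> card F = n"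
    and thin: "\<And>F x. F \<in> \<F> \<Longrightarrow> x \<in> F \<Longrightarrow> card {K\<in>\<F>. F - {x} \<subseteq> K} = 2"
  shows "\<exists>\<phi> \<psi>. full_chart \<F> n \<phi> \<psi>"
proof (cases n)
  case 0
  \<comment> \<open>In dimension 0 the only facet is the empty one, and its cone is the
    origin.\<close>
  have ne: "\<F> \<noteq> {}" using assms(1) by cases auto
  have "F = {}" if "F \<in> \<F>" for F using assms(3,4)[OF that] 0 by simp
  then have "\<F> = {{}}" using ne by auto
  then have "cone_complex \<F> = {\<lambda>_. 0}" by (auto simp: cone_complex_def)
  then have "full_chart \<F> n (\<lambda>_ _. 0) (\<lambda>_ _. 0)"
    unfolding full_chart_def using 0 by (auto simp: lattice_linear_zero)
  then show ?thesis by blast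
next
  case (Suc d)
  obtain \<phi> \<psi> where c: "half_chart \<F> d \<phi> \<psi> \<or> full_chart \<F> (Suc d) \<phi> \<psi>"
  proof -
    have "card {K\<in>\<F>. F - {x} \<subseteq> K} \<le> 2" if "F \<in> \<F>" "x \<in> F" for F x using thin[OF that] by simp
    note * = this
    have "\<exists>\<phi> \<psi>. half_chart \<F> d \<phi> \<psi> \<or> full_chart \<F> (Suc d) \<phi> \<psi> \<and>
      (\<forall>G\<in>\<F>. \<forall>x\<in>G. \<exists>K\<in>\<F>. K \<noteq> G \<and> G - {x} \<subseteq> K)"
      by (rule shelling_chart[OF assms(1,2) order.refl]) (use assms(3,4) Suc * in simp_all)
    then obtain \<phi> \<psi> where "half_chart \<F> d \<phi> \<psi> \<or> full_chart \<F> (Suc d) \<phi> \<psi> \<and>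
      (\<forall>G\<in>\<F>. \<forall>x\<in>G. \<exists>K\<in>\<F>. K \<noteq> G \<and> G - {x} \<subseteq> K)" by (elim exE)
    then show ?thesis using that[of \<phi> \<psi>] by (elim disjE) simp_all
  qed
  \<comment> \<open>The origin lies on the boundary hyperplane, so a half-chart would produce a free
    ridge, but each ridge lies in exactly two facets.\<close>
  have "\<not> half_chart \<F> d \<phi> \<psi>"
  proof
    assume h: "half_chart \<F> d \<phi> \<psi>"
    let ?z = "\<lambda>_::nat. 0::real"
    have z: "?z \<in> coord_space (Suc d)" "0 \<le> ?z d" by auto
    have h1: "\<forall>x\<in>coord_space (Suc d). 0 \<le> x d \<longrightarrow> \<psi> x \<in> cone_complex \<F> \<and> \<phi> (\<psi> x) = x"
      using h unfolding half_chart_def by (elim conjE)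
    have h2: "\<forall>h\<in>cone_complex \<F>. \<phi> h d = 0 \<longleftrightarrow> h \<in> cone_boundary \<F>"
      using h unfolding half_chart_def by simp
    have "\<psi> ?z \<in> cone_complex \<F>" "\<phi> (\<psi> ?z) = ?z" using h1[rule_format, OF z] by auto
    then have "\<psi> ?z \<in> cone_boundary \<F>" using h2[rule_format, of "\<psi> ?z"] by simp
    then obtain F x where Fx: "F \<in> \<F>" "x \<in> F" "\<forall>G\<in>\<F>. F - {x} \<subseteq> G \<longrightarrow> G = F"
      unfolding cone_boundary_def by blast
    then have "{K\<in>\<F>. F - {x} \<subseteq> K} = {F}" by auto
    then show False using thin[OF Fx(1,2)] by simp
  qed
  then show ?thesis using c Suc by blast
qed

section \<open>Maximal chains of intervals\<close>

abbreviation is_chain :: "'a::order set \<Rightarrow> bool" where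
  "is_chain \<equiv> Complete_Partial_Order.chain (\<le>)"

lemma is_chainD: "is_chain C \<Longrightarrow> u \<in> C \<Longrightarrow> v \<in> C \<Longrightarrow> u \<le> v \<or> v \<le> u"
  unfolding Complete_Partial_Order.chain_def by blast

lemma is_chainI: "(\<And>u v. u \<in> C \<Longrightarrow> v \<in> C \<Longrightarrow> u \<le> v \<or> v \<le> u) \<Longrightarrow> is_chain C"
  unfolding Complete_Partial_Order.chain_def by blast

lemma is_chain_insert:
  "is_chain C \<Longrightarrow> (\<And>u. u \<in> C \<Longrightarrow> u \<le> v \<or> v \<le> u) \<Longrightarrow> is_chain (insert v C)"
  unfolding Complete_Partial_Order.chain_def by blast

lemma maximal_chains_iff:
  "m \<in> maximal_chains A \<longleftrightarrow> m \<subseteq> A \<and> m \<noteq> {} \<and> is_chain m \<and>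
     (\<forall>C. C \<subseteq> A \<longrightarrow> is_chain C \<longrightarrow> m \<subseteq> C \<longrightarrow> C = m)"
  unfolding maximal_chains_def maximal_elements_def barycentric_subdivision_def by blast

lemma maximal_chainD:
  assumes "m \<in> maximal_chains A"
  shows "m \<subseteq> A" "m \<noteq> {}" "is_chain m" "\<And>C. C \<subseteq> A \<Longrightarrow> is_chain C \<Longrightarrow> m \<subseteq> C \<Longrightarrow> C = m"
    "\<And>v. v \<in> A \<Longrightarrow> (\<And>u. u \<in> m \<Longrightarrow> u \<le> v \<or> v \<le> u) \<Longrightarrow> v \<in> m"
proof -
  show 1: "m \<subseteq> A" "m \<noteq> {}" "is_chain m" "\<And>C. C \<subseteq> A \<Longrightarrow> is_chain C \<Longrightarrow> m \<subseteq> C \<Longrightarrow> C = m"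
    using assms unfolding maximal_chains_iff by auto
  fix v assume v: "v \<in> A" "\<And>u. u \<in> m \<Longrightarrow> u \<le> v \<or> v \<le> u"
  have "insert v m = m" using v 1(1) by (intro 1(4) is_chain_insert 1(3)) auto
  then show "v \<in> m" by blast
qed

text \<open>By Zorn's lemma, because it is applied to intervals before they are known to be finite:
  their finiteness rests on the monotonicity of \<open>g\<close>, which is proved with maximal
  chains.\<close>

lemma extend_to_maximal_chain:
  assumes "C \<subseteq> A" "C \<noteq> {}" "is_chain C"
  obtains m where "m \<in> maximal_chains A" "C \<subseteq> m"
proof -
  let ?\<A> = "{D. D \<subseteq> A \<and> is_chain D \<and> C \<subseteq> D}"
  have "\<exists>M\<in>?\<A>. \<forall>X\<in>?\<A>. M \<subseteq> X \<longrightarrow> X = M"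
  proof (rule subset_Zorn_nonempty)
    show "?\<A> \<noteq> {}" using assms by blast
    fix \<C> assume ne: "\<C> \<noteq> {}" and c: "subset.chain ?\<A> \<C>"
    then have sub: "\<C> \<subseteq> ?\<A>" and cmp: "\<And>X Y. X \<in> \<C> \<Longrightarrow> Y \<in> \<C> \<Longrightarrow> X \<subseteq> Y \<or> Y \<subseteq> X"
      unfolding subset_chain_def by auto
    have "is_chain (\<Union>\<C>)"
    proof (rule is_chainI)
      fix u v assume "u \<in> \<Union>\<C>" "v \<in> \<Union>\<C>"
      then obtain X Y where XY: "X \<in> \<C>" "u \<in> X" "Y \<in> \<C>" "v \<in> Y" by blast
      then obtain Z where "Z \<in> \<C>" "u \<in> Z" "v \<in> Z" using cmp[OF XY(1,3)] by blast
      moreover have "is_chain Z" using sub \<open>Z \<in> \<C>\<close> by blast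
      ultimately show "u \<le> v \<or> v \<le> u" using is_chainD by metis
    qed
    moreover have "\<Union>\<C> \<subseteq> A" using sub by blast
    moreover have "C \<subseteq> \<Union>\<C>" using sub ne by blast
    ultimately show "\<Union>\<C> \<in> ?\<A>" by blast
  qed
  then obtain m where m: "m \<in> ?\<A>" "\<And>X. X \<in> ?\<A> \<Longrightarrow> m \<subseteq> X \<Longrightarrow> X = m" by meson
  then have m1: "m \<subseteq> A" "is_chain m" "C \<subseteq> m" by auto
  have "D = m" if "D \<subseteq> A" "is_chain D" "m \<subseteq> D" for D
    using m(2)[of D] that m1(3) by auto
  then have "m \<in> maximal_chains A"
    unfolding maximal_chains_iff using m1 assms(2) by auto
  then show ?thesis using that m1(3) by simp
qed

lemma finite_chain_max:
  assumes "finite C" "C \<noteq> {}" "is_chain C"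
  obtains e where "e \<in> C" "\<And>w. w \<in> C \<Longrightarrow> w \<le> e"
proof -
  obtain e where e: "e \<in> C" "\<And>w. w \<in> C \<Longrightarrow> e \<le> w \<Longrightarrow> e = w"
    using finite_has_maximal[OF assms(1,2)] by blast
  have "w \<le> e" if "w \<in> C" for w
    using is_chainD[OF assms(3) e(1) that] e(2)[OF that] by auto
  then show ?thesis using that e(1) by blast
qed

lemma finite_chain_min:
  assumes "finite C" "C \<noteq> {}" "is_chain C"
  obtains e where "e \<in> C" "\<And>w. w \<in> C \<Longrightarrow> e \<le> w"
proof -
  obtain e where e: "e \<in> C" "\<And>w. w \<in> C \<Longrightarrow> w \<le> e \<Longrightarrow> e = w"
    using finite_has_minimal[OF assms(1,2)] by blast
  have "e \<le> w" if "w \<in> C" for w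
    using is_chainD[OF assms(3) e(1) that] e(2)[OF that] by auto
  then show ?thesis using that e(1) by blast
qed

section \<open>Intervals of GT posets\<close>

locale GT =
  fixes P :: "'a::order set" and g :: "'a \<Rightarrow> int"
  assumes GT: "GT_poset P g"
begin

lemma thin_facts: "locally_thin P" "grading_assignment P g" "finite {p \<in> P. g p = k}"
  using GT unfolding GT_poset_def by auto

lemma covers_grading: "covers P a b \<Longrightarrow> g b = g a + 1"
  using thin_facts(2) unfolding grading_assignment_def by blast

lemma maximal_chain_ends:
  assumes "a \<in> P" "b \<in> P" "a \<le> b" "m \<in> maximal_chains (P \<inter> {a..b})"
  shows "a \<in> m" "b \<in> m" "finite m"
proof -
  have sub: "m \<subseteq> P \<inter> {a..b}" using maximal_chainD(1)[OF assms(4)] .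
  show "a \<in> m" by (rule maximal_chainD(5)[OF assms(4)]) (use assms sub in auto)
  show "b \<in> m" by (rule maximal_chainD(5)[OF assms(4)]) (use assms sub in auto)
  have "graded (P \<inter> {a..b})" using thin_facts(1) assms unfolding locally_thin_def by blast
  moreover have "a \<in> P \<inter> {a..b}" "b \<in> P \<inter> {a..b}" using assms by auto
  ultimately have "\<exists>n. \<forall>m\<in>maximal_chains (P \<inter> {a..b} \<inter> {a..b}). finite m \<and> card m = n"
    using assms(3) unfolding graded_def by blast
  then show "finite m" using assms(4) by (auto simp: Int_assoc)
qed

text \<open>The second largest element of a maximal chain is covered by the top, and removing the
  top leaves a maximal chain of the shorter interval. So \<open>g\<close> determines the common
  length of all maximal chains, which makes the complexes below pure.\<close>

lemma maximal_chain_card: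
  assumes "a \<in> P" "b \<in> P" "a \<le> b" "m \<in> maximal_chains (P \<inter> {a..b})"
  shows "g b - g a = int (card m) - 1"
  using assms
proof (induction "card m" arbitrary: b m rule: less_induct)
  case less
  note m = maximal_chainD[OF less.prems(4)] and e = maximal_chain_ends[OF less.prems]
  show ?case
  proof (cases "a = b")
    case True
    then have "m = {a}" using m(1) e(1) by auto
    then show ?thesis using True by simp
  next
    case False
    have "m - {b} \<noteq> {}" using e(1) False by blast
    moreover have "is_chain (m - {b})" by (rule chain_subset[OF m(3)]) auto
    ultimately obtain c where c: "c \<in> m - {b}" "\<And>w. w \<in> m - {b} \<Longrightarrow> w \<le> c"
      using finite_chain_max[of "m - {b}"] e(3) by auto
    have cP: "c \<in> P" "a \<le> c" "c < b" using c(1) subsetD[OF m(1), of c] by (auto simp: less_le)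
    have "covers P c b"
      unfolding covers_def
    proof (intro conjI notI)
      assume "\<exists>z\<in>P. c < z \<and> z < b"
      then obtain z where z: "z \<in> P" "c < z" "z < b" by blast
      have "u \<le> z \<or> z \<le> u" if "u \<in> m" for u using c(2)[of u] z that by (cases "u = b") auto
      then have "z \<in> m" using z cP by (intro m(5)) auto
      then have "z \<le> c" using c(2)[of z] z(3) by blast
      then show False using z(2) by (simp add: less_le_not_le)
    qed (use cP less.prems in auto)
    then have gb: "g b = g c + 1" by (rule covers_grading)
    have mc: "m - {b} \<in> maximal_chains (P \<inter> {a..c})"
      unfolding maximal_chains_iff
    proof (intro conjI allI impI)
      show "m - {b} \<subseteq> P \<inter> {a..c}"
      proof
        fix w assume "w \<in> m - {b}"
        then show "w \<in> P \<inter> {a..c}" using subsetD[OF m(1), of w] c(2)[of w] by auto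
      qed
      fix C assume C: "C \<subseteq> P \<inter> {a..c}" "is_chain C" "m - {b} \<subseteq> C"
      have "u \<le> b" if "u \<in> C" for u
        using subsetD[OF C(1) that] cP(3) by (auto intro: order.trans less_imp_le)
      then have "is_chain (insert b C)" by (intro is_chain_insert[OF C(2)]) blast
      moreover have "insert b C \<subseteq> P \<inter> {a..b}"
      proof
        fix u assume "u \<in> insert b C"
        then show "u \<in> P \<inter> {a..b}"
          using subsetD[OF C(1), of u] \<open>\<And>u. u \<in> C \<Longrightarrow> u \<le> b\<close> less.prems by auto
      qed
      ultimately have "insert b C = m" using C(3) by (intro m(4)) auto
      moreover have "b \<notin> C" using subsetD[OF C(1), of b] cP by auto
      ultimately show "C = m - {b}" by blast
    qed fact+
    have "card (m - {b}) < card m" using e(2,3) by (intro psubset_card_mono) auto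
    then have "g c - g a = int (card (m - {b})) - 1" by (rule less.hyps[OF _ less.prems(1) cP(1,2) mc])
    moreover have "card m = Suc (card (m - {b}))" by (rule card.remove[OF e(3,2)])
    ultimately show ?thesis using gb by simp
  qed
qed

lemma grading_mono:
  assumes "a \<in> P" "b \<in> P" "a \<le> b" shows "g a \<le> g b"
proof -
  obtain m where m: "m \<in> maximal_chains (P \<inter> {a..b})" "{a} \<subseteq> m"
    by (rule extend_to_maximal_chain[of "{a}" "P \<inter> {a..b}"]) (use assms in \<open>auto intro: is_chainI\<close>)
  have "card m > 0" using maximal_chain_ends[OF assms m(1)] m(2) by (auto simp: card_gt_0_iff)
  then show ?thesis using maximal_chain_card[OF assms m(1)] by simp
qed

lemma finite_interval:
  assumes "a \<in> P" "b \<in> P" shows "finite (P \<inter> {a..b})"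
proof (rule finite_subset)
  show "P \<inter> {a..b} \<subseteq> (\<Union>k\<in>{g a..g b}. {p \<in> P. g p = k})" using assms grading_mono by auto
  show "finite (\<Union>k\<in>{g a..g b}. {p \<in> P. g p = k})" using thin_facts(3) by simp
qed

text \<open>Let \<open>a\<close> and \<open>b\<close> be the neighbours of \<open>c\<close> in
  \<open>m\<close>. The chains in question arise by putting any element strictly between
  \<open>a\<close> and \<open>b\<close> in place of \<open>c\<close>, and since the interval from
  \<open>a\<close> to \<open>b\<close> has length 3, local thinness leaves two choices.\<close>

lemma ridge_in_two_maximal_chains:
  assumes P: "y \<in> P" "x \<in> P" "y \<le> x" and m: "m \<in> maximal_chains (P \<inter> {y..x})" and c: "c \<in> m" "c \<noteq> x" "c \<noteq> y"
  shows "card {m' \<in> maximal_chains (P \<inter> {y..x}). m - {c} \<subseteq> m'} = 2"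
proof -
  let ?M = "maximal_chains (P \<inter> {y..x})"
  note mD = maximal_chainD[OF m] and me = maximal_chain_ends[OF P m]
  have cP: "c \<in> P" "y < c" "c < x" using c subsetD[OF mD(1) c(1)] by (auto simp: less_le)
  have "is_chain {w\<in>m. w < c}" "is_chain {w\<in>m. c < w}" by (rule chain_subset[OF mD(3)], blast)+
  moreover have "finite {w\<in>m. w < c}" "finite {w\<in>m. c < w}" using me(3) by auto
  moreover have "y \<in> {w\<in>m. w < c}" "x \<in> {w\<in>m. c < w}" using me cP by auto
  then have "{w\<in>m. w < c} \<noteq> {}" "{w\<in>m. c < w} \<noteq> {}" by blast+
  ultimately have lower: "finite {w\<in>m. w < c}" "{w\<in>m. w < c} \<noteq> {}" "is_chain {w\<in>m. w < c}"
    and upper: "finite {w\<in>m. c < w}" "{w\<in>m. c < w} \<noteq> {}" "is_chain {w\<in>m. c < w}" by simp_all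
  obtain a where a: "a \<in> {w\<in>m. w < c}" "\<And>w. w \<in> {w\<in>m. w < c} \<Longrightarrow> w \<le> a"
    by (rule finite_chain_max[OF lower]) (rule that)
  obtain b where b: "b \<in> {w\<in>m. c < w}" "\<And>w. w \<in> {w\<in>m. c < w} \<Longrightarrow> b \<le> w"
    by (rule finite_chain_min[OF upper]) (rule that)
  have ab: "a \<in> m" "b \<in> m" "a < c" "c < b" "a \<in> P" "b \<in> P" "a \<le> b" "y \<le> a" "b \<le> x"
    using a(1) b(1) mD(1) by auto
  have gap: "w \<le> a \<or> w = c \<or> b \<le> w" if "w \<in> m" for w
    using is_chainD[OF mD(3) that c(1)] a(2)[of w] b(2)[of w] that by (auto simp: order.order_iff_strict)
  have in_m: "z \<in> m" if "z \<in> P" "a \<le> z" "z \<le> b" "z \<le> c \<or> c \<le> z" for z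
  proof (rule mD(5))
    show "z \<in> P \<inter> {y..x}" using that ab by (auto intro: order.trans)
    show "u \<le> z \<or> z \<le> u" if "u \<in> m" for u
      using gap[OF that] \<open>a \<le> z\<close> \<open>z \<le> b\<close> \<open>z \<le> c \<or> c \<le> z\<close> by (auto intro: order.trans)
  qed
  have "\<not> (\<exists>z\<in>P. a < z \<and> z < c)"
  proof clarify
    fix z assume z: "z \<in> P" "a < z" "z < c"
    then have "z \<in> m" using ab by (intro in_m) (auto intro: order.trans)
    then have "z \<le> a" using a(2)[of z] z by auto
    then show False using z(2) by (simp add: less_le_not_le)
  qed
  moreover have "\<not> (\<exists>z\<in>P. c < z \<and> z < b)"
  proof clarify
    fix z assume z: "z \<in> P" "c < z" "z < b"
    then have "z \<in> m" using ab by (intro in_m) (auto intro: order.trans)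
    then have "b \<le> z" using b(2)[of z] z by auto
    then show False using z(3) by (simp add: less_le_not_le)
  qed
  ultimately have cov: "covers P a c" "covers P c b"
    unfolding covers_def using ab cP by simp_all
  have gab: "g b = g a + 2" using covers_grading cov by force
  let ?Z = "{z\<in>P. a < z \<and> z < b}" and ?N = "maximal_chains (P \<inter> {a..b})"
  have c3: "card k = 3" if "k \<in> ?N" for k using maximal_chain_card[OF ab(5-7) that] gab by simp
  have N: "?N = (\<lambda>z. {a, z, b}) ` ?Z"
  proof (intro equalityI subsetI)
    fix k assume k: "k \<in> ?N"
    note kD = maximal_chainD[OF k] and ke = maximal_chain_ends[OF ab(5-7) k]
    have "a \<noteq> b" using ab by auto
    then have "card (k - {a, b}) = 1" using c3[OF k] ke by (simp add: card_Diff_subset)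
    then obtain z where z: "k - {a, b} = {z}" by (auto simp: card_1_singleton_iff)
    then have "k = {a, z, b}" "z \<in> k" "z \<noteq> a" "z \<noteq> b" using ke by auto
    moreover have "z \<in> ?Z" using calculation(2-4) subsetD[OF kD(1), of z] by (auto simp: less_le)
    ultimately show "k \<in> (\<lambda>z. {a, z, b}) ` ?Z" by blast
  next
    fix k assume "k \<in> (\<lambda>z. {a, z, b}) ` ?Z"
    then obtain z where z: "z \<in> ?Z" "k = {a, z, b}" by blast
    obtain k' where k': "k' \<in> ?N" "k \<subseteq> k'"
      by (rule extend_to_maximal_chain[of k "P \<inter> {a..b}"]) (use z ab in \<open>auto intro!: is_chainI\<close>)
    have "a \<noteq> z" "z \<noteq> b" "a \<noteq> b" using z ab by auto
    then have "card k = 3" using z(2) by simp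
    then have "k = k'" using c3[OF k'(1)] k'(2) maximal_chain_ends(3)[OF ab(5-7) k'(1)] card_subset_eq by metis
    then show "k \<in> ?N" using k'(1) by simp
  qed
  have "card ?N = 2"
    using thin_facts(1) ab(5-7) c3 unfolding locally_thin_def by blast
  moreover have "inj_on (\<lambda>z. {a, z, b}) ?Z" by (rule inj_onI) auto
  ultimately have Z2: "card ?Z = 2" unfolding N by (simp add: card_image)
  have cm: "card m' = card m" if "m' \<in> ?M" for m'
    using maximal_chain_card[OF P that] maximal_chain_card[OF P m] by simp
  \<comment> \<open>All maximal chains have the same number of elements, so \<open>m'\<close> adds a
    single \<open>z\<close>. At or below \<open>a\<close>, or at or above \<open>b\<close>, it would
    be comparable with all of \<open>m\<close>, hence an element of \<open>m\<close> other than
    \<open>c\<close>, which is excluded.\<close>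
  have "{m' \<in> ?M. m - {c} \<subseteq> m'} = (\<lambda>z. insert z (m - {c})) ` ?Z"
  proof (intro equalityI subsetI)
    fix m' assume "m' \<in> {m' \<in> ?M. m - {c} \<subseteq> m'}"
    then have m': "m' \<in> ?M" "m - {c} \<subseteq> m'" by auto
    have fin: "finite m'" using maximal_chain_ends(3)[OF P m'(1)] .
    have "card (m - {c}) = card m - 1" "card m > 0" using c(1) me(3) by (auto simp: card_gt_0_iff)
    then have "card (m' - (m - {c})) = 1" using cm[OF m'(1)] m'(2) me(3) by (simp add: card_Diff_subset)
    then obtain z where z: "m' - (m - {c}) = {z}" by (auto simp: card_1_singleton_iff)
    then have mz: "m' = insert z (m - {c})" and zn: "z \<notin> m - {c}" using m'(2) by auto
    have zA: "z \<in> P" "y \<le> z" "z \<le> x" using z maximal_chainD(1)[OF m'(1)] by auto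
    have cmp: "u \<le> z \<or> z \<le> u" if "u \<in> m" "u \<noteq> c" for u
      using is_chainD[OF maximal_chainD(3)[OF m'(1)], of u z] that mz by blast
    have cmp_c: "z \<in> m" if "z \<le> c \<or> c \<le> z"
    proof (rule mD(5))
      show "z \<in> P \<inter> {y..x}" using zA by simp
      show "u \<le> z \<or> z \<le> u" if "u \<in> m" for u
        using cmp[OF that] \<open>z \<le> c \<or> c \<le> z\<close> by blast
    qed
    have "a < z"
    proof (rule ccontr)
      assume "\<not> a < z"
      moreover have "a \<le> z \<or> z \<le> a" using cmp[OF ab(1)] ab(3) by blast
      ultimately have "z \<le> a" by (auto simp: less_le)
      then have zc: "z < c" using ab(3) by (rule le_less_trans)
      then have "z \<in> m" using cmp_c less_imp_le by blast
      then show False using zn zc by blast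
    qed
    moreover have "z < b"
    proof (rule ccontr)
      assume "\<not> z < b"
      moreover have "b \<le> z \<or> z \<le> b" using cmp[OF ab(2)] ab(4) by blast
      ultimately have "b \<le> z" by (auto simp: less_le)
      with ab(4) have zc: "c < z" by (rule less_le_trans)
      then have "z \<in> m" using cmp_c less_imp_le by blast
      then show False using zn zc by blast
    qed
    ultimately show "m' \<in> (\<lambda>z. insert z (m - {c})) ` ?Z" using mz zA(1) by blast
  next
    fix C assume "C \<in> (\<lambda>z. insert z (m - {c})) ` ?Z"
    then obtain z where z: "z \<in> P" "a < z" "z < b" "C = insert z (m - {c})" by blast
    have "is_chain (m - {c})" by (rule chain_subset[OF mD(3)]) auto
    moreover have "u \<le> z \<or> z \<le> u" if "u \<in> m - {c}" for u using gap[of u] z that by auto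
    ultimately have ch: "is_chain C" unfolding z(4) by (rule is_chain_insert)
    have zn: "z \<notin> m - {c}" using gap[of z] z by auto
    have CA: "C \<subseteq> P \<inter> {y..x}" using z mD(1) ab by auto
    obtain m' where m': "m' \<in> ?M" "C \<subseteq> m'"
      using extend_to_maximal_chain[OF CA _ ch] z(4) by blast
    have "card (m - {c}) = card m - 1" "card m > 0" using c(1) me(3) by (auto simp: card_gt_0_iff)
    then have "card C = card m" using zn me(3) z(4) by simp
    then have "C = m'" using cm[OF m'(1)] m'(2) maximal_chain_ends(3)[OF P m'(1)] card_subset_eq by metis
    then show "C \<in> {m' \<in> ?M. m - {c} \<subseteq> m'}" using m'(1) z(4) by auto
  qed
  moreover have "inj_on (\<lambda>z. insert z (m - {c})) ?Z"
  proof (rule inj_onI)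
    fix z w assume h: "z \<in> ?Z" "w \<in> ?Z" "insert z (m - {c}) = insert w (m - {c})"
    have "u \<notin> m - {c}" if "u \<in> ?Z" for u using gap[of u] that by auto
    then have "z \<notin> m - {c}" "w \<notin> m - {c}" using h(1,2) by blast+
    then show "z = w" using h(3) by blast
  qed
  ultimately show ?thesis using Z2 by (simp add: card_image)
qed

end

lemma linear_order_finite_max:
  assumes r: "linear_order_on M r" and D: "finite D" "D \<noteq> {}" "D \<subseteq> M"
  shows "\<exists>F\<in>D. \<forall>G\<in>D. (G, F) \<in> r"
  using D
proof (induction D rule: finite_ne_induct)
  case (singleton F)
  then show ?case using r by (auto simp: order_on_defs refl_on_def)
next
  case (insert F D)
  then obtain E where E: "E \<in> D" "\<forall>G\<in>D. (G, E) \<in> r" by auto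
  have FE: "F \<in> M" "E \<in> M" using insert E by auto
  have rr: "(F, F) \<in> r" using r FE by (auto simp: order_on_defs refl_on_def)
  show ?case
  proof (cases "(F, E) \<in> r")
    case True
    then show ?thesis using E by auto
  next
    case False
    then have "(E, F) \<in> r" using r FE rr by (auto simp: order_on_defs total_on_def)
    then have "\<forall>G\<in>D. (G, F) \<in> r" using E(2) r unfolding order_on_defs trans_def by blast
    then show ?thesis using rr by blast
  qed
qed

text \<open>Induction over initial segments of the shelling order, splitting off the greatest chain.
  The common part \<open>E\<close>, later the two ends, is removed from all chains; the vertex
  \<open>x\<close> dropped by the shelling condition is not in \<open>E\<close>, since
  \<open>E\<close> lies in the comparison chain \<open>K\<close>.\<close>

lemma shellable_imp_shelling:
  fixes A :: "'a::order set"
  assumes sh: "shellable A" and fin: "finite (maximal_chains A)" and ne: "maximal_chains A \<noteq> {}"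
    and E: "\<And>m. m \<in> maximal_chains A \<Longrightarrow> E \<subseteq> m"
  shows "shelling ((\<lambda>m. m - E) ` maximal_chains A)"
proof -
  let ?M = "maximal_chains A"
  obtain r where r: "linear_order_on ?M r"
    and s: "\<And>mi mj. mi \<in> ?M \<Longrightarrow> mj \<in> ?M \<Longrightarrow> (mi, mj) \<in> r \<Longrightarrow> mi \<noteq> mj \<Longrightarrow>
           (\<exists>mk\<in>?M. (mk, mj) \<in> r \<and> mk \<noteq> mj \<and> (\<exists>x\<in>mj. mi \<inter> mj \<subseteq> mk \<inter> mj \<and> mk \<inter> mj = mj - {x}))"
    using sh unfolding shellable_def by blast
  have "shelling ((\<lambda>m. m - E) ` D)"
    if "D \<subseteq> ?M" "D \<noteq> {}" "\<And>F G. F \<in> D \<Longrightarrow> G \<in> ?M \<Longrightarrow> (G, F) \<in> r \<Longrightarrow> G \<in> D" for D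
    using that
  proof (induction "card D" arbitrary: D rule: less_induct)
    case less
    have fD: "finite D" using less.prems(1) fin by (rule finite_subset)
    obtain F where F: "F \<in> D" "\<And>G. G \<in> D \<Longrightarrow> (G, F) \<in> r"
      using linear_order_finite_max[OF r fD less.prems(2,1)] by blast
    have FM: "F \<in> ?M" using F less.prems(1) by blast
    show ?case
    proof (cases "D = {F}")
      case True
      then show ?thesis by (simp add: shelling.single)
    next
      case False
      let ?D = "D - {F}"
      have "card ?D < card D" using F(1) fD by (intro psubset_card_mono) auto
      moreover have "G \<in> ?D" if "H \<in> ?D" "G \<in> ?M" "(G, H) \<in> r" for H G
      proof -
        have "G \<in> D" using less.prems(3)[of H G] that by blast
        moreover have "G \<noteq> F"
        proof
          assume "G = F"
          then have "(F, H) \<in> r" "(H, F) \<in> r" using that F(2) by auto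
          then have "F = H" using r unfolding order_on_defs antisym_def by blast
          then show False using that(1) by blast
        qed
        ultimately show ?thesis by blast
      qed
      ultimately have IH: "shelling ((\<lambda>m. m - E) ` ?D)"
        using less.hyps[of ?D] less.prems(1) False F(1) by blast
      have "shelling (insert (F - E) ((\<lambda>m. m - E) ` ?D))"
      proof (rule shelling.step[OF IH])
        show "F - E \<notin> (\<lambda>m. m - E) ` ?D"
        proof
          assume "F - E \<in> (\<lambda>m. m - E) ` ?D"
          then obtain G where G: "G \<in> ?D" "F - E = G - E" by blast
          then have "F = G" using E[OF FM] E[of G] less.prems(1) by blast
          then show False using G(1) by blast
        qed
        fix G' assume "G' \<in> (\<lambda>m. m - E) ` ?D"
        then obtain G where G: "G \<in> D" "G \<noteq> F" "G' = G - E" by blast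
        have "G \<in> ?M" using G(1) less.prems(1) by blast
        from s[OF this FM F(2)[OF G(1)] G(2)]
        obtain K x where K: "K \<in> ?M" "(K, F) \<in> r" "K \<noteq> F" "x \<in> F" "G \<inter> F \<subseteq> K \<inter> F" "K \<inter> F = F - {x}" by blast
        have KD: "K \<in> ?D" using less.prems(3)[OF F(1) K(1,2)] K(3) by blast
        have xE: "x \<notin> E"
        proof
          assume "x \<in> E"
          then have "x \<in> K \<inter> F" using E[OF K(1)] K(4) by blast
          then show False using K(6) by blast
        qed
        show "\<exists>x\<in>F - E. \<exists>K\<in>(\<lambda>m. m - E) ` ?D. G' \<inter> (F - E) \<subseteq> F - E - {x} \<and> F - E - {x} \<subseteq> K"
        proof (intro bexI conjI)
          show "K - E \<in> (\<lambda>m. m - E) ` ?D" using KD by blast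
          show "x \<in> F - E" using K(4) xE by blast
          show "G' \<inter> (F - E) \<subseteq> F - E - {x}" using K(5,6) G(3) by blast
          show "F - E - {x} \<subseteq> K - E" using K(6) by blast
        qed
      qed
      moreover have "insert (F - E) ((\<lambda>m. m - E) ` ?D) = (\<lambda>m. m - E) ` D" using F(1) by blast
      ultimately show ?thesis by simp
    qed
  qed
  from this[OF order.refl ne] show ?thesis by blast
qed

context GT
begin

text \<open>The facets of the order complex of the open interval. If \<open>x\<close> covers
  \<open>y\<close>, the only one is the empty set, and the cone is a point.\<close>

definition facets :: "'a \<Rightarrow> 'a \<Rightarrow> 'a set set" where
  "facets y x = (\<lambda>m. m - {y, x}) ` maximal_chains (P \<inter> {y..x})"

lemma facets_chart:
  assumes P: "y \<in> P" "x \<in> P" "y < x" and sh: "shellable (P \<inter> {y..x})"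
  obtains n \<phi> \<psi> where "g x - g y - 1 = int n" "full_chart (facets y x) n \<phi> \<psi>"
proof -
  let ?A = "P \<inter> {y..x}" and ?M = "maximal_chains (P \<inter> {y..x})"
  have yx: "y \<le> x" using P by simp
  have fA: "finite ?A" by (rule finite_interval[OF P(1,2)])
  have "?M \<subseteq> Pow ?A" using maximal_chainD(1) by blast
  then have fM: "finite ?M" by (rule finite_subset) (use fA in \<open>simp only: finite_Pow_iff\<close>)
  note ends = maximal_chain_ends[OF P(1,2) yx]
  obtain m0 where m0: "m0 \<in> ?M"
    by (rule extend_to_maximal_chain[of "{y}" ?A]) (use P in \<open>auto intro: is_chainI\<close>)
  have c2: "card (m - {y, x}) = card m - 2" "2 \<le> card m" if m: "m \<in> ?M" for m
  proof -
    have "{y, x} \<subseteq> m" "card {y, x} = 2" using ends[OF m] P by auto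
    then show "card (m - {y, x}) = card m - 2" "2 \<le> card m"
      using ends(3)[OF m] card_mono[of m "{y, x}"] by (auto simp: card_Diff_subset)
  qed
  define n where "n = card (m0 - {y, x})"
  have n: "g x - g y - 1 = int n"
    using maximal_chain_card[OF P(1,2) yx m0] c2[OF m0] by (simp add: n_def of_nat_diff)
  have "shelling (facets y x)" unfolding facets_def
    using shellable_imp_shelling[OF sh fM, of "{y, x}"] m0 ends by auto
  moreover have "finite (facets y x)" unfolding facets_def using fM by simp
  moreover have "finite F" if "F \<in> facets y x" for F using that ends unfolding facets_def by auto
  moreover have "card F = n" if F: "F \<in> facets y x" for F
  proof -
    obtain m where m: "m \<in> ?M" "F = m - {y, x}" using F unfolding facets_def by blast
    then show ?thesis
      using c2[OF m(1)] c2[OF m0] maximal_chain_card[OF P(1,2) yx m(1)] maximal_chain_card[OF P(1,2) yx m0]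
      by (simp add: n_def)
  qed
  moreover have "card {K\<in>facets y x. F - {c} \<subseteq> K} = 2" if F: "F \<in> facets y x" "c \<in> F" for F c
  proof -
    obtain m where m: "m \<in> ?M" "F = m - {y, x}" using F unfolding facets_def by blast
    have c: "c \<in> m" "c \<noteq> x" "c \<noteq> y" using F(2) m(2) by auto
    have "{K\<in>facets y x. F - {c} \<subseteq> K} = (\<lambda>m. m - {y, x}) ` {m' \<in> ?M. m - {c} \<subseteq> m'}"
    proof (intro equalityI subsetI)
      fix K assume "K \<in> {K\<in>facets y x. F - {c} \<subseteq> K}"
      then obtain m' where m': "m' \<in> ?M" "K = m' - {y, x}" "F - {c} \<subseteq> K" unfolding facets_def by blast
      then have "m - {c} \<subseteq> m'" using m(2) ends(1,2)[OF m'(1)] by blast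
      then show "K \<in> (\<lambda>m. m - {y, x}) ` {m' \<in> ?M. m - {c} \<subseteq> m'}" using m' by blast
    qed (use m(2) in \<open>auto simp: facets_def\<close>)
    moreover have "inj_on (\<lambda>m. m - {y, x}) {m' \<in> ?M. m - {c} \<subseteq> m'}"
    proof (rule inj_onI)
      fix k l assume h: "k \<in> {m' \<in> ?M. m - {c} \<subseteq> m'}" "l \<in> {m' \<in> ?M. m - {c} \<subseteq> m'}" "k - {y, x} = l - {y, x}"
      have "{y, x} \<subseteq> k" "{y, x} \<subseteq> l" using h(1,2) ends by auto
      then have "k = (k - {y, x}) \<union> {y, x}" "l = (l - {y, x}) \<union> {y, x}" by blast+
      then show "k = l" using h(3) by simp
    qed
    ultimately show ?thesis using ridge_in_two_maximal_chains[OF P(1,2) yx m(1) c] by (simp add: card_image)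
  qed
  ultimately have "\<exists>\<phi> \<psi>. full_chart (facets y x) n \<phi> \<psi>" by (rule shellable_sphere_chart)
  then show ?thesis using that[OF n] by (elim exE)
qed

end

section \<open>Level functions\<close>

text \<open>A point of the order complex of a poset of chains is a convex combination of chains; replacing
  chains by their indicator functions identifies \<open>F_Mor P x y\<close> with a set of functions on \<open>P\<close>. In
  these coordinates composition is gluing of functions.\<close>

definition level :: "'a::order set \<Rightarrow> ('a set \<Rightarrow> real) \<Rightarrow> 'a \<Rightarrow> real" where
  "level A f v = (\<Sum>C\<in>barycentric_subdivision A. f C * (if v \<in> C then 1 else 0))"

definition chain_functions :: "'a::order set \<Rightarrow> ('a \<Rightarrow> real) set" where
  "chain_functions A = {h. (\<forall>v. 0 \<le> h v) \<and> {v. h v \<noteq> 0} \<subseteq> A \<and> is_chain {v. h v \<noteq> 0}}"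

definition mor_functions :: "'a::order set \<Rightarrow> 'a \<Rightarrow> 'a \<Rightarrow> ('a \<Rightarrow> real) set" where
  "mor_functions P x y = {h \<in> chain_functions (P \<inter> {y..x}). (\<forall>v. h v \<le> 1) \<and> h x = 1 \<and> h y = 1}"

text \<open>The layer-cake decomposition as an instance of \<open>flag_fan\<close>: strata are
  supports, their vectors are indicators, and the flag of a function consists of its superlevel
  sets.\<close>

lemma level_fan:
  fixes A :: "'a::order set"
  assumes "finite A"
  shows "flag_fan A (\<lambda>v h. h v) (chain_functions A) (\<lambda>\<sigma> v. if v \<in> \<sigma> then 1 else 0) (\<lambda>h. {v\<in>A. 0 < h v})"
proof (rule flag_fan.intro)
  fix h :: "'a \<Rightarrow> real"
  assume h: "h \<in> chain_functions A"
  have h0: "0 \<le> h v" "h v \<noteq> 0 \<Longrightarrow> v \<in> A" for v using h by (auto simp: chain_functions_def)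
  show "{v\<in>A. 0 < h v} = {} \<Longrightarrow> h = 0"
    using h0 by (auto simp: fun_eq_iff) (metis order_le_less)
  show "{v\<in>A. 0 < (if v \<in> {v\<in>A. 0 < h v} then 1 else 0 :: real)} = {v\<in>A. 0 < h v}" by auto
  fix t :: real assume t: "0 \<le> t"
    and le: "\<And>l. l \<in> {v\<in>A. 0 < h v} \<Longrightarrow> t * (if l \<in> {v\<in>A. 0 < h v} then 1 else 0) \<le> h l"
  let ?k = "h - t *\<^sub>R (\<lambda>v. if v \<in> {v\<in>A. 0 < h v} then 1 else 0)"
  have k: "?k v = (if v \<in> A \<and> 0 < h v then h v - t else h v)" for v by (simp add: scaleR_fun_def)
  have "0 \<le> ?k v" for v using le[of v] h0(1)[of v] unfolding k by auto
  moreover have "{v. ?k v \<noteq> 0} \<subseteq> {v. h v \<noteq> 0}" unfolding k by auto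
  moreover have "is_chain {v. h v \<noteq> 0}" "{v. h v \<noteq> 0} \<subseteq> A" using h by (auto simp: chain_functions_def)
  ultimately have "?k \<in> chain_functions A" unfolding chain_functions_def using chain_subset by blast
  moreover have "{v\<in>A. 0 < ?k v} \<subseteq> {v\<in>A. 0 < h v}" unfolding k by auto
  ultimately show "?k \<in> chain_functions A \<and> {v\<in>A. 0 < ?k v} \<subseteq> {v\<in>A. 0 < h v}" by blast
qed (use assms linear_coordinate in auto)

lemma level_types:
  fixes A :: "'a::order set"
  assumes "finite A"
  shows "flag_fan.types (chain_functions A) (\<lambda>h. {v\<in>A. 0 < h v}) = barycentric_subdivision A"
proof -
  interpret flag_fan A "\<lambda>v h. h v" "chain_functions A" "\<lambda>\<sigma> v. if v \<in> \<sigma> then 1 else 0" "\<lambda>h. {v\<in>A. 0 < h v}"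
    by (rule level_fan[OF assms])
  show ?thesis
    unfolding types_def
  proof (intro equalityI subsetI)
    fix \<sigma> assume "\<sigma> \<in> (\<lambda>h. {v\<in>A. 0 < h v}) ` (chain_functions A - {0})"
    then obtain h where h: "h \<in> chain_functions A" "h \<noteq> 0" "\<sigma> = {v\<in>A. 0 < h v}" by blast
    have "\<sigma> \<noteq> {}" using ty_empty[OF h(1)] h(2,3) by blast
    moreover have "\<sigma> \<subseteq> {v. h v \<noteq> 0}" using h(3) by auto
    then have "is_chain \<sigma>" using h(1) chain_subset unfolding chain_functions_def by blast
    ultimately show "\<sigma> \<in> barycentric_subdivision A" using h(3) by (auto simp: barycentric_subdivision_def)
  next
    fix C assume C: "C \<in> barycentric_subdivision A"
    let ?h = "\<lambda>v. if v \<in> C then 1 else 0 :: real"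
    have s: "{v. ?h v \<noteq> 0} = C" by auto
    have "?h \<in> chain_functions A" using C unfolding chain_functions_def s by (auto simp: barycentric_subdivision_def)
    moreover have "?h \<noteq> 0" using C by (auto simp: barycentric_subdivision_def fun_eq_iff)
    moreover have "C = {v\<in>A. 0 < ?h v}" using C by (auto simp: barycentric_subdivision_def)
    ultimately show "C \<in> (\<lambda>h. {v\<in>A. 0 < h v}) ` (chain_functions A - {0})"
      by (intro image_eqI[of _ _ ?h]) simp_all
  qed
qed

lemma linear_level: "linear (level A)"
  by (rule linearI) (auto simp: level_def fun_eq_iff scaleR_fun_def algebra_simps sum.distrib sum_distrib_left)

lemma finite_barycentric_subdivision: "finite A \<Longrightarrow> finite (barycentric_subdivision A)"
  unfolding barycentric_subdivision_def by (rule finite_subset[of _ "Pow A"]) auto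

lemma finite_end_chains: "finite (P \<inter> {y..x}) \<Longrightarrow> finite (end_chains P y x)"
  unfolding end_chains_def by (simp add: finite_barycentric_subdivision)

lemma end_chains_iff:
  "C \<in> end_chains P y x \<longleftrightarrow> C \<subseteq> P \<inter> {y..x} \<and> is_chain C \<and> y \<in> C \<and> x \<in> C"
  unfolding end_chains_def barycentric_subdivision_def by auto

lemma F_Mor_empty: assumes "\<not> y \<le> x" shows "F_Mor P x y = {}"
proof -
  have "end_chains P y x = {}" using assms by (auto simp: end_chains_iff)
  then show ?thesis unfolding F_Mor_def using order_space_iff[of "{}"] by auto
qed

lemma level_end_chains:
  assumes "finite (P \<inter> {y..x})" "f \<in> F_Mor P x y"
  shows "level (P \<inter> {y..x}) f v = (\<Sum>C\<in>end_chains P y x. f C * (if v \<in> C then 1 else 0))"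
proof -
  have fb: "finite (barycentric_subdivision (P \<inter> {y..x}))"
    by (rule finite_barycentric_subdivision[OF assms(1)])
  have "{C. f C \<noteq> 0} \<subseteq> end_chains P y x"
    using assms order_space_iff[OF finite_end_chains] unfolding F_Mor_def by blast
  then show ?thesis unfolding level_def
    by (intro sum.mono_neutral_right fb) (auto simp: end_chains_def)
qed

text \<open>An element of the smallest chain of a flag lies in all its chains, so the bound 1 on the
  values bounds the total weight. The value 1 at both ends then forces every chain to contain both
  ends and the total weight to be 1.\<close>

lemma level_bij:
  fixes P :: "'a::order set"
  assumes P: "x \<in> P" "y \<in> P" "y \<le> x" and fin: "finite (P \<inter> {y..x})"
  shows "bij_betw (level (P \<inter> {y..x})) (F_Mor P x y) (mor_functions P x y)"
proof -
  let ?A = "P \<inter> {y..x}" and ?E = "end_chains P y x"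
  interpret flag_fan ?A "\<lambda>v h. h v" "chain_functions ?A" "\<lambda>\<sigma> v. if v \<in> \<sigma> then 1 else 0" "\<lambda>h. {v\<in>?A. 0 < h v}"
    by (rule level_fan[OF fin])
  have ty: "types = barycentric_subdivision ?A" by (rule level_types[OF fin])
  have lv: "comb f = level ?A f" for f
    unfolding comb_def ty level_def by (auto simp: fun_eq_iff sum_fun_apply scaleR_fun_def)
  have FM: "f \<in> F_Mor P x y \<longleftrightarrow> (\<forall>C. 0 \<le> f C) \<and> {C. f C \<noteq> 0} \<subseteq> ?E \<and> is_chain {C. f C \<noteq> 0} \<and> sum f ?E = 1" for f
    unfolding F_Mor_def by (rule order_space_iff[OF finite_end_chains[OF fin]])
  have EB: "?E \<subseteq> barycentric_subdivision ?A" by (auto simp: end_chains_def)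
  have fl: "f \<in> flags" if "f \<in> F_Mor P x y" for f
    using that EB unfolding FM flags_def ty by blast
  have into: "level ?A f \<in> mor_functions P x y" if f: "f \<in> F_Mor P x y" for f
  proof -
    have fD: "\<And>C. 0 \<le> f C" "{C. f C \<noteq> 0} \<subseteq> ?E" "sum f ?E = 1" using f unfolding FM by auto
    note l = level_end_chains[OF fin f]
    have l0: "0 \<le> level ?A f v" for v unfolding l using fD(1) by (intro sum_nonneg) auto
    have "level ?A f v \<le> sum f ?E" for v unfolding l using fD(1) by (intro sum_mono) auto
    moreover have "level ?A f v = sum f ?E" if "v = x \<or> v = y" for v
      unfolding l using that by (intro sum.cong) (auto simp: end_chains_iff)
    moreover have "level ?A f \<in> chain_functions ?A"
    proof -
      have "{v. level ?A f v \<noteq> 0} \<subseteq> \<Union>{C. f C \<noteq> 0}"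
      proof (rule ccontr)
        assume "\<not> ?thesis"
        then obtain v where v: "level ?A f v \<noteq> 0" "\<And>C. f C \<noteq> 0 \<Longrightarrow> v \<notin> C" by blast
        have "level ?A f v = 0" unfolding l using v(2) by (intro sum.neutral) auto
        then show False using v(1) by simp
      qed
      moreover have "\<Union>{C. f C \<noteq> 0} \<in> ?E"
      proof -
        have "\<Union>{C. f C \<noteq> 0} \<in> {C. f C \<noteq> 0}"
        proof (rule Union_chain_in)
          show "finite {C. f C \<noteq> 0}" using fD(2) finite_end_chains[OF fin] by (rule finite_subset)
          show "is_chain {C. f C \<noteq> 0}" using f unfolding FM by blast
          show "{C. f C \<noteq> 0} \<noteq> {}" using fD(3) by (metis (mono_tags, lifting) empty_Collect_eq sum.neutral zero_neq_one)
        qed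
        then show ?thesis using fD(2) by blast
      qed
      ultimately show ?thesis unfolding chain_functions_def using l0 chain_subset
        by (auto simp: end_chains_iff)
    qed
    ultimately show ?thesis using fD(3) by (simp add: mor_functions_def)
  qed
  have surj: "\<exists>f\<in>F_Mor P x y. level ?A f = h" if h: "h \<in> mor_functions P x y" for h
  proof -
    have hD: "h \<in> chain_functions ?A" "\<And>v. h v \<le> 1" "h x = 1" "h y = 1" using h by (auto simp: mor_functions_def)
    obtain t where t: "t \<in> flags" "comb t = h" using comb_surj[OF hD(1)] by blast
    note tD = flagsD[OF t(1)]
    have hv: "h v = (\<Sum>C\<in>types. t C * (if v \<in> C then 1 else 0))" for v
      unfolding t(2)[symmetric] lv level_def ty ..
    have ne: "{C. t C \<noteq> 0} \<noteq> {}"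
    proof
      assume "{C. t C \<noteq> 0} = {}"
      then have "h x = 0" unfolding hv by (intro sum.neutral) auto
      then show False using hD(3) by simp
    qed
    obtain C0 where C0: "C0 \<in> {C. t C \<noteq> 0}" "\<And>C. C \<in> {C. t C \<noteq> 0} \<Longrightarrow> C0 \<subseteq> C"
      by (rule finite_chain_min[OF tD(4) ne tD(3)]) (rule that)
    have "C0 \<noteq> {}" using C0(1) tD(2) types_nonempty by blast
    then obtain v0 where v0: "v0 \<in> C0" by blast
    have "h v0 = sum t types" unfolding hv
    proof (rule sum.cong[OF refl])
      fix C assume "C \<in> types"
      show "t C * (if v0 \<in> C then 1 else 0) = t C" using C0(2)[of C] v0 by (cases "t C = 0") auto
    qed
    then have tot: "sum t types \<le> 1" using hD(2)[of v0] by simp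
    have all: "v \<in> C" if v: "h v = 1" and C: "t C \<noteq> 0" for v C
    proof (rule ccontr)
      assume n: "v \<notin> C"
      have Ct: "C \<in> types" using C tD(2) by blast
      have "h v < sum t types" unfolding hv
      proof (rule sum_strict_mono_ex1[OF finite_types])
        show "\<forall>D\<in>types. t D * (if v \<in> D then 1 else 0) \<le> t D" using tD(1) by auto
        show "\<exists>D\<in>types. t D * (if v \<in> D then 1 else 0) < t D"
          using Ct n C tD(1)[of C] by (intro bexI[of _ C]) auto
      qed
      then show False using v tot by simp
    qed
    have sE: "{C. t C \<noteq> 0} \<subseteq> ?E"
    proof
      fix C assume C: "C \<in> {C. t C \<noteq> 0}"
      then have "C \<in> barycentric_subdivision ?A" using tD(2) ty by blast
      moreover have "x \<in> C" "y \<in> C" using all hD(3,4) C by auto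
      ultimately show "C \<in> ?E" by (auto simp: end_chains_def)
    qed
    have "h x = sum t ?E"
    proof -
      have "h x = (\<Sum>C\<in>?E. t C * (if x \<in> C then 1 else 0))" unfolding hv
        using sE EB finite_types unfolding ty by (intro sum.mono_neutral_right) auto
      also have "\<dots> = sum t ?E" by (intro sum.cong) (auto simp: end_chains_iff)
      finally show ?thesis .
    qed
    then have "t \<in> F_Mor P x y" unfolding FM using tD(1,3) sE hD(3) by auto
    then show ?thesis using t(2) lv by auto
  qed
  have "inj_on (level ?A) (F_Mor P x y)"
  proof (rule inj_onI)
    fix f k assume "f \<in> F_Mor P x y" "k \<in> F_Mor P x y" "level ?A f = level ?A k"
    then show "f = k" using comb_inj[OF fl fl, of f k] lv by simp
  qed
  moreover have "level ?A ` F_Mor P x y = mor_functions P x y"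
  proof (intro equalityI subsetI)
    fix h assume "h \<in> mor_functions P x y"
    then obtain f where "f \<in> F_Mor P x y" "level ?A f = h" using surj by blast
    then show "h \<in> level ?A ` F_Mor P x y" by blast
  qed (use into in blast)
  ultimately show ?thesis by (simp add: bij_betw_def)
qed

section \<open>Realization of monotone maps\<close>

lemma realize_map_sum:
  assumes "finite A" "{v. f v \<noteq> 0} \<subseteq> A"
  shows "realize_map \<phi> f w = (\<Sum>v\<in>{v\<in>A. \<phi> v = w}. f v)"
  unfolding realize_map_def using assms by (intro sum.mono_neutral_left) auto

text \<open>Change of variables: \<open>realize_map\<close> is the push-forward of weights along
  \<open>\<phi>\<close>. With \<open>G\<close> the indicator of the chains through an element, it
  computes levels.\<close>

lemma sum_realize_map:
  assumes "finite A" "{v. f v \<noteq> 0} \<subseteq> A" "finite B" "\<phi> ` A \<subseteq> B"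
  shows "(\<Sum>w\<in>B. realize_map \<phi> f w * G w) = (\<Sum>v\<in>A. f v * G (\<phi> v))"
proof -
  have "(\<Sum>w\<in>B. realize_map \<phi> f w * G w) = (\<Sum>w\<in>B. \<Sum>v\<in>{v\<in>A. \<phi> v = w}. f v * G (\<phi> v))"
    unfolding realize_map_sum[OF assms(1,2)] sum_distrib_right by (intro sum.cong refl) auto
  also have "\<dots> = (\<Sum>v\<in>A. f v * G (\<phi> v))" using assms(1,3,4) by (rule sum.group)
  finally show ?thesis .
qed

lemma realize_map_order_space:
  assumes A: "finite A" and B: "finite B" and \<phi>: "\<phi> ` A \<subseteq> B"
    and mono: "\<And>u v. u \<in> A \<Longrightarrow> v \<in> A \<Longrightarrow> u \<le> v \<Longrightarrow> \<phi> u \<le> \<phi> v" and f: "f \<in> order_space A"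
  shows "realize_map \<phi> f \<in> order_space B"
proof -
  have fD: "\<And>v. 0 \<le> f v" "{v. f v \<noteq> 0} \<subseteq> A" "is_chain {v. f v \<noteq> 0}" "sum f A = 1"
    using f order_space_iff[OF A] by auto
  note r = realize_map_sum[OF A fD(2)]
  have sub: "{w. realize_map \<phi> f w \<noteq> 0} \<subseteq> \<phi> ` {v. f v \<noteq> 0}"
  proof
    fix w assume "w \<in> {w. realize_map \<phi> f w \<noteq> 0}"
    then have "(\<Sum>v\<in>{v\<in>A. \<phi> v = w}. f v) \<noteq> 0" unfolding r by simp
    then obtain v where "v \<in> {v\<in>A. \<phi> v = w}" "f v \<noteq> 0" by (meson sum.neutral)
    then show "w \<in> \<phi> ` {v. f v \<noteq> 0}" by blast
  qed
  have "is_chain (\<phi> ` {v. f v \<noteq> 0})"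
  proof (rule is_chainI)
    fix u' v' assume "u' \<in> \<phi> ` {v. f v \<noteq> 0}" "v' \<in> \<phi> ` {v. f v \<noteq> 0}"
    then obtain u v where "u \<in> {v. f v \<noteq> 0}" "u' = \<phi> u" "v \<in> {v. f v \<noteq> 0}" "v' = \<phi> v" by blast
    then show "u' \<le> v' \<or> v' \<le> u'" using is_chainD[OF fD(3), of u v] fD(2) mono by blast
  qed
  then have "is_chain {w. realize_map \<phi> f w \<noteq> 0}" using sub by (rule chain_subset)
  moreover have "0 \<le> realize_map \<phi> f w" for w unfolding r using fD(1) by (intro sum_nonneg)
  moreover have "{w. realize_map \<phi> f w \<noteq> 0} \<subseteq> B" using sub fD(2) \<phi> by blast
  moreover have "sum (realize_map \<phi> f) B = 1"
    using sum_realize_map[OF A fD(2) B \<phi>, of "\<lambda>_. 1"] fD(4) by simp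
  ultimately show ?thesis using order_space_iff[OF B] by blast
qed

section \<open>Composition\<close>

text \<open>For the functions to be glued, both are 1 at \<open>y\<close>, so the overlap is
  harmless; at elements incomparable with \<open>y\<close> the second branch gives 0.\<close>

definition glue :: "'a::order \<Rightarrow> ('a \<Rightarrow> real) \<Rightarrow> ('a \<Rightarrow> real) \<Rightarrow> 'a \<Rightarrow> real" where
  "glue y h k v = (if y \<le> v then h v else k v)"

context GT
begin

abbreviation lev :: "'a \<Rightarrow> 'a \<Rightarrow> ('a set \<Rightarrow> real) \<Rightarrow> 'a \<Rightarrow> real" where
  "lev x y \<equiv> level (P \<inter> {y..x})"

lemma lev_bij: "x \<in> P \<Longrightarrow> y \<in> P \<Longrightarrow> y \<le> x \<Longrightarrow> bij_betw (lev x y) (F_Mor P x y) (mor_functions P x y)"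
  by (intro level_bij finite_interval)

lemma F_Mor_le: "f \<in> F_Mor P x y \<Longrightarrow> y \<le> x"
  using F_Mor_empty by blast

lemma lev_in: "x \<in> P \<Longrightarrow> y \<in> P \<Longrightarrow> f \<in> F_Mor P x y \<Longrightarrow> lev x y f \<in> mor_functions P x y"
  using bij_betwE[OF lev_bij] F_Mor_le by blast

lemma lev_inj: "x \<in> P \<Longrightarrow> y \<in> P \<Longrightarrow> f \<in> F_Mor P x y \<Longrightarrow> k \<in> F_Mor P x y \<Longrightarrow> lev x y f = lev x y k \<Longrightarrow> f = k"
  using inj_onD[OF bij_betw_imp_inj_on[OF lev_bij]] F_Mor_le by blast

lemma lev_surj:
  assumes "x \<in> P" "y \<in> P" "y \<le> x" "h \<in> mor_functions P x y"
  obtains f where "f \<in> F_Mor P x y" "lev x y f = h"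
proof -
  have "h \<in> lev x y ` F_Mor P x y" using lev_bij[OF assms(1-3)] assms(4) by (simp add: bij_betw_def)
  then show ?thesis using that by blast
qed

lemma mor_functionsD:
  assumes "h \<in> mor_functions P x y"
  shows "0 \<le> h v" "h v \<le> 1" "h x = 1" "h y = 1" "h v \<noteq> 0 \<Longrightarrow> v \<in> P" "h v \<noteq> 0 \<Longrightarrow> y \<le> v" "h v \<noteq> 0 \<Longrightarrow> v \<le> x"
    "h u \<noteq> 0 \<Longrightarrow> h v \<noteq> 0 \<Longrightarrow> u \<le> v \<or> v \<le> u"
  using assms is_chainD[of "{v. h v \<noteq> 0}" u v] unfolding mor_functions_def chain_functions_def by auto

lemma mor_functionsI:
  assumes "\<And>v. 0 \<le> h v" "\<And>v. h v \<le> 1" "h x = 1" "h y = 1" "\<And>v. h v \<noteq> 0 \<Longrightarrow> v \<in> P \<and> y \<le> v \<and> v \<le> x"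
    "\<And>u v. h u \<noteq> 0 \<Longrightarrow> h v \<noteq> 0 \<Longrightarrow> u \<le> v \<or> v \<le> u"
  shows "h \<in> mor_functions P x y"
proof -
  have "is_chain {v. h v \<noteq> 0}" by (rule is_chainI) (use assms(6) in blast)
  then show ?thesis using assms(1-5) unfolding mor_functions_def chain_functions_def by auto
qed

lemma glue_mor_functions:
  assumes h: "h \<in> mor_functions P x y" and k: "k \<in> mor_functions P y z" and zyx: "z \<le> y" "y \<le> x"
  shows "glue y h k \<in> mor_functions P x z"
proof (rule mor_functionsI)
  note hD = mor_functionsD[OF h] and kD = mor_functionsD[OF k]
  show "0 \<le> glue y h k v" "glue y h k v \<le> 1" for v using hD kD by (simp_all add: glue_def)
  show "glue y h k x = 1" using hD(3) zyx by (simp add: glue_def)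
  show "glue y h k z = 1" using hD(4) kD(4) zyx by (auto simp: glue_def dest: antisym)
  show "v \<in> P \<and> z \<le> v \<and> v \<le> x" if "glue y h k v \<noteq> 0" for v
    using that hD(5-7)[of v] kD(5-7)[of v] zyx by (auto simp: glue_def split: if_splits intro: order.trans)
  show "u \<le> v \<or> v \<le> u" if "glue y h k u \<noteq> 0" "glue y h k v \<noteq> 0" for u v
    using that hD(8)[of u v] kD(8)[of u v] kD(7)[of u] kD(7)[of v]
    by (auto simp: glue_def split: if_splits intro: order.trans)
qed

text \<open>Surjectivity of the projections of the product complex, which gives the inverse in
  \<open>product_iso\<close> its meaning. The preimage comes from the glued level function:
  decompose it into chains, cut each chain at \<open>y\<close>, and push the weights forward to
  pairs. Comparing levels identifies the marginals.\<close>

lemma product_marginals: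
  assumes P: "x \<in> P" "y \<in> P" "z \<in> P" and f: "f \<in> F_Mor P x y" and k: "k \<in> F_Mor P y z"
  shows "\<exists>r\<in>order_space (end_chains P y x \<times> end_chains P z y). realize_map fst r = f \<and> realize_map snd r = k"
proof -
  note le = F_Mor_le[OF f] F_Mor_le[OF k]
  have zx: "z \<le> x" using le by auto
  let ?E = "end_chains P z x" and ?A = "end_chains P y x" and ?B = "end_chains P z y"
  let ?E' = "{C\<in>?E. y \<in> C}"
  have fin: "finite ?E" "finite ?A" "finite ?B" by (intro finite_end_chains finite_interval P)+
  have fE': "finite ?E'" using fin(1) by simp
  let ?w = "glue y (lev x y f) (lev y z k)"
  note hD = mor_functionsD[OF lev_in[OF P(1,2) f]] and kD = mor_functionsD[OF lev_in[OF P(2,3) k]]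
  have "?w \<in> mor_functions P x z" by (rule glue_mor_functions[OF lev_in[OF P(1,2) f] lev_in[OF P(2,3) k] le(2,1)])
  then obtain e where e: "e \<in> F_Mor P x z" "lev x z e = ?w" using lev_surj[OF P(1,3) zx] by blast
  have eD: "\<And>C. 0 \<le> e C" "{C. e C \<noteq> 0} \<subseteq> ?E" "is_chain {C. e C \<noteq> 0}" "sum e ?E = 1"
    using e(1) order_space_iff[OF fin(1)] unfolding F_Mor_def by auto
  have lv: "?w v = (\<Sum>C\<in>?E. e C * (if v \<in> C then 1 else 0))" for v
    using level_end_chains[OF finite_interval[OF P(3,1)] e(1), of v] e(2) by simp
  have wy: "?w y = 1" using hD(4) by (simp add: glue_def)
  \<comment> \<open>The total weight and the glued level at \<open>y\<close> are both 1, so every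
    chain that occurs passes through \<open>y\<close> and can be cut there.\<close>
  have yC: "y \<in> C" if "e C \<noteq> 0" for C
  proof (rule ccontr)
    assume n: "y \<notin> C"
    have "C \<in> ?E" using that eD(2) by blast
    have "?w y < sum e ?E" unfolding lv
    proof (rule sum_strict_mono_ex1[OF fin(1)])
      show "\<forall>D\<in>?E. e D * (if y \<in> D then 1 else 0) \<le> e D" using eD(1) by auto
      show "\<exists>D\<in>?E. e D * (if y \<in> D then 1 else 0) < e D"
        using \<open>C \<in> ?E\<close> n that eD(1)[of C] by (intro bexI[of _ C]) auto
    qed
    then show False using wy eD(4) by simp
  qed
  have sE': "{C. e C \<noteq> 0} \<subseteq> ?E'" using eD(2) yC by blast
  have se: "(\<Sum>C\<in>?E'. e C * G C) = (\<Sum>C\<in>?E. e C * G C)" for G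
    using sE' fin(1) by (intro sum.mono_neutral_left) auto
  have eE': "e \<in> order_space ?E'"
    using order_space_iff[OF fE'] eD(1,3,4) sE' se[of "\<lambda>_. 1"] by simp
  let ?\<phi> = "\<lambda>C. (C \<inter> {y..}, C \<inter> {..y})"
  have im: "?\<phi> ` ?E' \<subseteq> ?A \<times> ?B"
  proof
    fix p assume "p \<in> ?\<phi> ` ?E'"
    then obtain C where C: "C \<subseteq> P \<inter> {z..x}" "is_chain C" "z \<in> C" "x \<in> C" "y \<in> C" "p = ?\<phi> C"
      by (auto simp only: end_chains_iff)
    have "C \<inter> {y..} \<in> ?A" unfolding end_chains_iff
    proof (intro conjI)
      show "is_chain (C \<inter> {y..})" by (rule chain_subset[OF C(2)]) simp
      show "C \<inter> {y..} \<subseteq> P \<inter> {y..x}"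
      proof
        fix u assume "u \<in> C \<inter> {y..}"
        then show "u \<in> P \<inter> {y..x}" using subsetD[OF C(1), of u] by auto
      qed
    qed (use C le in auto)
    moreover have "C \<inter> {..y} \<in> ?B" unfolding end_chains_iff
    proof (intro conjI)
      show "is_chain (C \<inter> {..y})" by (rule chain_subset[OF C(2)]) simp
      show "C \<inter> {..y} \<subseteq> P \<inter> {z..y}"
      proof
        fix u assume "u \<in> C \<inter> {..y}"
        then show "u \<in> P \<inter> {z..y}" using subsetD[OF C(1), of u] by auto
      qed
    qed (use C le in auto)
    ultimately show "p \<in> ?A \<times> ?B" using C(6) by simp
  qed
  let ?r = "realize_map ?\<phi> e"
  have r: "?r \<in> order_space (?A \<times> ?B)"
    by (rule realize_map_order_space[OF fE' _ im _ eE']) (use fin in \<open>auto simp: less_eq_prod_def\<close>)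
  have fAB: "finite (?A \<times> ?B)" using fin by simp
  have rs: "{p. ?r p \<noteq> 0} \<subseteq> ?A \<times> ?B" using r order_space_iff[OF fAB] by blast
  have rG: "(\<Sum>p\<in>?A \<times> ?B. ?r p * G p) = (\<Sum>C\<in>?E. e C * G (?\<phi> C))" for G
    using sum_realize_map[OF fE' sE' fAB im, of G] se[of "\<lambda>C. G (?\<phi> C)"] by simp
  have 1: "realize_map fst ?r \<in> F_Mor P x y" unfolding F_Mor_def
    by (rule realize_map_order_space[OF fAB fin(2) _ _ r]) (auto simp: less_eq_prod_def)
  have 2: "realize_map snd ?r \<in> F_Mor P y z" unfolding F_Mor_def
    by (rule realize_map_order_space[OF fAB fin(3) _ _ r]) (auto simp: less_eq_prod_def)
  have "lev x y (realize_map fst ?r) v = lev x y f v" for v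
  proof -
    have "lev x y (realize_map fst ?r) v = (\<Sum>C\<in>?A. realize_map fst ?r C * (if v \<in> C then 1 else 0))"
      by (rule level_end_chains[OF finite_interval[OF P(2,1)] 1])
    also have "\<dots> = (\<Sum>p\<in>?A \<times> ?B. ?r p * (if v \<in> fst p then 1 else 0))"
      by (rule sum_realize_map[OF fAB rs fin(2)]) auto
    also have "\<dots> = (\<Sum>C\<in>?E. e C * (if v \<in> C \<inter> {y..} then 1 else 0))" unfolding rG by simp
    also have "\<dots> = (if y \<le> v then ?w v else 0)" unfolding lv by (auto intro!: sum.neutral)
    also have "\<dots> = lev x y f v" using hD(6)[of v] by (auto simp: glue_def)
    finally show ?thesis .
  qed
  then have "realize_map fst ?r = f" using lev_inj[OF P(1,2) 1 f] by blast
  moreover have "lev y z (realize_map snd ?r) v = lev y z k v" for v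
  proof -
    have "lev y z (realize_map snd ?r) v = (\<Sum>C\<in>?B. realize_map snd ?r C * (if v \<in> C then 1 else 0))"
      by (rule level_end_chains[OF finite_interval[OF P(3,2)] 2])
    also have "\<dots> = (\<Sum>p\<in>?A \<times> ?B. ?r p * (if v \<in> snd p then 1 else 0))"
      by (rule sum_realize_map[OF fAB rs fin(3)]) auto
    also have "\<dots> = (\<Sum>C\<in>?E. e C * (if v \<in> C \<inter> {..y} then 1 else 0))" unfolding rG by simp
    also have "\<dots> = (if v \<le> y then ?w v else 0)" unfolding lv by (auto intro!: sum.neutral)
    also have "\<dots> = lev y z k v" using kD(7)[of v] kD(3) hD(4) by (auto simp: glue_def dest: antisym)
    finally show ?thesis .
  qed
  then have "realize_map snd ?r = k" using lev_inj[OF P(2,3) 2 k] by blast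
  ultimately show ?thesis using r by blast
qed

text \<open>In the union of a pair of chains, membership is decided by the first chain at or above
  \<open>y\<close> and by the second elsewhere. So the level of the composite depends on
  \<open>r\<close> through its two marginals, which are known.\<close>

lemma F_comp_level:
  assumes P: "x \<in> P" "y \<in> P" "z \<in> P" and f: "f \<in> F_Mor P x y" and k: "k \<in> F_Mor P y z"
  shows "F_comp P x y z (f, k) \<in> F_Mor P x z" "lev x z (F_comp P x y z (f, k)) = glue y (lev x y f) (lev y z k)"
proof -
  note le = F_Mor_le[OF f] F_Mor_le[OF k]
  let ?E = "end_chains P z x" and ?A = "end_chains P y x" and ?B = "end_chains P z y"
  have fin: "finite ?E" "finite ?A" "finite ?B" by (intro finite_end_chains finite_interval P)+
  have fAB: "finite (?A \<times> ?B)" using fin by simp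
  define r where "r = product_iso ?A ?B (f, k)"
  have "(f, k) \<in> (\<lambda>f. (realize_map fst f, realize_map snd f)) ` order_space (?A \<times> ?B)"
    using product_marginals[OF P f k] by force
  then have r: "r \<in> order_space (?A \<times> ?B)" and rm: "(realize_map fst r, realize_map snd r) = (f, k)"
    unfolding r_def product_iso_def
    by (rule inv_into_into, rule f_inv_into_f[where f = "\<lambda>f. (realize_map fst f, realize_map snd f)"])
  have rs: "{p. r p \<noteq> 0} \<subseteq> ?A \<times> ?B" using r order_space_iff[OF fAB] by blast
  have F: "F_comp P x y z (f, k) = realize_map (\<lambda>(C, D). C \<union> D) r" by (simp add: F_comp_def r_def)
  have un: "C \<union> D \<in> ?E" if "C \<in> ?A" "D \<in> ?B" for C D
    unfolding end_chains_iff
  proof (intro conjI)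
    have CD: "C \<subseteq> P \<inter> {y..x}" "is_chain C" "D \<subseteq> P \<inter> {z..y}" "is_chain D" "z \<in> D" "x \<in> C"
      using that by (auto simp: end_chains_iff)
    show "C \<union> D \<subseteq> P \<inter> {z..x}"
    proof
      fix u assume "u \<in> C \<union> D"
      then show "u \<in> P \<inter> {z..x}" using subsetD[OF CD(1), of u] subsetD[OF CD(3), of u] le by (auto intro: order.trans)
    qed
    show "is_chain (C \<union> D)"
    proof (rule is_chainI)
      fix u v assume "u \<in> C \<union> D" "v \<in> C \<union> D"
      then show "u \<le> v \<or> v \<le> u"
        using is_chainD[OF CD(2), of u v] is_chainD[OF CD(4), of u v] subsetD[OF CD(1), of u] subsetD[OF CD(3), of u]
          subsetD[OF CD(1), of v] subsetD[OF CD(3), of v] by (auto intro: order.trans)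
    qed
    show "z \<in> C \<union> D" "x \<in> C \<union> D" using CD by auto
  qed
  have im: "(\<lambda>(C, D). C \<union> D) ` (?A \<times> ?B) \<subseteq> ?E" using un by auto
  show 1: "F_comp P x y z (f, k) \<in> F_Mor P x z"
    unfolding F F_Mor_def
    by (rule realize_map_order_space[OF fAB fin(1) im _ r]) (auto simp: less_eq_prod_def)
  show "lev x z (F_comp P x y z (f, k)) = glue y (lev x y f) (lev y z k)"
  proof
    fix v
    have "lev x z (F_comp P x y z (f, k)) v = (\<Sum>C\<in>?E. F_comp P x y z (f, k) C * (if v \<in> C then 1 else 0))"
      by (rule level_end_chains[OF finite_interval[OF P(3,1)] 1])
    also have "\<dots> = (\<Sum>p\<in>?A \<times> ?B. r p * (if v \<in> (\<lambda>(C, D). C \<union> D) p then 1 else 0))"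
      unfolding F by (rule sum_realize_map[OF fAB rs fin(1) im])
    finally have l: "lev x z (F_comp P x y z (f, k)) v = \<dots>" .
    have "lev x y f v = (\<Sum>C\<in>?A. realize_map fst r C * (if v \<in> C then 1 else 0))"
      using level_end_chains[OF finite_interval[OF P(2,1)] f] rm by simp
    also have "\<dots> = (\<Sum>p\<in>?A \<times> ?B. r p * (if v \<in> fst p then 1 else 0))"
      by (rule sum_realize_map[OF fAB rs fin(2)]) auto
    finally have lf: "lev x y f v = \<dots>" .
    have "lev y z k v = (\<Sum>C\<in>?B. realize_map snd r C * (if v \<in> C then 1 else 0))"
      using level_end_chains[OF finite_interval[OF P(3,2)] k] rm by simp
    also have "\<dots> = (\<Sum>p\<in>?A \<times> ?B. r p * (if v \<in> snd p then 1 else 0))"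
      by (rule sum_realize_map[OF fAB rs fin(3)]) auto
    finally have lk: "lev y z k v = \<dots>" .
    have CD: "y \<in> C" "v \<in> C \<Longrightarrow> y \<le> v" "v \<in> D \<Longrightarrow> v \<le> y" if "C \<in> ?A" "D \<in> ?B" for C D
    proof -
      have "C \<subseteq> P \<inter> {y..x}" "y \<in> C" "D \<subseteq> P \<inter> {z..y}" using that by (simp_all only: end_chains_iff)
      then show "y \<in> C" "v \<in> C \<Longrightarrow> y \<le> v" "v \<in> D \<Longrightarrow> v \<le> y"
        using subsetD[of C "P \<inter> {y..x}" v] subsetD[of D "P \<inter> {z..y}" v] by simp_all
    qed
    show "lev x z (F_comp P x y z (f, k)) v = glue y (lev x y f) (lev y z k) v"
    proof (cases "y \<le> v")
      case True
      have "(v \<in> C \<union> D) = (v \<in> C)" if "C \<in> ?A" "D \<in> ?B" for C D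
        using CD[OF that] True antisym[of v y] by blast
      then show ?thesis using True unfolding l by (auto simp: glue_def lf intro!: sum.cong)
    next
      case False
      have "(v \<in> C \<union> D) = (v \<in> D)" if "C \<in> ?A" "D \<in> ?B" for C D
        using CD[OF that] False by blast
      then show ?thesis using False unfolding l by (auto simp: glue_def lk intro!: sum.cong)
    qed
  qed
qed

end

section \<open>Morphism spaces are balls\<close>

context GT
begin

definition open_part :: "'a \<Rightarrow> 'a \<Rightarrow> 'a set" where
  "open_part y x = P \<inter> {y..x} - {y, x}"

definition restrict_open_part :: "'a \<Rightarrow> 'a \<Rightarrow> ('a \<Rightarrow> real) \<Rightarrow> 'a \<Rightarrow> real" where
  "restrict_open_part y x h v = (if v \<in> open_part y x then h v else 0)"

lemma facets_open_part: "F \<in> facets y x \<Longrightarrow> F \<subseteq> open_part y x"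
  unfolding facets_def open_part_def using maximal_chainD(1) by blast

lemma cone_facets_support: "h \<in> cone_complex (facets y x) \<Longrightarrow> v \<notin> open_part y x \<Longrightarrow> h v = 0"
  using facets_open_part unfolding cone_complex_def by blast

lemma restrict_open_part_bij:
  assumes P: "y \<in> P" "x \<in> P" "y < x"
  shows "bij_betw (restrict_open_part y x) (mor_functions P x y) {h \<in> cone_complex (facets y x). \<forall>v. h v \<le> 1}"
proof (rule bij_betw_byWitness[where f' = "\<lambda>h. h(x := 1, y := 1)"])
  have in1: "x \<notin> open_part y x" "y \<notin> open_part y x" by (auto simp: open_part_def)
  show "\<forall>h\<in>mor_functions P x y. (restrict_open_part y x h)(x := 1, y := 1) = h"
  proof
    fix h assume h: "h \<in> mor_functions P x y"
    note hD = mor_functionsD[OF h]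
    show "(restrict_open_part y x h)(x := 1, y := 1) = h"
      using hD(3,4) hD(5-7) by (auto simp: fun_eq_iff restrict_open_part_def open_part_def)
  qed
  show "\<forall>h\<in>{h \<in> cone_complex (facets y x). \<forall>v. h v \<le> 1}. restrict_open_part y x (h(x := 1, y := 1)) = h"
    using in1 cone_facets_support by (auto simp: fun_eq_iff restrict_open_part_def)
  show "restrict_open_part y x ` mor_functions P x y \<subseteq> {h \<in> cone_complex (facets y x). \<forall>v. h v \<le> 1}"
  proof clarify
    fix h assume h: "h \<in> mor_functions P x y"
    note hD = mor_functionsD[OF h]
    have c: "h \<in> chain_functions (P \<inter> {y..x})" using h by (simp add: mor_functions_def)
    have "x \<in> {v. h v \<noteq> 0}" using hD(3) by simp
    then have "{v. h v \<noteq> 0} \<subseteq> P \<inter> {y..x}" "{v. h v \<noteq> 0} \<noteq> {}" "is_chain {v. h v \<noteq> 0}"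
      using c unfolding chain_functions_def by blast+
    then obtain m where m: "m \<in> maximal_chains (P \<inter> {y..x})" "{v. h v \<noteq> 0} \<subseteq> m"
      by (rule extend_to_maximal_chain)
    have "{v. restrict_open_part y x h v \<noteq> 0} \<subseteq> m - {y, x}" using m(2) by (auto simp: restrict_open_part_def open_part_def)
    moreover have "m - {y, x} \<in> facets y x" using m(1) by (simp add: facets_def)
    moreover have "0 \<le> restrict_open_part y x h v" for v using hD(1) by (simp add: restrict_open_part_def)
    ultimately have "restrict_open_part y x h \<in> cone_complex (facets y x)"
      unfolding cone_complex_def by blast
    then show "restrict_open_part y x h \<in> cone_complex (facets y x) \<and> (\<forall>v. restrict_open_part y x h v \<le> 1)"
      using hD(2) by (simp add: restrict_open_part_def)
  qed
  show "(\<lambda>h. h(x := 1, y := 1)) ` {h \<in> cone_complex (facets y x). \<forall>v. h v \<le> 1} \<subseteq> mor_functions P x y"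
  proof clarify
    fix h assume h: "h \<in> cone_complex (facets y x)" "\<forall>v. h v \<le> 1"
    then obtain F where F: "F \<in> facets y x" "{v. h v \<noteq> 0} \<subseteq> F" "\<And>v. 0 \<le> h v" unfolding cone_complex_def by blast
    then obtain m where m: "m \<in> maximal_chains (P \<inter> {y..x})" "F = m - {y, x}" unfolding facets_def by blast
    have s: "{v. (h(x := 1, y := 1)) v \<noteq> 0} \<subseteq> m"
      using F(2) m(2) maximal_chain_ends(1,2)[OF P(1,2) less_imp_le[OF P(3)] m(1)] by (auto split: if_splits)
    show "h(x := 1, y := 1) \<in> mor_functions P x y"
      unfolding mor_functions_def chain_functions_def mem_Collect_eq
    proof (intro conjI)
      show "{v. (h(x := 1, y := 1)) v \<noteq> 0} \<subseteq> P \<inter> {y..x}" using s maximal_chainD(1)[OF m(1)] by (rule order_trans)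
      show "is_chain {v. (h(x := 1, y := 1)) v \<noteq> 0}" by (rule chain_subset[OF maximal_chainD(3)[OF m(1)] s])
    qed (use F(3) h(2) in auto)
  qed
qed

lemma mor_ball:
  assumes P: "y \<in> P" "x \<in> P" "y < x" and sh: "shellable (P \<inter> {y..x})"
  obtains n p \<theta> where "g x - g y - 1 = int n" "gauge n p" "piecewise_affine_on (F_Mor P x y) \<theta>"
    "bij_betw \<theta> (F_Mor P x y) (gauge.gauge_ball n p)"
    "\<And>f. f \<in> F_Mor P x y \<Longrightarrow> p (\<theta> f) = 1 \<longleftrightarrow> (\<exists>v. v \<noteq> x \<and> v \<noteq> y \<and> lev x y f v = 1)"
proof -
  let ?A = "P \<inter> {y..x}" and ?\<F> = "facets y x"
  have yx: "y \<le> x" using P by simp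
  have fA: "finite ?A" by (rule finite_interval[OF P(1,2)])
  have neA: "?A \<noteq> {}" using P by auto
  obtain n \<phi> \<psi> where n: "g x - g y - 1 = int n" and chart: "full_chart ?\<F> n \<phi> \<psi>"
    by (rule facets_chart[OF P sh]) (rule that)
  have LL\<phi>: "\<And>j. lattice_linear (\<lambda>h. \<phi> h j)" and LL\<psi>: "\<And>v. lattice_linear (\<lambda>z. \<psi> z v)"
    and \<phi>: "\<And>h. h \<in> cone_complex ?\<F> \<Longrightarrow> \<phi> h \<in> coord_space n" "\<And>h. h \<in> cone_complex ?\<F> \<Longrightarrow> \<psi> (\<phi> h) = h"
    and \<psi>: "\<And>z. z \<in> coord_space n \<Longrightarrow> \<psi> z \<in> cone_complex ?\<F>" "\<And>z. z \<in> coord_space n \<Longrightarrow> \<phi> (\<psi> z) = z"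
    using chart unfolding full_chart_def by simp_all
  \<comment> \<open>Elements outside the open part contribute 0, so that the maximum is over a
    nonempty set even if the open interval is empty; the remaining values are nonnegative.\<close>
  define p where "p z = Max ((\<lambda>v. if v \<in> open_part y x then \<psi> z v else 0) ` ?A)" for z
  have pge: "\<psi> z v \<le> p z" if "v \<in> open_part y x" for z v
    unfolding p_def using fA that by (intro Max_ge image_eqI[of _ _ v]) (auto simp: open_part_def)
  have gauge: "gauge n p"
  proof
    show "lattice_linear p" unfolding p_def[abs_def]
      by (intro lattice_linear_Max[OF fA neA] lattice_linear_if LL\<psi> lattice_linear_zero)
    fix z assume z: "z \<in> coord_space n" "z \<noteq> (\<lambda>_. 0)"
    have "\<psi> z \<noteq> (\<lambda>_. 0)"
    proof
      assume "\<psi> z = (\<lambda>_. 0)"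
      then have "z j = 0" for j using \<psi>(2)[OF z(1)] lattice_linear_0[OF LL\<phi>, of j] by metis
      then show False using z(2) by blast
    qed
    then obtain v where v: "\<psi> z v \<noteq> 0" by blast
    have "v \<in> open_part y x" using cone_facets_support[OF \<psi>(1)[OF z(1)]] v by blast
    moreover have "0 < \<psi> z v" using v \<psi>(1)[OF z(1)] unfolding cone_complex_def by (simp add: less_le)
    ultimately show "0 < p z" using pge[of v z] by simp
  qed
  let ?Q = "{h \<in> cone_complex ?\<F>. \<forall>v. h v \<le> 1}"
  have p\<phi>: "p (\<phi> h) = Max ((\<lambda>v. if v \<in> open_part y x then h v else 0) ` ?A)" if "h \<in> cone_complex ?\<F>" for h
    unfolding p_def \<phi>(2)[OF that] ..
  have b3: "bij_betw \<phi> ?Q (gauge.gauge_ball n p)"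
  proof (rule bij_betw_byWitness[where f' = \<psi>])
    show "\<phi> ` ?Q \<subseteq> gauge.gauge_ball n p"
    proof clarify
      fix h assume h: "h \<in> cone_complex ?\<F>" "\<forall>v. h v \<le> 1"
      have "p (\<phi> h) \<le> 1" unfolding p\<phi>[OF h(1)] by (rule Max.boundedI) (use fA neA h(2) in auto)
      then show "\<phi> h \<in> gauge.gauge_ball n p" using \<phi>(1)[OF h(1)] by (simp add: gauge.gauge_ball_def[OF gauge])
    qed
    show "\<psi> ` gauge.gauge_ball n p \<subseteq> ?Q"
    proof clarify
      fix z assume "z \<in> gauge.gauge_ball n p"
      then have z: "z \<in> coord_space n" "p z \<le> 1" by (auto simp: gauge.gauge_ball_def[OF gauge])
      have "\<psi> z v \<le> 1" for v
        using pge[of v z] z(2) cone_facets_support[OF \<psi>(1)[OF z(1)], of v] by (cases "v \<in> open_part y x") auto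
      then show "\<psi> z \<in> cone_complex ?\<F> \<and> (\<forall>v. \<psi> z v \<le> 1)" using \<psi>(1)[OF z(1)] by blast
    qed
  qed (use \<phi>(2) \<psi>(2) in \<open>auto simp: gauge.gauge_ball_def[OF gauge]\<close>)
  define \<theta> where "\<theta> f = \<phi> (restrict_open_part y x (lev x y f))" for f
  note b1 = lev_bij[OF P(2,1) yx] and b2 = restrict_open_part_bij[OF P]
  have b: "bij_betw \<theta> (F_Mor P x y) (gauge.gauge_ball n p)"
    using bij_betw_trans[OF bij_betw_trans[OF b1 b2] b3] by (simp add: \<theta>_def[abs_def] o_def)
  have rl: "restrict_open_part y x (lev x y f) \<in> cone_complex ?\<F>" if "f \<in> F_Mor P x y" for f
    using bij_betwE[OF b2] lev_in[OF P(2,1) that] by blast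
  have "linear (restrict_open_part y x)"
    by (rule linearI) (auto simp: restrict_open_part_def fun_eq_iff scaleR_fun_def)
  then have pa1: "piecewise_affine_on (F_Mor P x y) (\<lambda>f. restrict_open_part y x (lev x y f))"
    by (rule piecewise_affine_on_linear_comp[OF _ piecewise_affine_on_linear[OF linear_level]])
  have pa2: "piecewise_affine_on (cone_complex ?\<F>) \<phi>"
    by (rule piecewise_affine_on_coordinatewise[of "{..<n}"])
       (use \<phi>(1) lattice_linear_piecewise_affine[OF LL\<phi>] in auto)
  have "(\<lambda>f. restrict_open_part y x (lev x y f)) ` F_Mor P x y \<subseteq> cone_complex ?\<F>"
    using rl by blast
  from piecewise_affine_on_comp[OF pa1 this pa2]
  have pa: "piecewise_affine_on (F_Mor P x y) \<theta>" by (simp add: \<theta>_def[abs_def])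
  have bd: "p (\<theta> f) = 1 \<longleftrightarrow> (\<exists>v. v \<noteq> x \<and> v \<noteq> y \<and> lev x y f v = 1)" if f: "f \<in> F_Mor P x y" for f
  proof -
    let ?h = "lev x y f"
    note hD = mor_functionsD[OF lev_in[OF P(2,1) f]]
    let ?S = "(\<lambda>v. if v \<in> open_part y x then ?h v else 0) ` ?A"
    have pf: "p (\<theta> f) = Max ?S" unfolding \<theta>_def p\<phi>[OF rl[OF f]] by (simp add: restrict_open_part_def cong: if_cong)
    show ?thesis
    proof
      assume one: "p (\<theta> f) = 1"
      have "Max ?S \<in> ?S" by (rule Max_in) (use fA neA in auto)
      then have "1 \<in> ?S" unfolding pf[symmetric] one .
      then obtain v where "v \<in> ?A" "(if v \<in> open_part y x then ?h v else 0) = 1" by force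
      then have "v \<in> open_part y x" "?h v = 1" by (auto split: if_splits)
      then show "\<exists>v. v \<noteq> x \<and> v \<noteq> y \<and> ?h v = 1" by (auto simp: open_part_def)
    next
      assume "\<exists>v. v \<noteq> x \<and> v \<noteq> y \<and> ?h v = 1"
      then obtain v where v: "v \<noteq> x" "v \<noteq> y" "?h v = 1" by blast
      have vA: "v \<in> open_part y x" using hD(5-7)[of v] v by (auto simp: open_part_def)
      have "Max ?S = 1"
      proof (rule Max_eqI)
        show "finite ?S" using fA by simp
        show "w \<le> 1" if "w \<in> ?S" for w using that hD(2) by auto
        show "1 \<in> ?S" using vA v(3) by (intro image_eqI[of _ _ v]) (auto simp: open_part_def)
      qed
      then show "p (\<theta> f) = 1" using pf by simp
    qed
  qed
  show ?thesis by (rule that[OF n gauge pa b bd])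
qed

section \<open>Axioms of the flow category\<close>

lemma F_Mor_compact: "x \<in> P \<Longrightarrow> y \<in> P \<Longrightarrow> compact_polyhedron (F_Mor P x y)"
  unfolding F_Mor_def by (intro order_space_compact_polyhedron finite_end_chains finite_interval)

lemma F_ident_in: "x \<in> P \<Longrightarrow> F_ident x \<in> F_Mor P x x"
proof -
  assume x: "x \<in> P"
  have E: "end_chains P x x = {{x}}" using x by (auto simp: end_chains_iff intro!: is_chainI)
  have s: "{C. F_ident x C \<noteq> 0} = {{x}}" by (auto simp: F_ident_def)
  show ?thesis unfolding F_Mor_def using order_space_iff[OF finite_end_chains[OF finite_interval[OF x x]], of "F_ident x"]
    unfolding E s by (auto simp: F_ident_def intro!: is_chainI)
qed

lemma mor_functions_self: "h \<in> mor_functions P x x \<Longrightarrow> h = (\<lambda>v. if v = x then 1 else 0)"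
  using mor_functionsD(3,6,7)[of h x x] by (auto simp: fun_eq_iff intro: antisym)

lemma F_Mor_self: assumes "x \<in> P" shows "F_Mor P x x = {F_ident x}"
proof -
  have "f = F_ident x" if f: "f \<in> F_Mor P x x" for f
    using mor_functions_self[OF lev_in[OF assms assms f]]
      mor_functions_self[OF lev_in[OF assms assms F_ident_in[OF assms]]]
      lev_inj[OF assms assms f F_ident_in[OF assms]] by simp
  then show ?thesis using F_ident_in[OF assms] by blast
qed

lemma F_comp_ident:
  assumes "x \<in> P" "y \<in> P" "f \<in> F_Mor P x y"
  shows "F_comp P x x y (F_ident x, f) = f" "F_comp P x y y (f, F_ident y) = f"
proof -
  note i = F_ident_in[OF assms(1)] F_ident_in[OF assms(2)]
  note hD = mor_functionsD[OF lev_in[OF assms]]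
  have le: "lev x x (F_ident x) = (\<lambda>v. if v = x then 1 else 0)" "lev y y (F_ident y) = (\<lambda>v. if v = y then 1 else 0)"
    using mor_functions_self lev_in assms(1,2) i by blast+
  note c1 = F_comp_level[OF assms(1,1,2) i(1) assms(3)] and c2 = F_comp_level[OF assms(1,2,2) assms(3) i(2)]
  have "glue x (\<lambda>v. if v = x then 1 else 0) (lev x y f) = lev x y f"
    using hD(3,7) by (auto simp: fun_eq_iff glue_def dest: antisym)
  then show "F_comp P x x y (F_ident x, f) = f" using lev_inj[OF assms(1,2) c1(1) assms(3)] c1(2) le by simp
  have "glue y (lev x y f) (\<lambda>v. if v = y then 1 else 0) = lev x y f"
    using hD(6) by (auto simp: fun_eq_iff glue_def)
  then show "F_comp P x y y (f, F_ident y) = f" using lev_inj[OF assms(1,2) c2(1) assms(3)] c2(2) le by simp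
qed

lemma F_comp_assoc:
  assumes P: "w \<in> P" "x \<in> P" "y \<in> P" "z \<in> P" and f: "f \<in> F_Mor P w x" "k \<in> F_Mor P x y" "l \<in> F_Mor P y z"
  shows "F_comp P w y z (F_comp P w x y (f, k), l) = F_comp P w x z (f, F_comp P x y z (k, l))"
proof -
  note fk = F_comp_level[OF P(1-3) f(1,2)] and kl = F_comp_level[OF P(2-4) f(2,3)]
  note a = F_comp_level[OF P(1,3,4) fk(1) f(3)] and b = F_comp_level[OF P(1,2,4) f(1) kl(1)]
  have "y \<le> x" using F_Mor_le[OF f(2)] .
  then have "glue y (glue x (lev w x f) (lev x y k)) (lev y z l) = glue x (lev w x f) (glue y (lev x y k) (lev y z l))"
    by (auto simp: fun_eq_iff glue_def dest: order.trans)
  then show ?thesis using lev_inj[OF P(1,4) a(1) b(1)] a(2) b(2) fk(2) kl(2) by simp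
qed

lemma piecewise_affine_on_empty: "piecewise_affine_on {} f"
  by (rule piecewise_affine_onI) (auto intro!: exI[of _ "{}"])

text \<open>Conjugated with the level maps, composition is the linear gluing map, and the inverse of
  a level map is piecewise affine because morphism spaces are compact polyhedra. Gluing is injective
  since each factor is recovered on its own side of \<open>y\<close>.\<close>

lemma F_comp_embedding:
  assumes P: "x \<in> P" "y \<in> P" "z \<in> P"
  shows "pl_embedding (F_comp P x y z) (F_Mor P x y \<times> F_Mor P y z) (F_Mor P x z)"
proof -
  let ?X = "F_Mor P x y \<times> F_Mor P y z" and ?c = "F_comp P x y z"
  have X: "compact_polyhedron ?X" by (intro compact_polyhedron_Times F_Mor_compact P)
  have im: "?c ` ?X \<subseteq> F_Mor P x z" using F_comp_level(1)[OF P] by auto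
  have "piecewise_affine_on ?X ?c \<and> inj_on ?c ?X"
  proof (cases "?X = {}")
    case True
    show ?thesis unfolding True by (simp add: piecewise_affine_on_empty)
  next
    case False
    then obtain f0 k0 where f0: "f0 \<in> F_Mor P x y" "k0 \<in> F_Mor P y z" by blast
    note le = F_Mor_le[OF f0(1)] F_Mor_le[OF f0(2)]
    then have zx: "z \<le> x" by auto
    let ?G = "\<lambda>q. glue y (lev x y (fst q)) (lev y z (snd q))"
    have "linear (\<lambda>(h, k). glue y h k :: 'a \<Rightarrow> real)"
      by (rule linearI) (auto simp: glue_def fun_eq_iff scaleR_fun_def)
    then have G: "piecewise_affine_on ?X ?G"
      by (rule piecewise_affine_on_linear2[OF
          piecewise_affine_on_linear_comp[OF linear_level piecewise_affine_on_linear[OF linear_fst]]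
          piecewise_affine_on_linear_comp[OF linear_level piecewise_affine_on_linear[OF linear_snd]]])
    note b = lev_bij[OF P(1,3) zx]
    have i: "piecewise_affine_on (mor_functions P x z) (inv_into (F_Mor P x z) (lev x z))"
      using piecewise_affine_on_inverse[OF F_Mor_compact[OF P(1,3)] piecewise_affine_on_linear[OF linear_level[of "P \<inter> {z..x}"]]] b
      by (simp add: bij_betw_def)
    have Gc: "lev x z (?c q) = ?G q" "?c q \<in> F_Mor P x z" if "q \<in> ?X" for q
      using F_comp_level[OF P, of "fst q" "snd q"] that by auto
    have GX: "?G ` ?X \<subseteq> mor_functions P x z" 
    proof
      fix h assume "h \<in> ?G ` ?X"
      then obtain q where q: "q \<in> ?X" "h = ?G q" by blast
      show "h \<in> mor_functions P x z"
        using lev_in[OF P(1,3) Gc(2)[OF q(1)]] unfolding q(2) Gc(1)[OF q(1)] .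
    qed
    have "piecewise_affine_on ?X (\<lambda>q. inv_into (F_Mor P x z) (lev x z) (?G q))"
      by (rule piecewise_affine_on_comp[OF G GX i])
    then have "piecewise_affine_on ?X ?c"
    proof (rule piecewise_affine_on_cong)
      fix q assume q: "q \<in> ?X"
      show "inv_into (F_Mor P x z) (lev x z) (?G q) = ?c q"
        unfolding Gc(1)[OF q, symmetric] using b Gc(2)[OF q] by (simp add: bij_betw_def inv_into_f_f)
    qed
    moreover have "inj_on ?c ?X"
    proof (rule inj_onI)
      fix q r assume qr: "q \<in> ?X" "r \<in> ?X" "?c q = ?c r"
      obtain f k f' k' where q: "q = (f, k)" "r = (f', k')" by (metis surj_pair)
      have fk: "f \<in> F_Mor P x y" "k \<in> F_Mor P y z" "f' \<in> F_Mor P x y" "k' \<in> F_Mor P y z" using qr q by auto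
      have e: "glue y (lev x y f) (lev y z k) v = glue y (lev x y f') (lev y z k') v" for v
        using Gc(1)[OF qr(1)] Gc(1)[OF qr(2)] qr(3) q by simp
      note fD = mor_functionsD[OF lev_in[OF P(1,2) fk(1)]] and f'D = mor_functionsD[OF lev_in[OF P(1,2) fk(3)]]
      note kD = mor_functionsD[OF lev_in[OF P(2,3) fk(2)]] and k'D = mor_functionsD[OF lev_in[OF P(2,3) fk(4)]]
      have "lev x y f v = lev x y f' v" for v
      proof (cases "y \<le> v")
        case False
        then have "lev x y f v = 0" "lev x y f' v = 0" using fD(6)[of v] f'D(6)[of v] by blast+
        then show ?thesis by simp
      qed (use e[of v] in \<open>simp add: glue_def\<close>)
      moreover have "lev y z k v = lev y z k' v" for v
      proof (cases "y \<le> v")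
        case True
        show ?thesis
        proof (cases "v = y")
          case False
          then have "\<not> v \<le> y" using True antisym by blast
          then have "lev y z k v = 0" "lev y z k' v = 0" using kD(7)[of v] k'D(7)[of v] by blast+
          then show ?thesis by simp
        qed (use kD(3) k'D(3) in simp)
      qed (use e[of v] in \<open>simp add: glue_def\<close>)
      ultimately have "lev x y f = lev x y f'" "lev y z k = lev y z k'" by blast+
      then show "q = r" using q lev_inj[OF P(1,2) fk(1,3)] lev_inj[OF P(2,3) fk(2,4)] by simp
    qed
    ultimately show ?thesis by blast
  qed
  then have "pl_map ?c ?X (F_Mor P x z)" "pl_homeomorphism ?c ?X (?c ` ?X)"
    using im X by (auto intro!: pl_mapI compact_imp_pl_polyhedron compact_pl_homeomorphism F_Mor_compact P)
  then show ?thesis unfolding pl_embedding_def by blast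
qed

text \<open>A function with level 1 at \<open>y\<close> can be cut there, both halves having the
  value 1 at their ends; nothing is lost, as the support is a chain through
  \<open>y\<close>.\<close>

lemma comp_image:
  assumes P: "x \<in> P" "y \<in> P" "z \<in> P" and f: "f \<in> F_Mor P x z" and fy: "lev x z f y = 1"
  shows "f \<in> F_comp P x y z ` (F_Mor P x y \<times> F_Mor P y z)"
proof -
  let ?h = "lev x z f"
  note hD = mor_functionsD[OF lev_in[OF P(1,3) f]]
  have zyx: "z \<le> y" "y \<le> x" using hD(6,7)[of y] fy by auto
  let ?a = "\<lambda>v. if y \<le> v then ?h v else 0" and ?b = "\<lambda>v. if v \<le> y then ?h v else 0"
  have "?a \<in> mor_functions P x y"
  proof (rule mor_functionsI)
    show "0 \<le> ?a v" "?a v \<le> 1" for v using hD(1,2) by simp_all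
    show "?a x = 1" "?a y = 1" using hD(3) fy zyx by simp_all
    show "v \<in> P \<and> y \<le> v \<and> v \<le> x" if "?a v \<noteq> 0" for v
      using that hD(5,7)[of v] by (simp split: if_splits)
    show "u \<le> v \<or> v \<le> u" if "?a u \<noteq> 0" "?a v \<noteq> 0" for u v
      using that hD(8)[of u v] by (simp split: if_splits)
  qed
  then obtain f1 where f1: "f1 \<in> F_Mor P x y" "lev x y f1 = ?a" by (rule lev_surj[OF P(1,2) zyx(2)]) (rule that)
  have "?b \<in> mor_functions P y z"
  proof (rule mor_functionsI)
    show "0 \<le> ?b v" "?b v \<le> 1" for v using hD(1,2) by simp_all
    show "?b y = 1" "?b z = 1" using hD(4) fy zyx by simp_all
    show "v \<in> P \<and> z \<le> v \<and> v \<le> y" if "?b v \<noteq> 0" for v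
      using that hD(5,6)[of v] by (simp split: if_splits)
    show "u \<le> v \<or> v \<le> u" if "?b u \<noteq> 0" "?b v \<noteq> 0" for u v
      using that hD(8)[of u v] by (simp split: if_splits)
  qed
  then obtain f2 where f2: "f2 \<in> F_Mor P y z" "lev y z f2 = ?b" by (rule lev_surj[OF P(2,3) zyx(1)]) (rule that)
  note c = F_comp_level[OF P f1(1) f2(1)]
  have "glue y ?a ?b = ?h" using hD(8)[of _ y] fy by (auto simp: fun_eq_iff glue_def)
  then have "F_comp P x y z (f1, f2) = f" using lev_inj[OF P(1,3) c(1) f] c(2) f1(2) f2(2) by simp
  then show ?thesis using f1(1) f2(1) by (metis SigmaI imageI)
qed

end

lemma pl_manifold_empty: "pl_manifold n ({} :: 'a::{real_vector,topological_space} set)"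
proof -
  have "second_countable (top_of_set ({} :: 'a set))"
    unfolding second_countable_def by (rule exI[of _ "{}"]) auto
  then show ?thesis by (simp add: pl_manifold_def pl_polyhedron_def)
qed

theorem theorem5p1:
  fixes P :: "'a::order set" and g :: "'a \<Rightarrow> int"
  assumes "GT_poset P g"
    and "\<And>a b. \<lbrakk>a \<in> P; b \<in> P; a \<le> b\<rbrakk> \<Longrightarrow> shellable (P \<inter> {a..b})"
  shows "pl_flow_category P g (F_Mor P) F_ident (F_comp P) \<and>
    (\<forall>x\<in>P. \<forall>y\<in>P. y < x \<longrightarrow> (\<exists>n. pl_homeomorphic (F_Mor P x y) (pl_cube n)))"
proof -
  interpret GT P g by (rule GT.intro[OF assms(1)])
  \<comment> \<open>The boundary is stated as the points with level 1 strictly inside the interval: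
    \<open>F_comp_level\<close> shows that composites have this property, and
    \<open>comp_image\<close> factors every such point.\<close>
  have ball: "pl_manifold (g x - g y - 1) (F_Mor P x y) \<and>
      pl_boundary (g x - g y - 1) (F_Mor P x y) = {f \<in> F_Mor P x y. \<exists>v. v \<noteq> x \<and> v \<noteq> y \<and> lev x y f v = 1} \<and>
      (\<exists>n. pl_homeomorphic (F_Mor P x y) (pl_cube n))"
    if P: "x \<in> P" "y \<in> P" "y < x" for x y
  proof -
    obtain n p \<theta> where *: "g x - g y - 1 = int n" "gauge n p" "piecewise_affine_on (F_Mor P x y) \<theta>"
      "bij_betw \<theta> (F_Mor P x y) (gauge.gauge_ball n p)"
      "\<And>f. f \<in> F_Mor P x y \<Longrightarrow> p (\<theta> f) = 1 \<longleftrightarrow> (\<exists>v. v \<noteq> x \<and> v \<noteq> y \<and> lev x y f v = 1)"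
      by (rule mor_ball[OF P(2,1,3) assms(2)[OF P(2,1) less_imp_le[OF P(3)]]]) (rule that)
    interpret gauge n p by (rule *(2))
    note F = F_Mor_compact[OF P(1,2)] *(3,4)
    show ?thesis
      unfolding *(1) ball_boundary[OF F] using ball_manifold[OF F] ball_cube[OF F] *(5) by blast
  qed
  have "pl_flow_category P g (F_Mor P) F_ident (F_comp P)"
  proof
    fix x y z
    assume P: "x \<in> P" "y \<in> P" "z \<in> P"
    show "pl_embedding (F_comp P x y z) (F_Mor P x y \<times> F_Mor P y z) (F_Mor P x z)"
      by (rule F_comp_embedding[OF P])
    show "F_comp P x y z (f, k) \<in> F_Mor P x z" if "f \<in> F_Mor P x y" "k \<in> F_Mor P y z" for f k
      by (rule F_comp_level(1)[OF P that])
    assume d: "x \<noteq> y" "y \<noteq> z" "x \<noteq> z"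
    show "F_comp P x y z ` (F_Mor P x y \<times> F_Mor P y z) \<subseteq> pl_boundary (g x - g z - 1) (F_Mor P x z)"
    proof clarify
      fix f k assume fk: "f \<in> F_Mor P x y" "k \<in> F_Mor P y z"
      have "z \<le> x" using F_Mor_le[OF fk(1)] F_Mor_le[OF fk(2)] by auto
      then have zx: "z < x" using d by (simp add: less_le)
      note c = F_comp_level[OF P fk]
      have "lev x z (F_comp P x y z (f, k)) y = 1"
        using mor_functionsD(4)[OF lev_in[OF P(1,2) fk(1)]] by (simp add: c(2) glue_def)
      then show "F_comp P x y z (f, k) \<in> pl_boundary (g x - g z - 1) (F_Mor P x z)"
        using ball[OF P(1,3) zx] c(1) d by auto
    qed
  next
    fix x y assume P: "x \<in> P" "y \<in> P"
    show "F_comp P x x y (F_ident x, f) = f" "F_comp P x y y (f, F_ident y) = f" if "f \<in> F_Mor P x y" for f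
      by (rule F_comp_ident[OF P that])+
    assume xy: "x \<noteq> y"
    show "pl_manifold (g x - g y - 1) (F_Mor P x y)"
    \<comment> \<open>If \<open>y \<le> x\<close> fails, the space is empty and counts as a manifold
      of whatever dimension the grading prescribes.\<close>
    proof (cases "y \<le> x")
      case True
      then show ?thesis using ball[OF P] xy by (simp add: less_le)
    qed (simp add: F_Mor_empty pl_manifold_empty)
    fix f assume f: "f \<in> pl_boundary (g x - g y - 1) (F_Mor P x y)"
    then have fM: "f \<in> F_Mor P x y" by (simp add: pl_boundary_def)
    then have "y < x" using F_Mor_le xy by (simp add: less_le)
    then obtain v where v: "v \<noteq> x" "v \<noteq> y" "lev x y f v = 1" using ball[OF P] f by blast
    have "v \<in> P" using mor_functionsD(5)[OF lev_in[OF P fM], of v] v(3) by simp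
    then show "\<exists>v\<in>P - {x, y}. f \<in> F_comp P x v y ` (F_Mor P x v \<times> F_Mor P v y)"
      using comp_image[OF P(1) _ P(2) fM v(3)] v by blast
  next
    fix x assume "x \<in> P"
    then show "F_ident x \<in> F_Mor P x x" "F_Mor P x x = {F_ident x}" by (simp_all add: F_Mor_self)
  qed (rule F_comp_assoc)
  then show ?thesis using ball by blast
qed

end
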